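(* Let $\alpha>0$ be a sufficiently small absolute constant, and let $\epsilon\in(0,1]$ and $\delta\in(0,1/2]$ satisfy $\delta\le O\left(\frac{1}{nd^2}\right)$. Then any $\alpha$-accurate $(\epsilon,\delta)$-differentially private sampler, with sample complexity $n$, for the class $\{\mathsf{N}(\mu,\Sigma)\mid\mu\in\mathbb{R}^d,\ I\preceq\Sigma\preceq 2I\}$ (with $\mu,\Sigma$ unknown) must satisfy $n=\Omega\left(\frac{d}{\epsilon\sqrt{\log d}}\right)$.
   Context: $A\preceq B$ means $B-A$ is positive semidefinite. $\mathsf{N}(\mu,\Sigma)$ is the Gaussian with density proportional to $\exp(-\frac12(x-\mu)^T\Sigma^{-1}(x-\mu))$. A sampler with sample complexity $n$ for a class $\mathcal{D}$ is an algorithm $\mathcal{A}$ that receives $n$ i.i.d. samples $\mathbf{X}\sim D^n$ from an unknown $D\in\mathcal{D}$ and outputs one element of the domain; with $Q_{\mathcal{A},D}$ the distribution of $\mathcal{A}(\mathbf{X})$, it is $\alpha$-accurate if $d_{\mathrm{tv}}(D,Q_{\mathcal{A},D})\le\alpha$ for all $D\in\mathcal{D}$. Datasets are neighbors if they have the same size and differ in one element. $\mathcal{M}$ is $(\epsilon,\delta)$-DP if for all neighbors $Y,Y'$ and all output sets $S$, $\Pr[\mathcal{M}(Y)\in S]\le e^\epsilon\Pr[\mathcal{M}(Y')\in S]+\delta$. *)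

theory Defs
  imports
    "HOL-Probability.Probability"
    "Jordan_Normal_Form.Gauss_Jordan_Elimination"
begin

text \<open>
  The dimension has to be an ordinary number, because it is quantified after the absolute
  constants. Points of $\mathbb{R}^d$ are therefore extensional functions on
  \<open>{..<d}\<close>; mean vectors and matrices are those of \<open>Jordan_Normal_Form\<close>.
\<close>

definition euclid :: "nat \<Rightarrow> (nat \<Rightarrow> real) measure" where
  "euclid d = (\<Pi>\<^sub>M i\<in>{..<d}. lborel)"

definition pos_semidef :: "nat \<Rightarrow> real mat \<Rightarrow> bool" where
  "pos_semidef d A \<longleftrightarrow> A \<in> carrier_mat d d \<and> transpose_mat A = A \<and>
     (\<forall>v\<in>carrier_vec d. 0 \<le> scalar_prod v (A *\<^sub>v v))"

definition loewner_le :: "nat \<Rightarrow> real mat \<Rightarrow> real mat \<Rightarrow> bool" where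
  "loewner_le d A B \<longleftrightarrow> A \<in> carrier_mat d d \<and> B \<in> carrier_mat d d \<and> pos_semidef d (B - A)"

definition gaussian_weight :: "nat \<Rightarrow> real Matrix.vec \<Rightarrow> real mat \<Rightarrow> (nat \<Rightarrow> real) \<Rightarrow> real" where
  "gaussian_weight d \<mu> \<Sigma> x =
     (let z = Matrix.vec d x - \<mu> in exp (- (1 / 2) * scalar_prod z (the (mat_inverse \<Sigma>) *\<^sub>v z)))"

text \<open>Only meaningful for a positive definite \<open>\<Sigma>\<close>, where the normalising integral is
  finite and positive.\<close>

definition gaussian :: "nat \<Rightarrow> real Matrix.vec \<Rightarrow> real mat \<Rightarrow> (nat \<Rightarrow> real) measure" where
  "gaussian d \<mu> \<Sigma> = density (euclid d)
     (\<lambda>x. ennreal (gaussian_weight d \<mu> \<Sigma> x / (\<integral>y. gaussian_weight d \<mu> \<Sigma> y \<partial>euclid d)))"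

definition gaussian_class :: "nat \<Rightarrow> (nat \<Rightarrow> real) measure set" where
  "gaussian_class d = {gaussian d \<mu> \<Sigma> | \<mu> \<Sigma>. \<mu> \<in> carrier_vec d \<and> \<Sigma> \<in> carrier_mat d d \<and>
     loewner_le d (1\<^sub>m d) \<Sigma> \<and> loewner_le d \<Sigma> (2 \<cdot>\<^sub>m 1\<^sub>m d)}"

definition tv_dist :: "'a measure \<Rightarrow> 'a measure \<Rightarrow> real" where
  "tv_dist P Q = (SUP S\<in>sets P. \<bar>measure P S - measure Q S\<bar>)"

abbreviation datasets :: "nat \<Rightarrow> 'a measure \<Rightarrow> (nat \<Rightarrow> 'a) measure" where
  "datasets n M \<equiv> (\<Pi>\<^sub>M i\<in>{..<n}. M)"

text \<open>A randomized algorithm is a Markov kernel from datasets to single elements of the domain.\<close>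

definition randomized_alg :: "nat \<Rightarrow> 'a measure \<Rightarrow> ((nat \<Rightarrow> 'a) \<Rightarrow> 'a measure) \<Rightarrow> bool" where
  "randomized_alg n M A \<longleftrightarrow> A \<in> datasets n M \<rightarrow>\<^sub>M prob_algebra M"

definition output_dist :: "nat \<Rightarrow> ((nat \<Rightarrow> 'a) \<Rightarrow> 'a measure) \<Rightarrow> 'a measure \<Rightarrow> 'a measure" where
  "output_dist n A D = Giry_Monad.bind (datasets n D) A"

definition accurate_sampler ::
  "nat \<Rightarrow> 'a measure \<Rightarrow> 'a measure set \<Rightarrow> real \<Rightarrow> ((nat \<Rightarrow> 'a) \<Rightarrow> 'a measure) \<Rightarrow> bool" where
  "accurate_sampler n M \<D> \<alpha> A \<longleftrightarrow> randomized_alg n M A \<and>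
     (\<forall>D\<in>\<D>. tv_dist D (output_dist n A D) \<le> \<alpha>)"

definition neighbors :: "nat \<Rightarrow> (nat \<Rightarrow> 'a) \<Rightarrow> (nat \<Rightarrow> 'a) \<Rightarrow> bool" where
  "neighbors n Y Y' \<longleftrightarrow> card {i. i < n \<and> Y i \<noteq> Y' i} = 1"

definition diff_private ::
  "nat \<Rightarrow> 'a measure \<Rightarrow> real \<Rightarrow> real \<Rightarrow> ((nat \<Rightarrow> 'a) \<Rightarrow> 'a measure) \<Rightarrow> bool" where
  "diff_private n M \<epsilon> \<delta> A \<longleftrightarrow>
     (\<forall>Y\<in>space (datasets n M). \<forall>Y'\<in>space (datasets n M). neighbors n Y Y' \<longrightarrow>
        (\<forall>S\<in>sets M. measure (A Y) S \<le> exp \<epsilon> * measure (A Y') S + \<delta>))"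

end

theory Submission
  imports Defs
begin

text \<open>
  The hard distributions come from linear regression: the first \<open>m = d div 2\<close> coordinates
  \<open>y\<close> of a point are centred Gaussian, the remaining ones are \<open>B y\<close> plus independent noise
  of the same variance, and the entries of the hidden matrix \<open>B\<close> are independent and uniform
  on \<open>[-b, b]\<close> with \<open>b\<close> of order \<open>1 / d\<close>. The Frobenius norm of \<open>B\<close> is then of
  constant size, which keeps the covariance between \<open>I\<close> and \<open>2I\<close>, yet the bilinear form
  \<open>T B z\<close> of an honest draw \<open>z\<close> has a mean comparable with its standard deviation.
  Hence an accurate sampler gives a definite positive value to a bounded odd function \<open>zeta B\<close>
  of \<open>T B z\<close>.

  Integrating by parts in every entry of \<open>B\<close> turns the average of \<open>zeta B\<close> over the prior
  into a sum over the samples of a bilinear correlation \<open>Phi B z x\<close> between the output \<open>z\<close>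
  and one sample \<open>x\<close>. If that sample is replaced by a fixed point before the algorithm is run,
  the correlation has mean zero and size \<open>b^2 * d\<close>, so privacy bounds each summand by
  \<open>\<epsilon> * b^2 * d\<close> up to a term in \<open>\<delta>\<close>. Since the whole sum must be of order
  \<open>b^2 * d^2\<close>, at least \<open>d / \<epsilon>\<close> samples are needed up to a constant factor.
\<close>

section \<open>Gaussian integrals and domination of measures\<close>

text \<open>Accuracy in total variation controls only bounded statistics of one output, and a
  private algorithm may output any point at all. So the statistic is damped, and outputs are cut off
  at squared length of order d; the numbers 20 in \<open>good\<close> and 1/40 in
  \<open>b * d <= 1/40\<close> are chosen so that a fixed share of the second moment of
  \<open>T\<close> survives both losses. The prior is uniform rather than Gaussian because every
  matrix in its support must lie in the class, and because its Stein kernel (b^2 - t^2)/2 is a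
  bounded polynomial. The regression model is a unipotent shear of white noise: the normalising
  constant does not depend on \<open>B\<close>, the likelihood ratio against \<open>B = 0\<close> is
  explicit, and the score of an honest sample is a bilinear form in the unsheared noise. All laws
  are reweightings of one fixed measure, so averages over \<open>B\<close> and over samples can be
  exchanged. For a fixed output the entries of the score are orthogonal, which gives the size b^2 d.
  Privacy with a \<delta> term needs a bound uniform in the output, which costs b^2 d^3, but that
  bound is multiplied by \<delta> only. The logarithm is introduced only at the very end.\<close>

text \<open>The variance is the midpoint of the interval [1, 2] allowed for the covariance.\<close>

definition nu :: "real measure" where
  "nu = density lborel (\<lambda>x. ennreal (normal_density 0 (sqrt (3/2)) x))"

lemma space_nu [simp]: "space nu = UNIV"
  and sets_nu [simp, measurable_cong]: "sets nu = sets borel"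
  by (simp_all add: nu_def)

lemma prob_space_nu: "prob_space nu"
  unfolding nu_def by (intro prob_space_normal_density) auto

lemma integrable_nu_power: "integrable nu (\<lambda>x. x ^ k)"
  unfolding nu_def using integrable_normal_moment[of "sqrt (3/2)" 0 k]
  by (subst integrable_density) (auto simp: mult.commute)

lemma integral_nu: "f \<in> borel_measurable borel \<Longrightarrow>
   (\<integral>x. f x \<partial>nu) = (\<integral>x. normal_density 0 (sqrt (3/2)) x * f x \<partial>lborel)" for f :: "real \<Rightarrow> real"
  unfolding nu_def by (subst integral_density) auto

lemma nu_moments:
  "(\<integral>x. x \<partial>nu) = 0" "(\<integral>x. x ^ 2 \<partial>nu) = 3 / 2" "(\<integral>x. x ^ 4 \<partial>nu) = 27 / 4"
proof -
  have *: "sqrt (3/2) ^ 2 = 3/(2::real)" by simp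
  show "(\<integral>x. x \<partial>nu) = 0"
    using integral_normal_moment_odd[of "sqrt (3/2)" 0 0] by (simp add: integral_nu)
  show "(\<integral>x. x ^ 2 \<partial>nu) = 3 / 2"
    using integral_normal_moment_even[of "sqrt (3/2)" 0 1] by (simp add: integral_nu)
  show "(\<integral>x. x ^ 4 \<partial>nu) = 27 / 4"
    using integral_normal_moment_even[of "sqrt (3/2)" 0 2]
    by (simp add: integral_nu fact_numeral power2_eq_square)
qed

text \<open>The Cameron-Martin formula in one dimension: for variance 3/2, shifting the law by
  \<open>u\<close> multiplies the density by exp(y u / (3/2) - u^2 / (2 * 3/2)).\<close>

lemma nn_integral_nu_shift:
  assumes [measurable]: "g \<in> borel_measurable borel"
  shows "(\<integral>\<^sup>+ y. ennreal (exp (2/3 * y * u - u\<^sup>2 / 3)) * g y \<partial>nu) = (\<integral>\<^sup>+ y. g (y + u) \<partial>nu)"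
proof -
  have e: "normal_density 0 (sqrt (3/2)) y * exp (2/3 * y * u - u\<^sup>2 / 3)
      = normal_density 0 (sqrt (3/2)) (y - u)" for y
    by (simp add: normal_density_def exp_add[symmetric] field_simps power2_eq_square)
  have "(\<integral>\<^sup>+ y. ennreal (exp (2/3 * y * u - u\<^sup>2 / 3)) * g y \<partial>nu) =
     (\<integral>\<^sup>+ y. ennreal (normal_density 0 (sqrt (3/2)) (y - u)) * g y \<partial>lborel)"
    unfolding nu_def
    by (subst nn_integral_density) (auto simp: e[symmetric] ennreal_mult mult.assoc)
  also have "\<dots> = (\<integral>\<^sup>+ y. ennreal (normal_density 0 (sqrt (3/2)) y) * g (y + u) \<partial>lborel)"
    by (subst nn_integral_real_affine[where c=1 and t=u]) (auto simp: add.commute)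
  also have "\<dots> = (\<integral>\<^sup>+ y. g (y + u) \<partial>nu)"
    unfolding nu_def by (subst nn_integral_density) auto
  finally show ?thesis .
qed

lemma nn_integral_nu_minus:
  assumes [measurable]: "g \<in> borel_measurable borel"
  shows "(\<integral>\<^sup>+ y. g (- y) \<partial>nu) = (\<integral>\<^sup>+ y. g y \<partial>nu)"
proof -
  have "(\<integral>\<^sup>+ y. g y \<partial>nu) = (\<integral>\<^sup>+ y. ennreal (normal_density 0 (sqrt (3/2)) y) * g y \<partial>lborel)"
    unfolding nu_def by (subst nn_integral_density) auto
  also have "\<dots> = (\<integral>\<^sup>+ y. ennreal (normal_density 0 (sqrt (3/2)) y) * g (- y) \<partial>lborel)"
    by (subst nn_integral_real_affine[where c="-1" and t=0]) (auto simp: normal_density_def)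
  also have "\<dots> = (\<integral>\<^sup>+ y. g (- y) \<partial>nu)"
    unfolding nu_def by (subst nn_integral_density) auto
  finally show ?thesis ..
qed

text \<open>Layer cake: \<open>f\<close> is the integral of the indicators of its superlevel sets,
  and only the levels in [0, M) matter, so the additive error \<delta> is paid M times. It serves
  total variation (with \<open>e = 1\<close>) as well as privacy (with
  \<open>e = exp \<epsilon>\<close>).\<close>

lemma nn_integral_le_of_emeasure_le:
  fixes f :: "'a \<Rightarrow> real"
  assumes P: "finite_measure P" and Q: "finite_measure Q" and PQ: "sets P = sets Q"
    and f[measurable]: "f \<in> borel_measurable P"
    and f0: "\<And>x. x \<in> space P \<Longrightarrow> 0 \<le> f x" and fM: "\<And>x. x \<in> space P \<Longrightarrow> f x \<le> M"
    and e: "0 \<le> e" "0 \<le> \<delta>" "0 \<le> M"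
    and le: "\<And>S. S \<in> sets P \<Longrightarrow> measure P S \<le> e * measure Q S + \<delta>"
  shows "(\<integral>\<^sup>+ x. ennreal (f x) \<partial>P) \<le> ennreal e * (\<integral>\<^sup>+ x. ennreal (f x) \<partial>Q) + ennreal (\<delta> * M)"
proof -
  have layer: "(\<integral>\<^sup>+ x. ennreal (f x) \<partial>N) =
      (\<integral>\<^sup>+ t. emeasure N {x\<in>space N. t < f x} * indicator {0..<M} t \<partial>lborel)"
    if "finite_measure N" and N[measurable_cong]: "sets N = sets P" for N
  proof -
    interpret finite_measure N by fact
    interpret pair_sigma_finite N lborel ..
    have sp: "space N = space P" using N by (rule sets_eq_imp_space_eq)
    have "(\<integral>\<^sup>+ x. ennreal (f x) \<partial>N) =
       (\<integral>\<^sup>+ x. \<integral>\<^sup>+ t. indicator {0..<M} t * (if t < f x then 1 else 0) \<partial>lborel \<partial>N)"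
    proof (rule nn_integral_cong)
      fix x assume x: "x \<in> space N"
      have "(\<integral>\<^sup>+ t. indicator {0..<M} t * (if t < f x then 1 else 0) \<partial>lborel)
        = (\<integral>\<^sup>+ t. indicator {0..<f x} t \<partial>lborel)"
        using fM[of x] x sp by (intro nn_integral_cong) (auto split: split_indicator)
      also have "\<dots> = ennreal (f x)" using f0[of x] x sp by simp
      finally show "ennreal (f x) = (\<integral>\<^sup>+ t. indicator {0..<M} t * (if t < f x then 1 else 0) \<partial>lborel)" ..
    qed
    also have "\<dots> = (\<integral>\<^sup>+ t. \<integral>\<^sup>+ x. indicator {0..<M} t * (if t < f x then 1 else 0) \<partial>N \<partial>lborel)"
      by (rule Fubini'[symmetric]) measurable
    also have "\<dots> = (\<integral>\<^sup>+ t. emeasure N {x\<in>space N. t < f x} * indicator {0..<M} t \<partial>lborel)"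
    proof (rule nn_integral_cong)
      fix t :: real
      have "(\<integral>\<^sup>+ x. indicator {0..<M} t * (if t < f x then 1 else 0) \<partial>N)
        = indicator {0..<M} t * (\<integral>\<^sup>+ x. indicator {x\<in>space N. t < f x} x \<partial>N)"
        by (subst nn_integral_cmult[symmetric], measurable,
            intro nn_integral_cong) (auto split: split_indicator)
      then show "(\<integral>\<^sup>+ x. indicator {0..<M} t * (if t < f x then 1 else 0) \<partial>N)
          = emeasure N {x\<in>space N. t < f x} * indicator {0..<M} t"
        by (simp add: mult.commute)
    qed
    finally show ?thesis .
  qed
  interpret P: finite_measure P by fact
  interpret Q: finite_measure Q by fact
  have [measurable]: "f \<in> borel_measurable Q" using f PQ by (simp cong: measurable_cong_sets)
  have spPQ: "space P = space Q" using PQ by (rule sets_eq_imp_space_eq)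
  have le': "emeasure P S \<le> ennreal e * emeasure Q S + ennreal \<delta>" if "S \<in> sets P" for S
    using le[OF that] e
    by (simp add: P.emeasure_eq_measure Q.emeasure_eq_measure ennreal_mult[symmetric] ennreal_plus[symmetric] ennreal_leI
         del: ennreal_plus)
  have [measurable]: "(\<lambda>t. emeasure Q {x\<in>space Q. t < f x}) \<in> borel_measurable lborel"
    by measurable
  have "(\<integral>\<^sup>+ x. ennreal (f x) \<partial>P) \<le>
    (\<integral>\<^sup>+ t. ennreal e * (emeasure Q {x\<in>space Q. t < f x} * indicator {0..<M} t) + ennreal \<delta> * indicator {0..<M} t \<partial>lborel)"
    unfolding layer[OF P refl]
  proof (rule nn_integral_mono)
    fix t :: real
    have S: "{x\<in>space P. t < f x} \<in> sets P" by measurable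
    show "emeasure P {x\<in>space P. t < f x} * indicator {0..<M} t
       \<le> ennreal e * (emeasure Q {x\<in>space Q. t < f x} * indicator {0..<M} t) + ennreal \<delta> * indicator {0..<M} t"
      using le'[OF S] by (auto simp: spPQ split: split_indicator)
  qed
  also have "\<dots> = ennreal e * (\<integral>\<^sup>+ x. ennreal (f x) \<partial>Q) + ennreal \<delta> * ennreal M"
    unfolding layer[OF Q PQ[symmetric]]
    by (subst nn_integral_add, simp, simp, subst nn_integral_cmult, simp, subst nn_integral_cmult_indicator) (use e in auto)
  finally show ?thesis using e by (simp add: ennreal_mult)
qed

section \<open>Linear regression with a hidden coefficient matrix\<close>

locale hidden_regression =
  fixes d m :: nat and b :: real
  assumes m_pos: "0 < m" and m_less: "m < d" and b_pos: "0 < b"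
begin

definition D0 :: "(nat \<Rightarrow> real) measure" where
  "D0 = (\<Pi>\<^sub>M i\<in>{..<d}. nu)"

definition shift :: "(nat \<times> nat \<Rightarrow> real) \<Rightarrow> (nat \<Rightarrow> real) \<Rightarrow> nat \<Rightarrow> real" where
  "shift B x j = (\<Sum>k<m. B (j, k) * x k)"

text \<open>Up to the factors 2/3 and -1/3, \<open>T\<close> is the part of the log-likelihood ratio
  linear in the hidden matrix and \<open>V\<close> the part quadratic in it.\<close>

definition T :: "(nat \<times> nat \<Rightarrow> real) \<Rightarrow> (nat \<Rightarrow> real) \<Rightarrow> real" where
  "T B x = (\<Sum>j=m..<d. x j * shift B x j)"

definition V :: "(nat \<times> nat \<Rightarrow> real) \<Rightarrow> (nat \<Rightarrow> real) \<Rightarrow> real" where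
  "V B x = (\<Sum>j=m..<d. (shift B x j)\<^sup>2)"

text \<open>The density of the model with coefficients \<open>B\<close> relative to the one with coefficients 0.\<close>

definition lik1 :: "(nat \<times> nat \<Rightarrow> real) \<Rightarrow> (nat \<Rightarrow> real) \<Rightarrow> real" where
  "lik1 B x = exp (2/3 * T B x - V B x / 3)"

definition DB :: "(nat \<times> nat \<Rightarrow> real) \<Rightarrow> (nat \<Rightarrow> real) measure" where
  "DB B = density D0 (\<lambda>x. ennreal (lik1 B x))"

text \<open>Turns a draw from \<open>D0\<close> into a draw from \<open>DB B\<close>: the inputs
  stay, and each response is noise plus its regression on the inputs.\<close>

definition shear :: "(nat \<times> nat \<Rightarrow> real) \<Rightarrow> (nat \<Rightarrow> real) \<Rightarrow> nat \<Rightarrow> real" where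
  "shear B x = (\<lambda>j\<in>{..<d}. if m \<le> j then x j + shift B x j else x j)"

text \<open>The symmetry behind all sign arguments: it preserves \<open>D0\<close>, makes
  \<open>T B\<close> odd and leaves \<open>V B\<close> unchanged.\<close>

definition neg :: "(nat \<Rightarrow> real) \<Rightarrow> nat \<Rightarrow> real" where
  "neg x = (\<lambda>j\<in>{..<d}. if m \<le> j then - x j else x j)"

sublocale nu: product_sigma_finite "\<lambda>i::nat. nu"
  by unfold_locales (intro sigma_finite_measure.sigma_finite_countable prob_space_imp_sigma_finite prob_space_nu)

sublocale D0: prob_space D0
  unfolding D0_def by (intro prob_space_PiM prob_space_nu)

lemma sets_D0 [measurable_cong]: "sets D0 = sets (euclid d)"
  unfolding D0_def euclid_def by (intro sets_PiM_cong) auto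

lemma space_D0: "space D0 = (\<Pi>\<^sub>E i\<in>{..<d}. UNIV)"
  by (simp add: D0_def space_PiM)

lemma measurable_coord_D0 [measurable]: "i < d \<Longrightarrow> (\<lambda>x. x i) \<in> borel_measurable D0"
  using measurable_component_singleton[of i "{..<d}" "\<lambda>_. nu", unfolded measurable_cong_sets[OF refl sets_nu]]
  unfolding D0_def by simp

lemma measurable_coord_euclid [measurable]: "i < d \<Longrightarrow> (\<lambda>x. x i) \<in> borel_measurable (euclid d)"
  using measurable_coord_D0 by (simp add: sets_D0 cong: measurable_cong_sets)

lemma measurable_into_D0:
  assumes "\<And>i. i < d \<Longrightarrow> (\<lambda>\<omega>. f \<omega> i) \<in> borel_measurable N"
  shows "(\<lambda>\<omega>. \<lambda>i\<in>{..<d}. f \<omega> i) \<in> N \<rightarrow>\<^sub>M D0"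
  unfolding D0_def using assms by (intro measurable_restrict) (auto cong: measurable_cong_sets)

lemma measurable_shift:
  assumes "\<And>k. k < m \<Longrightarrow> (\<lambda>\<omega>. f \<omega> (j, k)) \<in> borel_measurable N"
    and "\<And>k. k < d \<Longrightarrow> (\<lambda>\<omega>. g \<omega> k) \<in> borel_measurable N"
  shows "(\<lambda>\<omega>. shift (f \<omega>) (g \<omega>) j) \<in> borel_measurable N"
  unfolding shift_def using assms m_less by (intro borel_measurable_sum borel_measurable_times) auto

lemma measurable_TV:
  assumes f: "\<And>e. e \<in> {m..<d} \<times> {..<m} \<Longrightarrow> (\<lambda>\<omega>. f \<omega> e) \<in> borel_measurable N"
    and g: "\<And>k. k < d \<Longrightarrow> (\<lambda>\<omega>. g \<omega> k) \<in> borel_measurable N"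
  shows "(\<lambda>\<omega>. T (f \<omega>) (g \<omega>)) \<in> borel_measurable N" "(\<lambda>\<omega>. V (f \<omega>) (g \<omega>)) \<in> borel_measurable N"
    "(\<lambda>\<omega>. lik1 (f \<omega>) (g \<omega>)) \<in> borel_measurable N"
proof -
  have [measurable]: "(\<lambda>\<omega>. shift (f \<omega>) (g \<omega>) j) \<in> borel_measurable N" if "j \<in> {m..<d}" for j
    by (rule measurable_shift) (use that f g in auto)
  note g[measurable]
  show [measurable]: "(\<lambda>\<omega>. T (f \<omega>) (g \<omega>)) \<in> borel_measurable N" unfolding T_def by measurable
  show [measurable]: "(\<lambda>\<omega>. V (f \<omega>) (g \<omega>)) \<in> borel_measurable N" unfolding V_def by measurable
  show "(\<lambda>\<omega>. lik1 (f \<omega>) (g \<omega>)) \<in> borel_measurable N" unfolding lik1_def by measurable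
qed

lemma measurable_fixed_D0 [measurable]:
  "(\<lambda>x. shift B x j) \<in> borel_measurable D0" "T B \<in> borel_measurable D0" "V B \<in> borel_measurable D0"
  "lik1 B \<in> borel_measurable D0"
  using measurable_TV[of "\<lambda>_. B" D0 "\<lambda>x. x"] measurable_shift[of "\<lambda>_. B" j D0 "\<lambda>x. x"] by auto

lemma measurable_shear [measurable]: "shear B \<in> D0 \<rightarrow>\<^sub>M D0"
  unfolding shear_def by (intro measurable_into_D0) measurable

lemma measurable_neg [measurable]: "neg \<in> D0 \<rightarrow>\<^sub>M D0"
  unfolding neg_def by (intro measurable_into_D0) measurable

lemma measurable_upd_D0:
  assumes "j < d" "(\<lambda>x. g x) \<in> borel_measurable D0"
  shows "(\<lambda>x. x(j := g x)) \<in> D0 \<rightarrow>\<^sub>M D0"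
proof -
  have "(\<lambda>x. \<lambda>i\<in>{..<d}. (x(j := g x)) i) \<in> D0 \<rightarrow>\<^sub>M D0"
    using assms by (intro measurable_into_D0) (auto simp: fun_upd_def)
  then show ?thesis
    by (rule measurable_cong[THEN iffD1, rotated])
       (use assms(1) in \<open>auto simp: space_D0 PiE_iff extensional_def fun_eq_iff\<close>)
qed

lemma nn_integral_D0_split:
  assumes j: "j < d" and F: "F \<in> borel_measurable D0"
  shows "(\<integral>\<^sup>+ x. F x \<partial>D0) = (\<integral>\<^sup>+ x. \<integral>\<^sup>+ y. F (x(j := y)) \<partial>nu \<partial>(\<Pi>\<^sub>M i\<in>{..<d} - {j}. nu))"
proof -
  have "insert j ({..<d} - {j}) = {..<d}" using j by auto
  then show ?thesis
    using nu.product_nn_integral_insert[of "{..<d} - {j}" j F] F by (simp add: D0_def)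
qed

lemma upd_measurable_nu:
  assumes "j < d" "x \<in> space (\<Pi>\<^sub>M i\<in>{..<d} - {j}. nu)"
  shows "(\<lambda>y. x(j := y)) \<in> borel \<rightarrow>\<^sub>M D0"
proof -
  have "insert j ({..<d} - {j}) = {..<d}" using assms by auto
  then show ?thesis
    using measurable_component_update[OF assms(2), of j] by (simp add: D0_def cong: measurable_cong_sets)
qed

lemma shift_upd: "m \<le> j \<Longrightarrow> shift B (x(j := y)) i = shift B x i"
  by (auto simp: shift_def intro!: sum.cong)

text \<open>\<open>shift B x j\<close> reads input coordinates only, so it is constant while the
  response coordinate \<open>j\<close> is integrated, and the one-dimensional shift formula applies
  inside Fubini.\<close>

lemma shift_coordinate:
  assumes j: "m \<le> j" "j < d" and F[measurable]: "F \<in> borel_measurable D0"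
  shows "(\<integral>\<^sup>+ x. ennreal (exp (2/3 * x j * shift B x j - (shift B x j)\<^sup>2 / 3)) * F x \<partial>D0)
    = (\<integral>\<^sup>+ x. F (x(j := x j + shift B x j)) \<partial>D0)"
proof -
  note [measurable] = measurable_upd_D0 upd_measurable_nu
  have [measurable]: "(\<lambda>x. F (x(j := x j + shift B x j))) \<in> borel_measurable D0"
    using j by measurable
  show ?thesis using j
    apply (subst (1 2) nn_integral_D0_split[of j], simp, simp, simp, simp)
    apply (rule nn_integral_cong)
    subgoal for x
      using nn_integral_nu_shift[of "\<lambda>y. F (x(j := y))" "shift B x j"]
      by (simp add: shift_upd)
    done
qed

text \<open>Responses can be shifted one at a time because no shift depends on a response;
  \<open>S\<close> collects those already shifted.\<close>

lemma shear_partial: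
  assumes S: "finite S" "S \<subseteq> {m..<d}" and F: "F \<in> borel_measurable D0"
  shows "(\<integral>\<^sup>+ x. (\<Prod>j\<in>S. ennreal (exp (2/3 * x j * shift B x j - (shift B x j)\<^sup>2 / 3))) * F x \<partial>D0)
    = (\<integral>\<^sup>+ x. F (\<lambda>j\<in>{..<d}. if j \<in> S then x j + shift B x j else x j) \<partial>D0)"
  using S F
proof (induction S arbitrary: F rule: finite_induct)
  case empty
  then show ?case
    by (auto intro!: nn_integral_cong arg_cong[where f=F] simp: space_D0 PiE_iff extensional_def fun_eq_iff)
next
  case (insert j S)
  note [measurable] = insert.prems(2) measurable_upd_D0
  have j: "m \<le> j" "j < d" using insert.prems by auto
  have [measurable]: "S \<subseteq> {m..<d}" using insert.prems by auto
  have [measurable]: "i \<in> S \<Longrightarrow> (\<lambda>x. x i) \<in> borel_measurable D0" for i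
    using insert.prems(1) by (intro measurable_coord_D0) auto
  define w where "w x i = ennreal (exp (2/3 * x i * shift B x i - (shift B x i)\<^sup>2 / 3))" for x i
  have [measurable]: "i \<in> S \<Longrightarrow> (\<lambda>x. w x i) \<in> borel_measurable D0" for i
    unfolding w_def by measurable
  define G where "G x = (\<Prod>i\<in>S. w x i) * F x" for x
  have G: "G \<in> borel_measurable D0" unfolding G_def by measurable
  have w_upd: "w (x(j := y)) i = w x i" if "i \<in> S" for x y i
    using that insert.hyps(2) j by (auto simp: w_def shift_upd)
  have "(\<integral>\<^sup>+ x. (\<Prod>i\<in>insert j S. w x i) * F x \<partial>D0) = (\<integral>\<^sup>+ x. w x j * G x \<partial>D0)"
    using insert.hyps by (simp add: G_def mult.assoc)
  also have "\<dots> = (\<integral>\<^sup>+ x. G (x(j := x j + shift B x j)) \<partial>D0)"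
    unfolding w_def by (rule shift_coordinate[OF j G])
  also have "\<dots> = (\<integral>\<^sup>+ x. (\<Prod>i\<in>S. w x i) * F (x(j := x j + shift B x j)) \<partial>D0)"
    by (simp add: G_def w_upd)
  also have "\<dots> = (\<integral>\<^sup>+ x. F ((\<lambda>j\<in>{..<d}. if j \<in> S then x j + shift B x j else x j)
      (j := x j + shift B x j)) \<partial>D0)"
    unfolding w_def
  proof (subst insert.IH)
    show "(\<lambda>x. F (x(j := x j + shift B x j))) \<in> borel_measurable D0"
      using j by measurable
    have "shift B (\<lambda>j\<in>{..<d}. if j \<in> S then x j + shift B x j else x j) j = shift B x j" for x
      using \<open>S \<subseteq> {m..<d}\<close> m_less by (auto simp: shift_def intro!: sum.cong)
    then show "(\<integral>\<^sup>+ x. F ((\<lambda>j\<in>{..<d}. if j \<in> S then x j + shift B x j else x j)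
       (j := (\<lambda>j\<in>{..<d}. if j \<in> S then x j + shift B x j else x j) j +
         shift B (\<lambda>j\<in>{..<d}. if j \<in> S then x j + shift B x j else x j) j)) \<partial>D0) =
     (\<integral>\<^sup>+ x. F ((\<lambda>j\<in>{..<d}. if j \<in> S then x j + shift B x j else x j)(j := x j + shift B x j)) \<partial>D0)"
      using j insert.hyps(2) by (simp cong: if_cong)
  qed (fact \<open>S \<subseteq> {m..<d}\<close>)
  also have "\<dots> = (\<integral>\<^sup>+ x. F (\<lambda>i\<in>{..<d}. if i \<in> insert j S then x i + shift B x i else x i) \<partial>D0)"
    using j by (auto intro!: nn_integral_cong arg_cong[where f=F] simp: fun_eq_iff)
  finally show ?case unfolding w_def .
qed

lemma lik1_prod: "ennreal (lik1 B x) =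
    (\<Prod>j\<in>{m..<d}. ennreal (exp (2/3 * x j * shift B x j - (shift B x j)\<^sup>2 / 3)))"
  by (subst prod_ennreal)
     (simp_all add: lik1_def T_def V_def flip: exp_sum, simp add: sum_subtractf sum_distrib_left sum_divide_distrib mult.assoc)

text \<open>\<open>DB B\<close> is the image of \<open>D0\<close> under \<open>shear B\<close>.
  Total mass one follows at once, and expectations under the hidden model reduce to expectations
  over independent noise.\<close>

lemma nn_integral_DB:
  assumes F[measurable]: "F \<in> borel_measurable D0"
  shows "(\<integral>\<^sup>+ x. F x \<partial>DB B) = (\<integral>\<^sup>+ x. F (shear B x) \<partial>D0)"
proof -
  have "(\<integral>\<^sup>+ x. F x \<partial>DB B) = (\<integral>\<^sup>+ x. ennreal (lik1 B x) * F x \<partial>D0)"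
    unfolding DB_def by (subst nn_integral_density) auto
  also have "\<dots> = (\<integral>\<^sup>+ x. F (\<lambda>j\<in>{..<d}. if j \<in> {m..<d} then x j + shift B x j else x j) \<partial>D0)"
    unfolding lik1_prod by (rule shear_partial) auto
  also have "\<dots> = (\<integral>\<^sup>+ x. F (shear B x) \<partial>D0)"
    by (intro nn_integral_cong arg_cong[where f=F]) (auto simp: shear_def)
  finally show ?thesis .
qed

lemma sets_DB [measurable_cong]: "sets (DB B) = sets (euclid d)"
  by (simp add: DB_def sets_D0)

lemma space_DB: "space (DB B) = space D0"
  by (simp add: DB_def)

lemma prob_space_DB: "prob_space (DB B)"
proof
  have "emeasure (DB B) (space (DB B)) = (\<integral>\<^sup>+ x. 1 \<partial>DB B)" by simp
  also have "\<dots> = 1" by (subst nn_integral_DB) (simp_all add: D0.emeasure_space_1)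
  finally show "emeasure (DB B) (space (DB B)) = 1" .
qed

lemma neg_partial:
  assumes S: "finite S" "S \<subseteq> {..<d}" and F: "F \<in> borel_measurable D0"
  shows "(\<integral>\<^sup>+ x. F (\<lambda>j\<in>{..<d}. if j \<in> S then - x j else x j) \<partial>D0) = (\<integral>\<^sup>+ x. F x \<partial>D0)"
  using S F
proof (induction S arbitrary: F rule: finite_induct)
  case empty
  then show ?case
    by (auto intro!: nn_integral_cong arg_cong[where f=F] simp: space_D0 PiE_iff extensional_def fun_eq_iff)
next
  case (insert j S)
  note [measurable] = insert.prems(2) measurable_upd_D0 upd_measurable_nu
  have j: "j < d" and S: "S \<subseteq> {..<d}" using insert.prems by auto
  have Fj [measurable]: "(\<lambda>x. F (x(j := - x j))) \<in> borel_measurable D0"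
    using j by measurable
  have "(\<integral>\<^sup>+ x. F (\<lambda>i\<in>{..<d}. if i \<in> insert j S then - x i else x i) \<partial>D0) =
    (\<integral>\<^sup>+ x. (\<lambda>x. F (x(j := - x j))) (\<lambda>i\<in>{..<d}. if i \<in> S then - x i else x i) \<partial>D0)"
    using j insert.hyps(2) by (auto intro!: nn_integral_cong arg_cong[where f=F] simp: fun_eq_iff)
  also have "\<dots> = (\<integral>\<^sup>+ x. F (x(j := - x j)) \<partial>D0)"
    by (rule insert.IH[OF S Fj])
  also have "\<dots> = (\<integral>\<^sup>+ x. F x \<partial>D0)" using j
    apply (subst (1 2) nn_integral_D0_split[of j], simp, simp, simp, simp)
    apply (rule nn_integral_cong)
    subgoal for x
      using nn_integral_nu_minus[of "\<lambda>y. F (x(j := y))"] by simp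
    done
  finally show ?case .
qed

lemma nn_integral_neg:
  assumes F: "F \<in> borel_measurable D0"
  shows "(\<integral>\<^sup>+ x. F (neg x) \<partial>D0) = (\<integral>\<^sup>+ x. F x \<partial>D0)"
proof -
  have "(\<lambda>j\<in>{..<d}. if j \<in> {m..<d} then - x j else x j) = neg x" for x :: "nat \<Rightarrow> real"
    by (auto simp: neg_def)
  moreover have "{m..<d} \<subseteq> {..<d}" by auto
  ultimately show ?thesis using neg_partial[of "{m..<d}", OF _ _ F] by (simp only: finite_atLeastLessThan)
qed

end

section \<open>Moments of bilinear forms and truncated squared lengths under the base model\<close>

context hidden_regression
begin

abbreviation E :: "(nat \<times> nat) set" where "E \<equiv> {m..<d} \<times> {..<m}"

lemma monomial_D0:
  fixes p :: "nat \<Rightarrow> nat"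
  shows "integrable D0 (\<lambda>x. \<Prod>i<d. x i ^ p i)"
    and "(\<integral>x. (\<Prod>i<d. x i ^ p i) \<partial>D0) = (\<Prod>i<d. \<integral>y. y ^ p i \<partial>nu)"
  unfolding D0_def
  by (intro nu.product_integrable_prod nu.product_integral_prod integrable_nu_power finite_lessThan)+

text \<open>Products of one response and one input are orthogonal in L2 of \<open>D0\<close>, each
  with squared norm (3/2)^2. This orthogonality is the source of the small correlation between an
  output and an unrelated sample.\<close>

lemma fourfold_moment:
  assumes e: "e \<in> E" "e' \<in> E"
  shows "integrable D0 (\<lambda>x. (x (fst e) * x (snd e)) * (x (fst e') * x (snd e')))"
    and "(\<integral>x. (x (fst e) * x (snd e)) * (x (fst e') * x (snd e')) \<partial>D0) = (if e = e' then 9 / 4 else 0)"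
proof -
  obtain j k j' k' where e_eq: "e = (j, k)" "e' = (j', k')" by (metis surj_pair)
  have lt: "j < d" "k < d" "j' < d" "k' < d" and ne: "k \<noteq> j" "k' \<noteq> j'" "k \<noteq> j'" "k' \<noteq> j"
    using e m_less by (auto simp: e_eq)
  \<comment> \<open>\<open>p\<close> counts the occurrences of each coordinate, so that the product
    of four factors becomes a monomial and its integral factorises.\<close>
  define p :: "nat \<Rightarrow> nat" where
    "p i = of_bool (i = j) + of_bool (i = k) + of_bool (i = j') + of_bool (i = k')" for i
  have one: "(\<Prod>i<d. x i ^ of_bool (i = l)) = x l" if "l < d" for l and x :: "nat \<Rightarrow> real"
  proof -
    have "(\<Prod>i<d. x i ^ of_bool (i = l)) = (\<Prod>i<d. if i = l then x i else 1)"
      by (intro prod.cong) auto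
    then show ?thesis using that by simp
  qed
  have eq: "(\<Prod>i<d. x i ^ p i) = (x j * x k) * (x j' * x k')" for x :: "nat \<Rightarrow> real"
    unfolding p_def power_add prod.distrib using one lt by simp
  show "integrable D0 (\<lambda>x. (x (fst e) * x (snd e)) * (x (fst e') * x (snd e')))"
    using monomial_D0(1)[of p] by (simp add: eq e_eq)
  have int: "(\<integral>x. (x j * x k) * (x j' * x k') \<partial>D0) = (\<Prod>i<d. \<integral>y. y ^ p i \<partial>nu)"
    using monomial_D0(2)[of p] by (simp add: eq)
  have "(\<Prod>i<d. \<integral>y. y ^ p i \<partial>nu) = (if e = e' then 9 / 4 else 0)"
  proof (cases "e = e'")
    case True
    then have "(\<Prod>i<d. \<integral>y. y ^ p i \<partial>nu) = (\<Prod>i<d. (if i = j then 3/2 else 1) * (if i = k then 3/2 else 1))"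
      using ne by (intro prod.cong)
        (auto simp: p_def e_eq nu_moments numeral_2_eq_2[symmetric] prob_space.prob_space[OF prob_space_nu, simplified])
    then show ?thesis using True lt by (simp add: prod.distrib)
  next
    case False
    \<comment> \<open>Response and input indices never coincide; if the pairs differ, some index
      therefore occurs exactly once, and its factor is a centred mean.\<close>
    then obtain l where l: "l < d" "p l = 1"
      using that lt ne by (cases "j = j'"; force simp: p_def e_eq)
    then have "(\<integral>y. y ^ p l \<partial>nu) = 0" by (simp add: nu_moments)
    then show ?thesis using False l(1) by (auto intro!: prod_zero bexI[of _ l])
  qed
  with int show "(\<integral>x. (x (fst e) * x (snd e)) * (x (fst e') * x (snd e')) \<partial>D0) = (if e = e' then 9 / 4 else 0)"
    by (simp add: e_eq)
qed

definition bilin :: "(nat \<times> nat \<Rightarrow> real) \<Rightarrow> (nat \<Rightarrow> real) \<Rightarrow> real" where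
  "bilin c x = (\<Sum>e\<in>E. c e * (x (fst e) * x (snd e)))"

lemma measurable_bilin [measurable]: "bilin c \<in> borel_measurable D0"
proof -
  have [measurable]: "e \<in> E \<Longrightarrow> (\<lambda>x. x (fst e)) \<in> borel_measurable D0"
    "e \<in> E \<Longrightarrow> (\<lambda>x. x (snd e)) \<in> borel_measurable D0" for e
    using m_less by (auto intro!: measurable_coord_D0)
  show ?thesis unfolding bilin_def[abs_def] by measurable
qed

lemma bilin_second_moment:
  "integrable D0 (\<lambda>x. (bilin c x)\<^sup>2)" "(\<integral>x. (bilin c x)\<^sup>2 \<partial>D0) = 9 / 4 * (\<Sum>e\<in>E. (c e)\<^sup>2)"
proof -
  have eq: "(bilin c x)\<^sup>2 = (\<Sum>e\<in>E. \<Sum>e'\<in>E. c e * c e' * ((x (fst e) * x (snd e)) * (x (fst e') * x (snd e'))))" for x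
    unfolding bilin_def power2_eq_square sum_product by (intro sum.cong) auto
  have int: "integrable D0 (\<lambda>x. c e * c e' * ((x (fst e) * x (snd e)) * (x (fst e') * x (snd e'))))"
    if "e \<in> E" "e' \<in> E" for e e'
    by (intro integrable_mult_right fourfold_moment that)
  show "integrable D0 (\<lambda>x. (bilin c x)\<^sup>2)"
    unfolding eq by (intro Bochner_Integration.integrable_sum int)
  have "(\<integral>x. (bilin c x)\<^sup>2 \<partial>D0) = (\<Sum>e\<in>E. \<Sum>e'\<in>E. c e * c e' * (if e = e' then 9/4 else 0))"
    unfolding eq using int
    by (simp add: Bochner_Integration.integral_sum Bochner_Integration.integrable_sum fourfold_moment del: mem_Sigma_iff cong: sum.cong)
  also have "\<dots> = (\<Sum>e\<in>E. c e * c e * (9/4))"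
    by (intro sum.cong refl) (simp add: if_distrib[of "\<lambda>z. _ * z"] sum.delta cong: if_cong del: mem_Sigma_iff)
  finally show "(\<integral>x. (bilin c x)\<^sup>2 \<partial>D0) = 9 / 4 * (\<Sum>e\<in>E. (c e)\<^sup>2)"
    by (simp add: sum_distrib_left power2_eq_square mult.commute)
qed

text \<open>Since \<open>ennreal\<close> discards negative values, this concerns the positive part.
  The inequality t <= \<kappa>/2 + t^2/(2\<kappa>) replaces Cauchy-Schwarz, so the second moment is
  all that enters.\<close>

lemma bilin_nn_integral_le:
  assumes "9 / 4 * (\<Sum>e\<in>E. (c e)\<^sup>2) \<le> \<kappa>\<^sup>2" "0 < \<kappa>"
  shows "(\<integral>\<^sup>+ x. ennreal (bilin c x) \<partial>D0) \<le> ennreal \<kappa>"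
proof -
  have int: "integrable D0 (\<lambda>x. \<kappa> / 2 + (bilin c x)\<^sup>2 / (2 * \<kappa>))"
    using bilin_second_moment(1)[of c] by auto
  have "(\<integral>\<^sup>+ x. ennreal (bilin c x) \<partial>D0) \<le> (\<integral>\<^sup>+ x. ennreal (\<kappa> / 2 + (bilin c x)\<^sup>2 / (2 * \<kappa>)) \<partial>D0)"
  proof (intro nn_integral_mono ennreal_leI)
    fix x
    have "0 \<le> (\<kappa> - bilin c x)\<^sup>2" by simp
    then show "bilin c x \<le> \<kappa> / 2 + (bilin c x)\<^sup>2 / (2 * \<kappa>)"
      using \<open>0 < \<kappa>\<close> by (simp add: field_simps power2_eq_square)
  qed
  also have "\<dots> = ennreal (\<integral>x. \<kappa> / 2 + (bilin c x)\<^sup>2 / (2 * \<kappa>) \<partial>D0)"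
    using \<open>0 < \<kappa>\<close> by (intro nn_integral_eq_integral int) auto
  also have "(\<integral>x. \<kappa> / 2 + (bilin c x)\<^sup>2 / (2 * \<kappa>) \<partial>D0) = \<kappa> / 2 + (9 / 4 * (\<Sum>e\<in>E. (c e)\<^sup>2)) / (2 * \<kappa>)"
    using bilin_second_moment(1)[of c] by (simp add: bilin_second_moment(2) D0.prob_space)
  also have "\<dots> \<le> \<kappa> / 2 + \<kappa>\<^sup>2 / (2 * \<kappa>)"
    using assms by (intro add_left_mono divide_right_mono) auto
  also have "\<dots> = \<kappa>" using \<open>0 < \<kappa>\<close> by (simp add: power2_eq_square)
  finally show ?thesis by (simp add: ennreal_leI)
qed

lemma bilin_neg: "bilin c (neg x) = - bilin c x"
  unfolding bilin_def sum_negf[symmetric]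
  using m_less by (intro sum.cong) (auto simp: neg_def)

text \<open>Reflecting the responses preserves \<open>D0\<close> and changes the sign of the form,
  so its positive and negative parts have equal mass.\<close>

lemma bilin_symmetric:
  "(\<integral>\<^sup>+ x. ennreal (- bilin c x) \<partial>D0) = (\<integral>\<^sup>+ x. ennreal (bilin c x) \<partial>D0)"
  using nn_integral_neg[of "\<lambda>x. ennreal (bilin c x)"] by (simp add: bilin_neg)

lemma coordinate_integral:
  assumes J: "finite J" "j \<in> J" and f: "integrable nu f"
  shows "integrable (\<Pi>\<^sub>M i\<in>J. nu) (\<lambda>x. f (x j) :: real)"
    and "(\<integral>x. f (x j) \<partial>(\<Pi>\<^sub>M i\<in>J. nu)) = (\<integral>y. f y \<partial>nu)"
proof -
  have d: "distr (\<Pi>\<^sub>M i\<in>J. nu) nu (\<lambda>x. x j) = nu"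
    using distr_PiM_component[of J "\<lambda>_. nu" j] J prob_space_nu by auto
  have [measurable]: "(\<lambda>x. x j) \<in> (\<Pi>\<^sub>M i\<in>J. nu) \<rightarrow>\<^sub>M nu"
    using J(2) by (rule measurable_component_singleton)
  show "integrable (\<Pi>\<^sub>M i\<in>J. nu) (\<lambda>x. f (x j))"
    using f by (subst (asm) d[symmetric]) (rule integrable_distr[rotated], auto)
  show "(\<integral>x. f (x j) \<partial>(\<Pi>\<^sub>M i\<in>J. nu)) = (\<integral>y. f y \<partial>nu)"
    using f by (subst (2) d[symmetric], subst integral_distr) (auto)
qed

text \<open>Cauchy-Schwarz over the coordinates reduces the second moment to fourth moments of
  single coordinates and avoids mixed terms; 27/4 is the Gaussian fourth moment 3 (3/2)^2.\<close>

lemma sq_norm_moments: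
  fixes J :: "nat set" and P :: "(nat \<Rightarrow> real) \<Rightarrow> real"
  assumes J: "finite J"
  defines "P \<equiv> \<lambda>x. \<Sum>j\<in>J. (x j)\<^sup>2" and "M \<equiv> (\<Pi>\<^sub>M i\<in>J. nu)"
  shows "integrable M P" "integrable M (\<lambda>x. (P x)\<^sup>2)"
    and "(\<integral>x. P x \<partial>M) = 3 / 2 * card J" "(\<integral>x. (P x)\<^sup>2 \<partial>M) \<le> 27 / 4 * (card J)\<^sup>2"
proof -
  note c = coordinate_integral[OF J]
  have i2: "integrable M (\<lambda>x. (x j)\<^sup>2)" "(\<integral>x. (x j)\<^sup>2 \<partial>M) = 3 / 2" if "j \<in> J" for j
    using c[OF that integrable_nu_power[of 2]] by (auto simp: M_def nu_moments)
  have i4: "integrable M (\<lambda>x. (x j)^4)" "(\<integral>x. (x j)^4 \<partial>M) = 27 / 4" if "j \<in> J" for j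
    using c[OF that integrable_nu_power[of 4]] by (auto simp: M_def nu_moments)
  show P: "integrable M P" unfolding P_def by (intro Bochner_Integration.integrable_sum i2)
  show "(\<integral>x. P x \<partial>M) = 3 / 2 * card J"
    unfolding P_def by (subst Bochner_Integration.integral_sum) (auto simp: i2)
  have le: "(P x)\<^sup>2 \<le> card J * (\<Sum>j\<in>J. (x j)^4)" for x :: "nat \<Rightarrow> real"
    using Cauchy_Schwarz_ineq_sum[of "\<lambda>_. 1" "\<lambda>j. (x j)\<^sup>2" J] by (simp add: P_def power_mult[symmetric])
  have i: "integrable M (\<lambda>x. card J * (\<Sum>j\<in>J. (x j)^4))"
    by (intro integrable_mult_right Bochner_Integration.integrable_sum i4)
  show P2: "integrable M (\<lambda>x. (P x)\<^sup>2)"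
    by (rule Bochner_Integration.integrable_bound[OF i])
       (use P le in \<open>auto simp: sum_nonneg intro!: AE_I2\<close>)
  have "(\<integral>x. (P x)\<^sup>2 \<partial>M) \<le> (\<integral>x. card J * (\<Sum>j\<in>J. (x j)^4) \<partial>M)"
    by (intro integral_mono P2 i le)
  also have "\<dots> = card J * (card J * (27 / 4))"
    by (simp add: Bochner_Integration.integral_sum i4)
  finally show "(\<integral>x. (P x)\<^sup>2 \<partial>M) \<le> 27 / 4 * (card J)\<^sup>2"
    by (simp add: power2_eq_square)
qed

text \<open>The minorant P - P^2/L of the truncation at L = 20 d costs at most 27/80 per coordinate
  out of the full mean 3/2, which leaves 93/80.\<close>

lemma truncated_sq_norm:
  fixes J :: "nat set" and P f :: "(nat \<Rightarrow> real) \<Rightarrow> real"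
  assumes J: "finite J" and J_le: "card J \<le> d"
  defines "P \<equiv> \<lambda>x. \<Sum>j\<in>J. (x j)\<^sup>2" and "M \<equiv> (\<Pi>\<^sub>M i\<in>J. nu)"
  defines "f \<equiv> \<lambda>x. if P x \<le> 20 * d then P x else 0"
  shows "integrable M f" "(\<integral>x. f x \<partial>M) \<ge> 93 / 80 * card J"
proof -
  have sq: "integrable M P" "integrable M (\<lambda>x. (P x)\<^sup>2)"
    "(\<integral>x. P x \<partial>M) = 3 / 2 * card J" "(\<integral>x. (P x)\<^sup>2 \<partial>M) \<le> 27 / 4 * (card J)\<^sup>2"
    using sq_norm_moments[OF J] by (simp_all add: P_def M_def)
  have d: "0 < real d" using m_less by simp
  have P0: "0 \<le> P x" for x by (auto simp: P_def sum_nonneg)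
  have le: "P x - (P x)\<^sup>2 / (20 * d) \<le> f x" for x
    using P0[of x] d by (auto simp: f_def field_simps power2_eq_square)
  have [measurable]: "P \<in> borel_measurable M" using sq(1) by auto
  show f: "integrable M f"
    by (rule Bochner_Integration.integrable_bound[OF sq(1)]) (auto simp: f_def)
  have "3 / 2 * card J - 27 / 4 * (card J)\<^sup>2 / (20 * d) \<le> (\<integral>x. P x - (P x)\<^sup>2 / (20 * d) \<partial>M)"
    using sq(1-3) divide_right_mono[OF sq(4), of "20 * real d"] by simp
  also have "\<dots> \<le> (\<integral>x. f x \<partial>M)"
    using sq by (intro integral_mono f le) auto
  finally have *: "3 / 2 * card J - 27 / 4 * (card J)\<^sup>2 / (20 * d) \<le> (\<integral>x. f x \<partial>M)" .
  have "27 / 4 * (real (card J))\<^sup>2 / (20 * d) \<le> 27 / 80 * card J"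
    using J_le d by (auto simp: field_simps power2_eq_square intro!: mult_right_mono)
  with * show "(\<integral>x. f x \<partial>M) \<ge> 93 / 80 * card J" by simp
qed

definition in_sq :: "(nat \<Rightarrow> real) \<Rightarrow> real" where "in_sq x = (\<Sum>k<m. (x k)\<^sup>2)"
definition out_sq :: "(nat \<Rightarrow> real) \<Rightarrow> real" where "out_sq x = (\<Sum>j=m..<d. (x j)\<^sup>2)"
text \<open>A generous cutoff, as each half of a base draw has mean squared length at most 3/2 d. It
  is imposed on the output, whose law is otherwise uncontrolled, and bounds every product of a
  response and an input by a multiple of d.\<close>

definition good :: "(nat \<Rightarrow> real) \<Rightarrow> bool" where "good x \<longleftrightarrow> in_sq x \<le> 20 * d \<and> out_sq x \<le> 20 * d"

lemma in_sq_nonneg: "0 \<le> in_sq x" and out_sq_nonneg: "0 \<le> out_sq x"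
  by (auto simp: in_sq_def out_sq_def sum_nonneg)

lemma measurable_in_sq_out_sq:
  assumes "\<And>k. k < d \<Longrightarrow> (\<lambda>\<omega>. g \<omega> k) \<in> borel_measurable N"
  shows "(\<lambda>\<omega>. in_sq (g \<omega>)) \<in> borel_measurable N" "(\<lambda>\<omega>. out_sq (g \<omega>)) \<in> borel_measurable N"
  unfolding in_sq_def out_sq_def using assms m_less by (auto intro!: borel_measurable_sum borel_measurable_power)

text \<open>Up to the factor b^2/3, \<open>F\<close> is the lower bound for \<open>low\<close> after
  averaging over the prior. Inputs and responses are independent, so its integral is a product of
  two truncated moments.\<close>

lemma integral_good:
  fixes F :: "(nat \<Rightarrow> real) \<Rightarrow> real"
  defines "F \<equiv> \<lambda>x. if good x then in_sq x * (3 / 4 * out_sq x - real (d - m) / 3) else 0"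
  shows "integrable D0 F" "(\<integral>x. F x \<partial>D0) \<ge> real m * real (d - m) / 2"
proof -
  have [measurable]: "in_sq \<in> borel_measurable D0" "out_sq \<in> borel_measurable D0"
    using measurable_in_sq_out_sq[of "\<lambda>x. x" D0] by auto
  have b_small: "\<bar>F x\<bar> \<le> (20 * d) * (3 / 4 * (20 * d) + real (d - m) / 3)" for x
  proof (cases "good x")
    case True
    have "\<bar>3 / 4 * out_sq x - real (d - m) / 3\<bar> \<le> 3 / 4 * out_sq x + real (d - m) / 3"
      using out_sq_nonneg[of x] by (simp add: abs_le_iff)
    also have "\<dots> \<le> 3 / 4 * (20 * d) + real (d - m) / 3"
      using True by (simp add: good_def)
    finally show ?thesis
      using True in_sq_nonneg[of x] by (auto simp: F_def good_def abs_mult intro!: mult_mono)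
  qed (simp add: F_def)
  have [measurable]: "F \<in> borel_measurable D0" unfolding F_def good_def by measurable
  show int: "integrable D0 F"
    by (rule D0.integrable_const_bound[of _ "(20 * d) * (3 / 4 * (20 * d) + real (d - m) / 3)"])
       (use b_small in auto)
  let ?f = "\<lambda>x. if in_sq x \<le> 20 * d then in_sq x else 0"
  let ?g = "\<lambda>x. if out_sq x \<le> 20 * d then out_sq x else 0"
  let ?h = "\<lambda>x. if out_sq x \<le> 20 * d then 3 / 4 * out_sq x - real (d - m) / 3 else 0"
  let ?M1 = "\<Pi>\<^sub>M i\<in>{..<m}. nu" and ?M2 = "\<Pi>\<^sub>M i\<in>{m..<d}. nu"
  have un: "{..<m} \<union> {m..<d} = {..<d}" and dj: "{..<m} \<inter> {m..<d} = {}" using m_less by auto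
  have mrg: "F (merge {..<m} {m..<d} (x, y)) = ?f x * ?h y" for x y
  proof -
    have "in_sq (merge {..<m} {m..<d} (x, y)) = in_sq x" "out_sq (merge {..<m} {m..<d} (x, y)) = out_sq y"
      by (auto simp: in_sq_def out_sq_def merge_def)
    then show ?thesis by (simp add: F_def good_def)
  qed
  interpret M2: prob_space ?M2 by (intro prob_space_PiM prob_space_nu)
  have "(\<integral>x. F x \<partial>D0) = (\<integral>x. \<integral>y. ?f x * ?h y \<partial>?M2 \<partial>?M1)"
    using nu.product_integral_fold[of "{..<m}" "{m..<d}" F] int
    by (simp add: un dj mrg D0_def)
  then have eq: "(\<integral>x. F x \<partial>D0) = (\<integral>x. ?f x \<partial>?M1) * (\<integral>y. ?h y \<partial>?M2)" by simp
  have f: "(\<integral>x. ?f x \<partial>?M1) \<ge> 93 / 80 * real m"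
    using truncated_sq_norm(2)[of "{..<m}"] m_less by (simp add: in_sq_def cong: if_cong)
  have g: "integrable ?M2 ?g" "(\<integral>x. ?g x \<partial>?M2) \<ge> 93 / 80 * real (d - m)"
    using truncated_sq_norm[of "{m..<d}"] by (simp_all add: out_sq_def cong: if_cong)
  have qM[measurable]: "out_sq \<in> borel_measurable ?M2"
    using sq_norm_moments(1)[of "{m..<d}"] unfolding out_sq_def[abs_def] by auto
  have hb: "\<bar>?h y\<bar> \<le> 15 * d + real (d - m) / 3" for y
    using out_sq_nonneg[of y] by (simp add: abs_if)
  have h: "integrable ?M2 ?h"
    by (rule M2.integrable_const_bound[of _ "15 * d + real (d - m) / 3"]) (use hb in auto)
  have "93 / 80 * real (d - m) * (3 / 4) - real (d - m) / 3 \<le> (\<integral>x. 3 / 4 * ?g x - real (d - m) / 3 \<partial>?M2)"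
    using g by (simp add: M2.prob_space)
  \<comment> \<open>Beyond the cutoff the left integrand is negative while \<open>?h\<close>
    vanishes. The constants close because 93/80 * 3/4 - 1/3 exceeds 1/2.\<close>
  also have "\<dots> \<le> (\<integral>y. ?h y \<partial>?M2)"
    using g by (intro integral_mono h) auto
  finally have h2: "(\<integral>y. ?h y \<partial>?M2) \<ge> real (d - m) / 2" by simp
  have "real m * (real (d - m) / 2) \<le> (\<integral>x. ?f x \<partial>?M1) * (\<integral>y. ?h y \<partial>?M2)"
    using f h2 by (intro mult_mono) auto
  then show "(\<integral>x. F x \<partial>D0) \<ge> real m * real (d - m) / 2" unfolding eq by simp
qed

end

section \<open>The uniform prior on the coefficients\<close>

context hidden_regression
begin

text \<open>Built on the restricted space so that every point of the product space lies in the box: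
  the bounds on the entries then hold pointwise and not merely almost everywhere.\<close>

definition unif :: "real measure" where
  "unif = density (restrict_space lborel {-b..b}) (\<lambda>_. ennreal (1 / (2 * b)))"

lemma space_unif [simp]: "space unif = {-b..b}"
  by (simp add: unif_def space_restrict_space)

lemma sets_unif: "sets unif = sets (restrict_space borel {-b..b})"
  by (simp add: unif_def sets_restrict_space)

lemma measurable_id_unif: "(\<lambda>x. x) \<in> borel_measurable unif"
  unfolding measurable_cong_sets[OF sets_unif refl] by (rule measurable_restrict_space1) simp

lemma measurable_unif:
  assumes "f \<in> borel_measurable borel" shows "f \<in> borel_measurable unif"
  using measurable_compose[OF measurable_id_unif assms] by simp

lemma prob_space_unif: "prob_space unif"
proof
  have "emeasure unif (space unif) = ennreal (1 / (2 * b)) * emeasure (restrict_space lborel {-b..b}) {-b..b}"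
    unfolding unif_def by (subst emeasure_density_const) (auto simp: space_restrict_space sets_restrict_space)
  also have "\<dots> = 1"
    using b_pos by (subst emeasure_restrict_space) (auto simp: ennreal_mult[symmetric] simp del: ennreal_1)
  finally show "emeasure unif (space unif) = 1" .
qed

lemma integral_unif:
  fixes f :: "real \<Rightarrow> real"
  assumes [measurable]: "f \<in> borel_measurable borel"
  shows "(\<integral>x. f x \<partial>unif) = (\<integral>x. f x * indicator {-b..b} x \<partial>lborel) / (2 * b)"
proof -
  have "f \<in> borel_measurable (restrict_space lborel {-b..b})"
    by (intro measurable_restrict_space1) simp
  then have "(\<integral>x. f x \<partial>unif) = (\<integral>x. (1 / (2 * b)) * f x \<partial>restrict_space lborel {-b..b})"
    unfolding unif_def using b_pos by (subst integral_density) auto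
  also have "\<dots> = (\<integral>x. f x * indicator {-b..b} x \<partial>lborel) / (2 * b)"
    by (subst integral_restrict_space) (auto simp: mult_ac set_lebesgue_integral_def)
  finally show ?thesis .
qed

lemma integrable_unif:
  fixes f :: "real \<Rightarrow> real"
  assumes "f \<in> borel_measurable borel" "\<And>x. -b \<le> x \<Longrightarrow> x \<le> b \<Longrightarrow> \<bar>f x\<bar> \<le> K"
  shows "integrable unif f"
proof -
  interpret prob_space unif by (rule prob_space_unif)
  show ?thesis using assms by (intro integrable_const_bound[of _ K] measurable_unif) auto
qed

lemma power_bound: "-b \<le> x \<Longrightarrow> x \<le> b \<Longrightarrow> \<bar>x ^ k\<bar> \<le> b ^ k"
  by (auto simp: power_abs intro!: power_mono)

lemma integrable_unif_power: "integrable unif (\<lambda>x. x ^ k)"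
  by (rule integrable_unif[of _ "b ^ k"]) (auto intro!: power_bound)

lemma integral_unif_power: "(\<integral>x. x ^ k \<partial>unif) = (b ^ Suc k - (- b) ^ Suc k) / (Suc k * (2 * b))"
  using integral_power[of "-b" b k] b_pos
  by (subst integral_unif) (auto simp: diff_divide_distrib)

lemma unif_moments:
  "(\<integral>x. x \<partial>unif) = 0" "(\<integral>x. x ^ 2 \<partial>unif) = b\<^sup>2 / 3" "(\<integral>x. x ^ 3 \<partial>unif) = 0" "(\<integral>x. x ^ 4 \<partial>unif) = b ^ 4 / 5"
  using integral_unif_power[of 1] integral_unif_power[of 2] integral_unif_power[of 3] integral_unif_power[of 4] b_pos
  by (simp_all add: power_numeral_reduce field_simps)

lemma unif_quadratic: "(\<integral>y. (a + u * y)\<^sup>2 \<partial>unif) = a\<^sup>2 + u\<^sup>2 * (b\<^sup>2 / 3)"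
proof -
  interpret U: prob_space unif by (rule prob_space_unif)
  have [simp]: "U.prob {-b..b} = 1" using U.prob_space by simp
  have e: "(a + u * y)\<^sup>2 = a\<^sup>2 + 2 * a * u * y + u\<^sup>2 * y\<^sup>2" for y
    by (simp add: power2_eq_square algebra_simps)
  have "integrable unif (\<lambda>y. y)" "integrable unif (\<lambda>y. y\<^sup>2)"
    using integrable_unif_power[of 1] integrable_unif_power[of 2] by simp_all
  then show ?thesis unfolding e by (simp add: unif_moments)
qed

lemma unif_quartic: "(\<integral>y. (a + u * y)^4 \<partial>unif) = a^4 + (6 * a\<^sup>2 * u\<^sup>2 * (b\<^sup>2 / 3) + u^4 * (b^4 / 5))"
proof -
  interpret U: prob_space unif by (rule prob_space_unif)
  have [simp]: "U.prob {-b..b} = 1" using U.prob_space by simp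
  have e: "(a + u * y)^4 = a^4 + 4 * a^3 * u * y + 6 * a\<^sup>2 * u\<^sup>2 * y\<^sup>2 + 4 * a * u^3 * y^3 + u^4 * y^4" for y
    by (simp add: power4_eq_xxxx power3_eq_cube power2_eq_square algebra_simps)
  have "integrable unif (\<lambda>y. y)" "integrable unif (\<lambda>y. y\<^sup>2)" "integrable unif (\<lambda>y. y^3)" "integrable unif (\<lambda>y. y^4)"
    using integrable_unif_power[of 1] integrable_unif_power[of 2] integrable_unif_power[of 3] integrable_unif_power[of 4]
    by simp_all
  then show ?thesis unfolding e by (simp add: unif_moments)
qed

text \<open>(b^2 - x^2)/2 is the primitive of -x that vanishes at both ends of the interval, that
  is, the Stein kernel of the uniform law.\<close>

lemma unif_by_parts:
  assumes D: "\<And>x. (f has_real_derivative f' x) (at x)" and c: "\<And>x. isCont f' x"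
  shows "(\<integral>x. x * f x \<partial>unif) = (\<integral>x. (b\<^sup>2 - x\<^sup>2) / 2 * f' x \<partial>unif)"
proof -
  have [measurable]: "f \<in> borel_measurable borel" "f' \<in> borel_measurable borel"
    using DERIV_isCont[OF D] c
    by (auto intro!: borel_measurable_continuous_onI continuous_at_imp_continuous_on)
  have "(\<integral>x. ((b\<^sup>2 - x\<^sup>2) / 2 * f' x) * indicator {-b..b} x \<partial>lborel) =
      (b\<^sup>2 - b\<^sup>2) / 2 * f b - (b\<^sup>2 - (-b)\<^sup>2) / 2 * f (-b) - (\<integral>x. (- x * f x) * indicator {-b..b} x \<partial>lborel)"
    using b_pos by (intro integral_by_parts D c) (auto intro!: derivative_eq_intros)
  then have "(\<integral>x. ((b\<^sup>2 - x\<^sup>2) / 2 * f' x) * indicator {-b..b} x \<partial>lborel) =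
     (\<integral>x. (x * f x) * indicator {-b..b} x \<partial>lborel)"
    by simp
  then show ?thesis by (subst (1 2) integral_unif) simp_all
qed

sublocale unif: product_sigma_finite "\<lambda>e::nat \<times> nat. unif"
  by unfold_locales (intro sigma_finite_measure.sigma_finite_countable prob_space_imp_sigma_finite prob_space_unif)

lemma measurable_coord_box: "e \<in> I \<Longrightarrow> (\<lambda>B. B e) \<in> borel_measurable (\<Pi>\<^sub>M e\<in>I. unif)"
  by (rule measurable_compose[OF measurable_component_singleton[of e I "\<lambda>_. unif"] measurable_id_unif]) auto

lemma box_range: "B \<in> space (\<Pi>\<^sub>M e\<in>I. unif) \<Longrightarrow> e \<in> I \<Longrightarrow> \<bar>B e\<bar> \<le> b"
  using PiE_mem[of B I "\<lambda>_. {-b..b}" e] by (simp add: space_PiM abs_le_iff)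

lemma integrable_box:
  fixes f :: "(nat \<times> nat \<Rightarrow> real) \<Rightarrow> real"
  assumes "f \<in> borel_measurable (\<Pi>\<^sub>M e\<in>I. unif)" "\<And>B. B \<in> space (\<Pi>\<^sub>M e\<in>I. unif) \<Longrightarrow> \<bar>f B\<bar> \<le> K"
  shows "integrable (\<Pi>\<^sub>M e\<in>I. unif) f"
proof -
  interpret box: prob_space "\<Pi>\<^sub>M e\<in>I. unif" by (intro prob_space_PiM prob_space_unif)
  show ?thesis
  proof (rule box.integrable_const_bound[OF AE_I2])
    show "norm (f B) \<le> K" if "B \<in> space (\<Pi>\<^sub>M e\<in>I. unif)" for B
      unfolding real_norm_def by (rule assms(2)[OF that])
  qed (rule assms(1))
qed

lemma linear_form_bound:
  assumes "B \<in> space (\<Pi>\<^sub>M e\<in>I. unif)"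
  shows "\<bar>\<Sum>e\<in>I. c e * B e\<bar> \<le> (\<Sum>e\<in>I. \<bar>c e\<bar> * b)"
proof -
  have "\<bar>\<Sum>e\<in>I. c e * B e\<bar> \<le> (\<Sum>e\<in>I. \<bar>c e * B e\<bar>)" by (rule sum_abs)
  also have "\<dots> \<le> (\<Sum>e\<in>I. \<bar>c e\<bar> * b)"
  proof (rule sum_mono)
    fix e assume "e \<in> I"
    then show "\<bar>c e * B e\<bar> \<le> \<bar>c e\<bar> * b"
      unfolding abs_mult by (intro mult_left_mono box_range[OF assms] abs_ge_zero)
  qed
  finally show ?thesis .
qed

lemma integrable_linear_form:
  fixes I :: "(nat \<times> nat) set"
  shows "integrable (\<Pi>\<^sub>M e\<in>I. unif) (\<lambda>B. (\<Sum>e\<in>I. c e * B e) ^ k)"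
proof (rule integrable_box[where K="(\<Sum>e\<in>I. \<bar>c e\<bar> * b) ^ k"])
  show "(\<lambda>B. (\<Sum>e\<in>I. c e * B e) ^ k) \<in> borel_measurable (Pi\<^sub>M I (\<lambda>e. unif))"
    by (intro borel_measurable_power borel_measurable_sum borel_measurable_times borel_measurable_const measurable_coord_box)
  show "\<bar>(\<Sum>e\<in>I. c e * B e) ^ k\<bar> \<le> (\<Sum>e\<in>I. \<bar>c e\<bar> * b) ^ k" if "B \<in> space (\<Pi>\<^sub>M e\<in>I. unif)" for B
    unfolding power_abs by (intro power_mono linear_form_bound that abs_ge_zero)
qed

text \<open>Independent coordinates are added one at a time, and odd moments vanish. The fourth
  moment is at most three times the square of the second, as for a Gaussian: 3 (b^2/3)^2 =
  b^4/3.\<close>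

lemma linear_form_moments:
  fixes I :: "(nat \<times> nat) set"
  assumes "finite I"
  shows "(\<integral>B. (\<Sum>e\<in>I. c e * B e)\<^sup>2 \<partial>(\<Pi>\<^sub>M e\<in>I. unif)) = b\<^sup>2 / 3 * (\<Sum>e\<in>I. (c e)\<^sup>2)"
    and "(\<integral>B. (\<Sum>e\<in>I. c e * B e)^4 \<partial>(\<Pi>\<^sub>M e\<in>I. unif)) \<le> b ^ 4 / 3 * (\<Sum>e\<in>I. (c e)\<^sup>2)\<^sup>2"
  using assms
proof (induction I rule: finite_induct)
  case empty
  { case 1 show ?case by simp next case 2 show ?case by simp }
next
  case (insert i I)
  interpret box: prob_space "\<Pi>\<^sub>M e\<in>I. unif" by (intro prob_space_PiM prob_space_unif)
  \<comment> \<open>Enlarging the one-dimensional fourth moment b^4/5 to b^4/3 completes the square,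
    which makes the bound stable under the induction.\<close>
  have fin: "b ^ 4 / 3 * s\<^sup>2 + (6 * (b\<^sup>2 / 3 * s) * u\<^sup>2 * (b\<^sup>2 / 3) + u^4 * (b^4 / 3)) = b ^ 4 / 3 * (u\<^sup>2 + s)\<^sup>2"
    for s u :: real
    by (simp add: power4_eq_xxxx power2_eq_square algebra_simps)
  let ?L = "\<lambda>B. \<Sum>e\<in>I. c e * B e"
  let ?S = "\<Sum>e\<in>I. (c e)\<^sup>2"
  note L = integrable_linear_form[of I c]
  have upd: "(\<Sum>e\<in>insert i I. c e * (B(i := y)) e) = ?L B + c i * y" for B y
  proof -
    have "(\<Sum>e\<in>I. c e * (B(i := y)) e) = ?L B" using insert.hyps by (intro sum.cong) auto
    then show ?thesis using insert.hyps by simp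
  qed
  note sq = unif_quadratic[of "?L B" "c i" for B] and quart = unif_quartic[of "?L B" "c i" for B]
  have e2: "(\<integral>B. (?L B)\<^sup>2 \<partial>(\<Pi>\<^sub>M e\<in>I. unif)) = b\<^sup>2 / 3 * ?S" by (rule insert.IH(1))
  have e4: "(\<integral>B. (?L B)^4 \<partial>(\<Pi>\<^sub>M e\<in>I. unif)) \<le> b ^ 4 / 3 * ?S\<^sup>2" by (rule insert.IH(2))
  { case 1
    have "(\<integral>B. (\<Sum>e\<in>insert i I. c e * B e)\<^sup>2 \<partial>(\<Pi>\<^sub>M e\<in>insert i I. unif))
      = (\<integral>B. (?L B)\<^sup>2 + (c i)\<^sup>2 * (b\<^sup>2 / 3) \<partial>(\<Pi>\<^sub>M e\<in>I. unif))"
      by (subst unif.product_integral_insert[OF insert.hyps integrable_linear_form]) (simp only: upd sq)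
    also have "\<dots> = b\<^sup>2 / 3 * ?S + (c i)\<^sup>2 * (b\<^sup>2 / 3)"
      using L[of 2] by (simp add: box.prob_space e2)
    finally show ?case using insert.hyps by (simp add: algebra_simps)
  next
    case 2
    have "(\<integral>B. (\<Sum>e\<in>insert i I. c e * B e)^4 \<partial>(\<Pi>\<^sub>M e\<in>insert i I. unif))
      = (\<integral>B. (?L B)^4 + (6 * (?L B)\<^sup>2 * (c i)\<^sup>2 * (b\<^sup>2 / 3) + (c i)^4 * (b^4 / 5)) \<partial>(\<Pi>\<^sub>M e\<in>I. unif))"
      by (subst unif.product_integral_insert[OF insert.hyps integrable_linear_form]) (simp only: upd quart)
    also have "\<dots> = (\<integral>B. (?L B)^4 \<partial>(\<Pi>\<^sub>M e\<in>I. unif)) + (6 * (b\<^sup>2 / 3 * ?S) * (c i)\<^sup>2 * (b\<^sup>2 / 3) + (c i)^4 * (b^4 / 5))"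
      using L[of 2] L[of 4] by (simp add: box.prob_space e2)
    also have "\<dots> \<le> b ^ 4 / 3 * ?S\<^sup>2 + (6 * (b\<^sup>2 / 3 * ?S) * (c i)\<^sup>2 * (b\<^sup>2 / 3) + (c i)^4 * (b^4 / 3))"
      using e4 b_pos by (intro add_mono order_refl mult_left_mono) simp_all
    also have "\<dots> = b ^ 4 / 3 * (\<Sum>e\<in>insert i I. (c e)\<^sup>2)\<^sup>2"
      unfolding fin using insert.hyps by simp
    finally show ?case .
  }
qed

lemma box_by_parts:
  fixes I :: "(nat \<times> nat) set"
  assumes I: "finite I" "e \<in> I"
    and i1: "integrable (\<Pi>\<^sub>M e\<in>I. unif) (\<lambda>B. B e * f B)"
    and i2: "integrable (\<Pi>\<^sub>M e\<in>I. unif) (\<lambda>B. (b\<^sup>2 - (B e)\<^sup>2) / 2 * f' B)"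
    and D: "\<And>B x. ((\<lambda>x. f (B(e := x))) has_real_derivative f' (B(e := x))) (at x)"
    and c: "\<And>B x. isCont (\<lambda>x. f' (B(e := x))) x"
  shows "(\<integral>B. B e * f B \<partial>(\<Pi>\<^sub>M e\<in>I. unif)) = (\<integral>B. (b\<^sup>2 - (B e)\<^sup>2) / 2 * f' B \<partial>(\<Pi>\<^sub>M e\<in>I. unif))"
proof -
  have I': "finite (I - {e})" "e \<notin> I - {e}" and eq: "insert e (I - {e}) = I" using I by auto
  show ?thesis
    unfolding unif.product_integral_insert[OF I', unfolded eq, OF i1]
      unif.product_integral_insert[OF I', unfolded eq, OF i2]
    by (simp only: fun_upd_same unif_by_parts[OF D c])
qed

end

section \<open>The regression model is Gaussian\<close>

text \<open>Both sides agree on product sets. It yields the Lebesgue density of the base model and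
  the likelihood of a whole dataset.\<close>

lemma PiM_density:
  fixes I :: "'i set"
  assumes I: "finite I" and M: "sigma_finite_measure M" and f[measurable]: "f \<in> borel_measurable M"
    and D: "sigma_finite_measure (density M f)"
  shows "(\<Pi>\<^sub>M i\<in>I. density M f) = density (\<Pi>\<^sub>M i\<in>I. M) (\<lambda>x. \<Prod>i\<in>I. f (x i))"
proof (rule sym)
  interpret D: product_sigma_finite "\<lambda>_::'i. density M f"
    by unfold_locales (rule sigma_finite_measure.sigma_finite_countable[OF D])
  interpret M: product_sigma_finite "\<lambda>_::'i. M"
    by unfold_locales (rule sigma_finite_measure.sigma_finite_countable[OF M])
  show "density (\<Pi>\<^sub>M i\<in>I. M) (\<lambda>x. \<Prod>i\<in>I. f (x i)) = (\<Pi>\<^sub>M i\<in>I. density M f)"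
  proof (rule D.PiM_eqI[OF I])
    show "sets (density (\<Pi>\<^sub>M i\<in>I. M) (\<lambda>x. \<Prod>i\<in>I. f (x i))) = sets (\<Pi>\<^sub>M i\<in>I. density M f)"
      by (simp cong: sets_PiM_cong)
    fix A assume A: "\<And>i. i \<in> I \<Longrightarrow> A i \<in> sets (density M f)"
    then have A': "Pi\<^sub>E I A \<in> sets (\<Pi>\<^sub>M i\<in>I. M)" using I by (intro sets_PiM_I_finite) auto
    have "emeasure (density (\<Pi>\<^sub>M i\<in>I. M) (\<lambda>x. \<Prod>i\<in>I. f (x i))) (Pi\<^sub>E I A)
      = (\<integral>\<^sup>+ x. (\<Prod>i\<in>I. f (x i)) * indicator (Pi\<^sub>E I A) x \<partial>(\<Pi>\<^sub>M i\<in>I. M))"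
      using A' by (subst emeasure_density) auto
    also have "\<dots> = (\<integral>\<^sup>+ x. (\<Prod>i\<in>I. f (x i) * indicator (A i) (x i)) \<partial>(\<Pi>\<^sub>M i\<in>I. M))"
    proof (rule nn_integral_cong)
      fix x assume "x \<in> space (\<Pi>\<^sub>M i\<in>I. M)"
      then have "indicator (Pi\<^sub>E I A) x = (\<Prod>i\<in>I. indicator (A i) (x i) :: ennreal)"
        using I by (auto simp: indicator_def space_PiM PiE_iff prod_zero_iff)
      then show "(\<Prod>i\<in>I. f (x i)) * indicator (Pi\<^sub>E I A) x = (\<Prod>i\<in>I. f (x i) * indicator (A i) (x i))"
        by (simp add: prod.distrib)
    qed
    also have "\<dots> = (\<Prod>i\<in>I. \<integral>\<^sup>+ x. f x * indicator (A i) x \<partial>M)"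
      using A by (intro M.product_nn_integral_prod[where f="\<lambda>i x. f x * indicator (A i) x"] I) auto
    also have "\<dots> = (\<Prod>i\<in>I. emeasure (density M f) (A i))"
      using A by (intro prod.cong refl, subst emeasure_density) auto
    finally show "emeasure (density (\<Pi>\<^sub>M i\<in>I. M) (\<lambda>x. \<Prod>i\<in>I. f (x i))) (Pi\<^sub>E I A)
      = (\<Prod>i\<in>I. emeasure (density M f) (A i))" .
  qed
qed

text \<open>\<open>mat_inverse\<close> is the outcome of an elimination procedure. A two-sided
  inverse makes the matrix a unit, which excludes \<open>None\<close>, and associativity then
  identifies the result.\<close>

lemma mat_inverse_eqI:
  assumes "A \<in> carrier_mat n n" "W \<in> carrier_mat n n" "A * W = 1\<^sub>m n" "W * A = 1\<^sub>m n"
  shows "mat_inverse A = Some (W :: 'a :: field mat)"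
proof (cases "mat_inverse A")
  case None
  then have "A \<notin> Units (ring_mat TYPE('a) n n)" by (rule mat_inverse(1)[OF assms(1)])
  moreover have "A \<in> Units (ring_mat TYPE('a) n n)"
    using assms by (auto simp: Units_def ring_mat_def)
  ultimately show ?thesis by simp
next
  case (Some X)
  then have X: "A * X = 1\<^sub>m n" "X \<in> carrier_mat n n" using mat_inverse(2)[OF assms(1)] by auto
  have "X = (W * A) * X" using assms X by simp
  also have "\<dots> = W * (A * X)" using assms X by (intro assoc_mult_mat) auto
  also have "\<dots> = W" using assms X by simp
  finally show ?thesis using Some by simp
qed

context hidden_regression
begin

text \<open>This matrix squares to zero, so both the covariance and its inverse are explicit.\<close>

definition hidden_mat :: "(nat \<times> nat \<Rightarrow> real) \<Rightarrow> real mat" where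
  "hidden_mat B = Matrix.mat d d (\<lambda>(i, j). if m \<le> i \<and> j < m then B (i, j) else 0)"

definition shear_mat :: "(nat \<times> nat \<Rightarrow> real) \<Rightarrow> real mat" where "shear_mat B = 1\<^sub>m d + hidden_mat B"
definition unshear_mat :: "(nat \<times> nat \<Rightarrow> real) \<Rightarrow> real mat" where "unshear_mat B = 1\<^sub>m d - hidden_mat B"
text \<open>The covariance (3/2) S S^T of white noise of variance 3/2 after the shear S. Its inverse
  is kept as a Gram matrix too, so that both quadratic forms are sums of squares.\<close>

definition cov_mat :: "(nat \<times> nat \<Rightarrow> real) \<Rightarrow> real mat" where
  "cov_mat B = (3 / 2) \<cdot>\<^sub>m (shear_mat B * transpose_mat (shear_mat B))"
definition prec_mat :: "(nat \<times> nat \<Rightarrow> real) \<Rightarrow> real mat" where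
  "prec_mat B = (2 / 3) \<cdot>\<^sub>m (transpose_mat (unshear_mat B) * unshear_mat B)"

lemma carriers [simp]: "hidden_mat B \<in> carrier_mat d d" "shear_mat B \<in> carrier_mat d d" "unshear_mat B \<in> carrier_mat d d"
  "cov_mat B \<in> carrier_mat d d" "prec_mat B \<in> carrier_mat d d"
  by (auto simp: hidden_mat_def shear_mat_def unshear_mat_def cov_mat_def prec_mat_def)

lemma hidden_mat_nilpotent: "hidden_mat B * hidden_mat B = 0\<^sub>m d d"
  by (rule eq_matI) (auto simp: hidden_mat_def scalar_prod_def intro!: sum.neutral)

lemma shear_mat_inverse: "shear_mat B * unshear_mat B = 1\<^sub>m d" "unshear_mat B * shear_mat B = 1\<^sub>m d"
proof -
  have "shear_mat B * unshear_mat B = (1\<^sub>m d + hidden_mat B) * 1\<^sub>m d - (1\<^sub>m d + hidden_mat B) * hidden_mat B"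
    unfolding shear_mat_def unshear_mat_def by (rule mult_minus_distrib_mat[of _ d d]) auto
  also have "(1\<^sub>m d + hidden_mat B) * hidden_mat B = hidden_mat B"
    by (subst add_mult_distrib_mat[of "1\<^sub>m d" d d "hidden_mat B" "hidden_mat B" d]) (auto simp: hidden_mat_nilpotent left_mult_one_mat[of "hidden_mat B" d d])
  finally show "shear_mat B * unshear_mat B = 1\<^sub>m d"
    by (intro eq_matI) (auto simp: right_mult_one_mat[of _ d d] shear_mat_def hidden_mat_def)
  have z: "hidden_mat B - 0\<^sub>m d d = hidden_mat B" by (intro eq_matI) (auto simp: hidden_mat_def)
  have "unshear_mat B * shear_mat B = (1\<^sub>m d - hidden_mat B) * 1\<^sub>m d + (1\<^sub>m d - hidden_mat B) * hidden_mat B"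
    unfolding shear_mat_def unshear_mat_def by (rule mult_add_distrib_mat[of _ d d]) (auto intro!: minus_carrier_mat)
  also have "(1\<^sub>m d - hidden_mat B) * hidden_mat B = hidden_mat B"
    by (subst minus_mult_distrib_mat[of "1\<^sub>m d" d d "hidden_mat B" "hidden_mat B" d]) (auto simp: z hidden_mat_nilpotent left_mult_one_mat[of "hidden_mat B" d d])
  finally show "unshear_mat B * shear_mat B = 1\<^sub>m d"
    by (intro eq_matI) (auto simp: right_mult_one_mat[of _ d d] hidden_mat_def)
qed

lemma cov_mat_prec_mat: "cov_mat B * prec_mat B = 1\<^sub>m d" "prec_mat B * cov_mat B = 1\<^sub>m d"
proof -
  have t: "transpose_mat (shear_mat B) * transpose_mat (unshear_mat B) = 1\<^sub>m d" "transpose_mat (unshear_mat B) * transpose_mat (shear_mat B) = 1\<^sub>m d"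
    by (subst transpose_mult[symmetric, of _ d d _ d], simp, simp, simp add: shear_mat_inverse)+
  let ?T = "transpose_mat (shear_mat B)" and ?T' = "transpose_mat (unshear_mat B)"
  have c: "?T \<in> carrier_mat d d" "?T' \<in> carrier_mat d d" by auto
  have mult4: "(P * Q) * (R * S) = P * ((Q * R) * S)"
    if "P \<in> carrier_mat d d" "Q \<in> carrier_mat d d" "R \<in> carrier_mat d d" "S \<in> carrier_mat d d"
    for P Q R S :: "real mat"
    unfolding assoc_mult_mat[OF that(1,2) mult_carrier_mat[OF that(3,4)]] assoc_mult_mat[OF that(2-4)] ..
  have "(shear_mat B * ?T) * (?T' * unshear_mat B) = shear_mat B * ((?T * ?T') * unshear_mat B)"
    using c by (intro mult4) auto
  also have "\<dots> = 1\<^sub>m d" by (simp add: t shear_mat_inverse left_mult_one_mat[of _ d d])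
  finally have 1: "(shear_mat B * ?T) * (?T' * unshear_mat B) = 1\<^sub>m d" .
  have "(?T' * unshear_mat B) * (shear_mat B * ?T) = ?T' * ((unshear_mat B * shear_mat B) * ?T)"
    using c by (intro mult4) auto
  also have "\<dots> = 1\<^sub>m d" using c by (simp add: t shear_mat_inverse left_mult_one_mat[of _ d d])
  finally have 2: "(?T' * unshear_mat B) * (shear_mat B * ?T) = 1\<^sub>m d" .
  have c2: "shear_mat B * ?T \<in> carrier_mat d d" "?T' * unshear_mat B \<in> carrier_mat d d"
    using c by (auto intro: mult_carrier_mat[of _ d d])
  have "cov_mat B * prec_mat B = (3 / 2) \<cdot>\<^sub>m ((shear_mat B * ?T) * ((2 / 3) \<cdot>\<^sub>m (?T' * unshear_mat B)))"
    unfolding cov_mat_def prec_mat_def by (rule mult_smult_assoc_mat[OF c2(1) smult_carrier_mat[OF c2(2)]])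
  also have "\<dots> = 1\<^sub>m d"
    unfolding mult_smult_distrib[OF c2] 1 by (intro eq_matI) auto
  finally show "cov_mat B * prec_mat B = 1\<^sub>m d" .
  have "prec_mat B * cov_mat B = (2 / 3) \<cdot>\<^sub>m ((?T' * unshear_mat B) * ((3 / 2) \<cdot>\<^sub>m (shear_mat B * ?T)))"
    unfolding cov_mat_def prec_mat_def by (rule mult_smult_assoc_mat[OF c2(2) smult_carrier_mat[OF c2(1)]])
  also have "\<dots> = 1\<^sub>m d"
    unfolding mult_smult_distrib[OF c2(2,1)] 2 by (intro eq_matI) auto
  finally show "prec_mat B * cov_mat B = 1\<^sub>m d" .
qed

lemma mat_inverse_cov_mat: "mat_inverse (cov_mat B) = Some (prec_mat B)"
  by (intro mat_inverse_eqI[of _ d] cov_mat_prec_mat) auto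

text \<open>Applied to \<open>unshear_mat\<close> for the Gaussian exponent and to the transpose of
  \<open>shear_mat\<close> for the covariance bounds.\<close>

lemma gram_quadratic_form:
  fixes A :: "real mat"
  assumes A: "A \<in> carrier_mat d d" and z: "z \<in> carrier_vec d"
  shows "scalar_prod z ((a \<cdot>\<^sub>m (transpose_mat A * A)) *\<^sub>v z) = a * (\<Sum>i<d. (scalar_prod (row A i) z)\<^sup>2)"
proof -
  have At: "transpose_mat A \<in> carrier_mat d d" and Az: "A *\<^sub>v z \<in> carrier_vec d" using A z by auto
  have "(a \<cdot>\<^sub>m (transpose_mat A * A)) *\<^sub>v z = a \<cdot>\<^sub>v (transpose_mat A *\<^sub>v (A *\<^sub>v z))"
  proof -
    have "(a \<cdot>\<^sub>m G) *\<^sub>v z = a \<cdot>\<^sub>v (G *\<^sub>v z)" if "G \<in> carrier_mat d d" for G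
      using that z by (intro eq_vecI) auto
    from this[of "transpose_mat A * A"] show ?thesis
      using A At z by (simp only: mult_carrier_mat assoc_mult_mat_vec[of _ d d _ d])
  qed
  then have "scalar_prod z ((a \<cdot>\<^sub>m (transpose_mat A * A)) *\<^sub>v z) = a * scalar_prod z (transpose_mat A *\<^sub>v (A *\<^sub>v z))"
    using At Az z by (simp add: scalar_prod_smult_distrib[of _ d])
  also have "scalar_prod z (transpose_mat A *\<^sub>v (A *\<^sub>v z)) = scalar_prod (A *\<^sub>v z) (A *\<^sub>v z)"
    using transpose_vec_mult_scalar[OF At Az z] A by simp
  also have "\<dots> = (\<Sum>i<d. (scalar_prod (row A i) z)\<^sup>2)"
    using A by (auto simp: scalar_prod_def[of "A *\<^sub>v z"] power2_eq_square atLeast0LessThan intro!: sum.cong)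
  finally show ?thesis .
qed

text \<open>The exponent is governed by the squared length of the residual vector; expanding (x_j -
  shift)^2 over the responses gives the terms -2 T and V of \<open>lik1\<close>.\<close>

lemma gaussian_weight_cov_mat:
  "gaussian_weight d (0\<^sub>v d) (cov_mat B) x = exp (- (\<Sum>i<d. (x i)\<^sup>2) / 3) * lik1 B x"
proof -
  have z: "Matrix.vec d x - 0\<^sub>v d = Matrix.vec d x" by (intro eq_vecI) auto
  have un: "{..<d} = {..<m} \<union> {m..<d}" "{..<m} \<inter> {m..<d} = {}" using m_less by auto
  have row: "scalar_prod (row (unshear_mat B) i) (Matrix.vec d x) = x i - (if m \<le> i then shift B x i else 0)"
    if i: "i < d" for i
  proof -
    have "scalar_prod (row (unshear_mat B) i) (Matrix.vec d x)
      = (\<Sum>j<d. (if j = i then x j else 0) - (if m \<le> i \<and> j < m then B (i, j) * x j else 0))"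
      using i by (auto simp: scalar_prod_def unshear_mat_def hidden_mat_def atLeast0LessThan algebra_simps intro!: sum.cong)
    also have "\<dots> = x i - (\<Sum>j<d. if m \<le> i \<and> j < m then B (i, j) * x j else 0)"
      using i by (simp add: sum_subtractf)
    also have "(\<Sum>j<d. if m \<le> i \<and> j < m then B (i, j) * x j else 0) = (if m \<le> i then shift B x i else 0)"
      unfolding un(1) by (subst sum.union_disjoint) (auto simp: shift_def)
    finally show ?thesis .
  qed
  have "(\<Sum>i<d. (x i - (if m \<le> i then shift B x i else 0))\<^sup>2)
     = (\<Sum>i<m. (x i)\<^sup>2) + (\<Sum>i=m..<d. (x i - shift B x i)\<^sup>2)"
    unfolding un(1) by (subst sum.union_disjoint) auto
  also have "\<dots> = (\<Sum>i<d. (x i)\<^sup>2) - 2 * T B x + V B x"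
    unfolding un(1) T_def V_def
    by (subst sum.union_disjoint) (auto simp: power2_diff sum.distrib sum_subtractf sum_distrib_left mult.assoc)
  finally have s: "(\<Sum>i<d. (x i - (if m \<le> i then shift B x i else 0))\<^sup>2) = (\<Sum>i<d. (x i)\<^sup>2) - 2 * T B x + V B x" .
  have q: "scalar_prod (Matrix.vec d x) (prec_mat B *\<^sub>v Matrix.vec d x) = 2 / 3 * ((\<Sum>i<d. (x i)\<^sup>2) - 2 * T B x + V B x)"
    unfolding prec_mat_def by (subst gram_quadratic_form) (simp_all add: row s)
  show ?thesis
    unfolding gaussian_weight_def Let_def z mat_inverse_cov_mat option.sel q lik1_def exp_add[symmetric]
    by (simp add: field_simps)
qed

lemma D0_density: "D0 = density (euclid d) (\<lambda>x. ennreal ((1 / sqrt (3 * pi)) ^ d * exp (- (\<Sum>i<d. (x i)\<^sup>2) / 3)))"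
proof -
  have "D0 = density (\<Pi>\<^sub>M i\<in>{..<d}. lborel) (\<lambda>x. \<Prod>i<d. ennreal (normal_density 0 (sqrt (3/2)) (x i)))"
    unfolding D0_def nu_def
    by (rule PiM_density)
       (auto simp: nu_def[symmetric] intro: prob_space_imp_sigma_finite prob_space_nu lborel.sigma_finite_measure_axioms)
  also have "\<dots> = density (euclid d) (\<lambda>x. ennreal ((1 / sqrt (3 * pi)) ^ d * exp (- (\<Sum>i<d. (x i)\<^sup>2) / 3)))"
    unfolding euclid_def
    by (intro arg_cong2[where f=density] refl ext)
       (simp add: prod_ennreal normal_density_def prod.distrib exp_sum sum_negf[symmetric] sum_divide_distrib prod_dividef power_divide)
  finally show ?thesis .
qed

text \<open>No determinant is computed: \<open>DB B\<close> already has mass one, which forces the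
  normalising integral to be the reciprocal of the constant in \<open>D0_density\<close>.\<close>

lemma gaussian_eq_DB: "gaussian d (0\<^sub>v d) (cov_mat B) = DB B"
proof -
  let ?K = "(1 / sqrt (3 * pi)) ^ d"
  let ?w = "gaussian_weight d (0\<^sub>v d) (cov_mat B)"
  have K: "0 < ?K" by simp
  have sm: "(\<lambda>x. \<Sum>i<d. (x i)\<^sup>2) \<in> borel_measurable (euclid d)"
    by (intro borel_measurable_sum borel_measurable_power measurable_coord_euclid) auto
  have lkm: "lik1 B \<in> borel_measurable (euclid d)"
    using measurable_fixed_D0(4)[of B] unfolding measurable_cong_sets[OF sets_D0 refl] .
  note [measurable] = sm lkm
  have w[measurable]: "?w \<in> borel_measurable (euclid d)"
    unfolding gaussian_weight_cov_mat[abs_def] by measurable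
  have DB: "DB B = density (euclid d) (\<lambda>x. ennreal (?K * ?w x))"
    unfolding DB_def D0_density
    by (subst density_density_eq)
       (auto simp: gaussian_weight_cov_mat ennreal_mult[symmetric] lik1_def mult_ac intro!: arg_cong2[where f=density])
  have "(\<integral>\<^sup>+ x. ennreal (?K * ?w x) \<partial>euclid d) = emeasure (DB B) (space (euclid d))"
    unfolding DB by (subst emeasure_density) (auto intro!: nn_integral_cong)
  also have "\<dots> = 1"
    using prob_space.emeasure_space_1[OF prob_space_DB[of B]] by (simp add: DB)
  finally have "(\<integral>x. ?K * ?w x \<partial>euclid d) = 1"
    by (subst integral_eq_nn_integral) (auto simp: gaussian_weight_cov_mat lik1_def)
  then have "?K * (\<integral>x. ?w x \<partial>euclid d) = 1" by simp
  then have "(\<integral>x. ?w x \<partial>euclid d) = 1 / ?K" using K by (simp add: field_simps)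
  then have "?w x / (\<integral>x. ?w x \<partial>euclid d) = ?K * ?w x" for x by simp
  then show ?thesis unfolding DB gaussian_def by simp
qed

text \<open>The hidden matrix has Frobenius norm at most b d <= 1/40, so the transposed shear scales
  squared lengths by factors between (39/40)^2 and (41/40)^2; times 3/2 this stays within
  [1, 2].\<close>

lemma cov_mat_quadratic_form:
  assumes B: "\<And>e. e \<in> {m..<d} \<times> {..<m} \<Longrightarrow> \<bar>B e\<bar> \<le> b" and b_small: "b * d \<le> 1 / 40"
    and v: "v \<in> carrier_vec d"
  shows "scalar_prod v v \<le> scalar_prod v (cov_mat B *\<^sub>v v)" "scalar_prod v (cov_mat B *\<^sub>v v) \<le> 2 * scalar_prod v v"
proof -
  define y where "y i = v $ i" for i
  define a where "a i j = (if m \<le> j \<and> i < m then B (j, i) else 0)" for i j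
  define u where "u i = (\<Sum>j<d. a i j * y j)" for i
  define q where "q = (\<Sum>i<d. (y i)\<^sup>2)"
  have q0: "0 \<le> q" by (simp add: q_def sum_nonneg)
  have vv: "scalar_prod v v = q"
    using v by (simp add: scalar_prod_def q_def y_def atLeast0LessThan power2_eq_square)
  have row: "scalar_prod (row (transpose_mat (shear_mat B)) i) v = y i + u i" if i: "i < d" for i
  proof -
    have "scalar_prod (row (transpose_mat (shear_mat B)) i) v = (\<Sum>j<d. (if j = i then y j else 0) + a i j * y j)"
      using i v m_less by (auto simp: scalar_prod_def shear_mat_def hidden_mat_def a_def y_def atLeast0LessThan algebra_simps intro!: sum.cong)
    then show ?thesis using i by (simp add: sum.distrib u_def)
  qed
  have Sq: "scalar_prod v (cov_mat B *\<^sub>v v) = 3 / 2 * (\<Sum>i<d. (y i + u i)\<^sup>2)"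
    using gram_quadratic_form[of "transpose_mat (shear_mat B)" v "3/2"] v by (simp add: cov_mat_def row)
  have a_le: "(a i j)\<^sup>2 \<le> b\<^sup>2" if "i < d" "j < d" for i j
  proof -
    have "\<bar>a i j\<bar> \<le> b" using B[of "(j, i)"] that b_pos by (auto simp: a_def)
    then show ?thesis using power_mono[of "\<bar>a i j\<bar>" b 2] by simp
  qed
  have u_le: "(u i)\<^sup>2 \<le> d * b\<^sup>2 * q" if i: "i < d" for i
  proof -
    have "(u i)\<^sup>2 \<le> (\<Sum>j<d. (a i j)\<^sup>2) * q"
      unfolding u_def q_def by (rule Cauchy_Schwarz_ineq_sum)
    also have "\<dots> \<le> (\<Sum>j<d. b\<^sup>2) * q"
      using a_le[OF i] q0 by (intro mult_right_mono sum_mono) auto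
    finally show ?thesis by simp
  qed
  have "(\<Sum>i<d. (u i)\<^sup>2) \<le> (\<Sum>i<d. d * b\<^sup>2 * q)" by (intro sum_mono u_le) auto
  also have "\<dots> = (b * d)\<^sup>2 * q" by (simp add: power2_eq_square)
  also have "\<dots> \<le> (1 / 40)\<^sup>2 * q"
    using b_small b_pos q0 by (intro mult_right_mono power_mono) auto
  finally have U: "(\<Sum>i<d. (u i)\<^sup>2) \<le> q / 1600" by (simp add: power2_eq_square)
  \<comment> \<open>Young's inequality with parameter 40, matched to the ratio 1/40 between the
    lengths of \<open>u\<close> and \<open>y\<close>.\<close>
  have lo: "39 / 40 * (y i)\<^sup>2 - 39 * (u i)\<^sup>2 \<le> (y i + u i)\<^sup>2" for i
  proof -
    have "0 \<le> (y i + 40 * u i)\<^sup>2" by simp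
    then show ?thesis by (simp add: power2_eq_square algebra_simps)
  qed
  have hi: "(y i + u i)\<^sup>2 \<le> 41 / 40 * (y i)\<^sup>2 + 41 * (u i)\<^sup>2" for i
  proof -
    have "0 \<le> (y i - 40 * u i)\<^sup>2" by simp
    then show ?thesis by (simp add: power2_eq_square algebra_simps)
  qed
  have "(\<Sum>i<d. 39 / 40 * (y i)\<^sup>2 - 39 * (u i)\<^sup>2) \<le> (\<Sum>i<d. (y i + u i)\<^sup>2)" by (intro sum_mono lo)
  then have "39 / 40 * q - 39 * (\<Sum>i<d. (u i)\<^sup>2) \<le> (\<Sum>i<d. (y i + u i)\<^sup>2)"
    by (simp add: sum_subtractf sum_distrib_left q_def)
  with U q0 show "scalar_prod v v \<le> scalar_prod v (cov_mat B *\<^sub>v v)" unfolding vv Sq by linarith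
  have "(\<Sum>i<d. (y i + u i)\<^sup>2) \<le> (\<Sum>i<d. 41 / 40 * (y i)\<^sup>2 + 41 * (u i)\<^sup>2)" by (intro sum_mono hi)
  then have "(\<Sum>i<d. (y i + u i)\<^sup>2) \<le> 41 / 40 * q + 41 * (\<Sum>i<d. (u i)\<^sup>2)"
    by (simp add: sum.distrib sum_distrib_left q_def)
  with U q0 show "scalar_prod v (cov_mat B *\<^sub>v v) \<le> 2 * scalar_prod v v" unfolding vv Sq by linarith
qed

lemma DB_in_gaussian_class:
  assumes B: "\<And>e. e \<in> {m..<d} \<times> {..<m} \<Longrightarrow> \<bar>B e\<bar> \<le> b" and b_small: "b * d \<le> 1 / 40"
  shows "DB B \<in> gaussian_class d"
proof -
  note qf = cov_mat_quadratic_form[OF B b_small]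
  have sym: "transpose_mat (cov_mat B) = cov_mat B"
  proof -
    have "transpose_mat (shear_mat B * transpose_mat (shear_mat B)) = shear_mat B * transpose_mat (shear_mat B)"
      by (subst transpose_mult[of _ d d _ d]) auto
    moreover have "transpose_mat (k \<cdot>\<^sub>m A) = k \<cdot>\<^sub>m transpose_mat A" for k :: real and A
      by (intro eq_matI) auto
    ultimately show ?thesis unfolding cov_mat_def by simp
  qed
  have dist: "scalar_prod v ((P - Q) *\<^sub>v v) = scalar_prod v (P *\<^sub>v v) - scalar_prod v (Q *\<^sub>v v)"
    if "P \<in> carrier_mat d d" "Q \<in> carrier_mat d d" "v \<in> carrier_vec d" for P Q :: "real mat" and v
    using that by (subst minus_mult_distrib_mat_vec[of _ d d]) (auto intro!: scalar_prod_minus_distrib[of _ d])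
  have two: "(2 \<cdot>\<^sub>m 1\<^sub>m d) *\<^sub>v v = 2 \<cdot>\<^sub>v v" if "v \<in> carrier_vec d" for v :: "real Matrix.vec"
    using that by (intro eq_vecI) auto
  have sym1: "transpose_mat (P - Q) = P - Q"
    if "P \<in> carrier_mat d d" "Q \<in> carrier_mat d d" "transpose_mat P = P" "transpose_mat Q = Q" for P Q :: "real mat"
    using that transpose_minus[of P d d Q] by simp
  have sym2: "transpose_mat (2 \<cdot>\<^sub>m 1\<^sub>m d) = (2 \<cdot>\<^sub>m 1\<^sub>m d :: real mat)"
    by (intro eq_matI) auto
  have "loewner_le d (1\<^sub>m d) (cov_mat B)"
    unfolding loewner_le_def pos_semidef_def
    using sym qf(1) by (auto simp: dist sym1 intro: minus_carrier_mat)
  moreover have "loewner_le d (cov_mat B) (2 \<cdot>\<^sub>m 1\<^sub>m d)"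
    unfolding loewner_le_def pos_semidef_def
    using sym sym2 qf(2) by (auto simp: dist sym1 two scalar_prod_smult_distrib[of _ d] intro: minus_carrier_mat)
  ultimately show ?thesis
    unfolding gaussian_class_def gaussian_eq_DB[symmetric]
    by (auto intro!: exI[of _ "0\<^sub>v d"] exI[of _ "cov_mat B"])
qed

end

section \<open>The test statistic\<close>

context hidden_regression
begin

abbreviation box :: "(nat \<times> nat \<Rightarrow> real) measure" where "box \<equiv> \<Pi>\<^sub>M e\<in>E. unif"

sublocale box: prob_space box by (intro prob_space_PiM prob_space_unif)

text \<open>The Stein kernel of the uniform prior, evaluated at entry \<open>e\<close>.\<close>

definition wgt :: "(nat \<times> nat \<Rightarrow> real) \<Rightarrow> nat \<times> nat \<Rightarrow> real" where
  "wgt B e = (b\<^sup>2 - (B e)\<^sup>2) / 2"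

definition outer :: "(nat \<Rightarrow> real) \<Rightarrow> nat \<times> nat \<Rightarrow> real" where
  "outer z e = z (fst e) * z (snd e)"

text \<open>Chosen so that t * damp t is bounded, while t^2 * damp t still dominates t^2 - t^4;
  second and fourth moments of \<open>T\<close> then suffice for the lower bound.\<close>

definition damp :: "real \<Rightarrow> real" where "damp t = 1 / (1 + t\<^sup>2)"
definition damp' :: "real \<Rightarrow> real" where "damp' t = - (2 * t) / (1 + t\<^sup>2)\<^sup>2"

text \<open>The coefficient of \<open>damp' (T B z)\<close> that the product rule creates: the
  derivative of \<open>T B z\<close> in entry \<open>e\<close> is \<open>outer z e\<close>, which
  meets the factor \<open>outer z e\<close> already present.\<close>

definition R :: "(nat \<times> nat \<Rightarrow> real) \<Rightarrow> (nat \<Rightarrow> real) \<Rightarrow> real" where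
  "R B z = (\<Sum>e\<in>E. wgt B e * (outer z e)\<^sup>2)"

text \<open>The damping factor keeps the statistic bounded, as accuracy in total variation requires. The second
  summand compensates for its derivative in the integration by parts; both summands are odd in \<open>T B z\<close>.\<close>

definition zeta :: "(nat \<times> nat \<Rightarrow> real) \<Rightarrow> (nat \<Rightarrow> real) \<Rightarrow> real" where
  "zeta B z = (if good z then T B z * damp (T B z) - R B z * damp' (T B z) else 0)"

text \<open>The partial derivative of \<open>ln (lik1 B x)\<close> in entry \<open>e\<close>:
  residual times input, divided by the variance.\<close>

definition score :: "(nat \<times> nat \<Rightarrow> real) \<Rightarrow> (nat \<Rightarrow> real) \<Rightarrow> nat \<times> nat \<Rightarrow> real" where
  "score B x e = 2 / 3 * (x (fst e) - shift B x (fst e)) * x (snd e)"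

text \<open>\<open>z\<close> is the output and \<open>x\<close> a sample. Truncation and damping
  involve \<open>z\<close> alone, so for fixed \<open>B\<close> and \<open>z\<close> this is linear
  in the score of the sample.\<close>

definition Phi :: "(nat \<times> nat \<Rightarrow> real) \<Rightarrow> (nat \<Rightarrow> real) \<Rightarrow> (nat \<Rightarrow> real) \<Rightarrow> real" where
  "Phi B z x = (if good z then damp (T B z) * (\<Sum>e\<in>E. wgt B e * outer z e * score B x e) else 0)"

lemma T_eq: "T B z = (\<Sum>e\<in>E. B e * outer z e)"
  by (simp add: T_def shift_def outer_def sum.cartesian_product' sum_distrib_left mult_ac)

lemma sum_outer_sq: "(\<Sum>e\<in>E. (outer z e)\<^sup>2) = out_sq z * in_sq z"
  by (simp add: outer_def in_sq_def out_sq_def sum.cartesian_product' sum_product power_mult_distrib)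

lemma wgt_bounds:
  assumes "\<bar>B e\<bar> \<le> b" shows "0 \<le> wgt B e" "wgt B e \<le> b\<^sup>2 / 2"
proof -
  have "(B e)\<^sup>2 \<le> b\<^sup>2" using power_mono[OF assms, of 2] by simp
  then show "0 \<le> wgt B e" "wgt B e \<le> b\<^sup>2 / 2" by (simp_all add: wgt_def)
qed

lemma damp_bounds: "0 < damp t" "damp t \<le> 1"
  by (auto simp: damp_def add_pos_nonneg)

lemma damp'_bound: "\<bar>damp' t\<bar> \<le> 1"
proof -
  have "2 * \<bar>t\<bar> \<le> 1 + t\<^sup>2"
    using sum_squares_bound[of "\<bar>t\<bar>" 1] by simp
  also have "\<dots> \<le> (1 + t\<^sup>2)\<^sup>2" by (simp add: power2_eq_square[of "1 + t\<^sup>2"] algebra_simps)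
  finally have "2 * \<bar>t\<bar> / (1 + t\<^sup>2)\<^sup>2 \<le> 1" by (intro divide_le_eq_1[THEN iffD2]) (auto simp: add_pos_nonneg)
  then show ?thesis by (simp add: damp'_def abs_mult)
qed

lemma t_damp_bound: "\<bar>t * damp t\<bar> \<le> 1 / 2"
proof -
  have "2 * \<bar>t\<bar> \<le> 1 + t\<^sup>2"
    using sum_squares_bound[of "\<bar>t\<bar>" 1] by simp
  then show ?thesis by (simp add: damp_def abs_mult add_pos_nonneg field_simps)
qed

lemma R_bounds:
  assumes B: "B \<in> space box" and z: "good z" and b_small: "b * d \<le> 1 / 40"
  shows "0 \<le> R B z" "R B z \<le> 1 / 8"
proof -
  note w = wgt_bounds[OF box_range[OF B]]
  show "0 \<le> R B z" unfolding R_def by (intro sum_nonneg mult_nonneg_nonneg w) auto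
  have "R B z \<le> (\<Sum>e\<in>E. b\<^sup>2 / 2 * (outer z e)\<^sup>2)"
    unfolding R_def by (intro sum_mono mult_right_mono w) auto
  also have "\<dots> = b\<^sup>2 / 2 * (out_sq z * in_sq z)" by (simp only: sum_distrib_left[symmetric] sum_outer_sq)
  also have "\<dots> \<le> b\<^sup>2 / 2 * ((20 * real d) * (20 * real d))"
    by (intro mult_left_mono mult_mono) (use z out_sq_nonneg[of z] in_sq_nonneg[of z] in \<open>simp_all add: good_def\<close>)
  also have "\<dots> = 200 * (b * d)\<^sup>2" by (simp add: power2_eq_square)
  also have "\<dots> \<le> 200 * (1 / 40)\<^sup>2"
    using b_small b_pos by (intro mult_left_mono power_mono) auto
  finally show "R B z \<le> 1 / 8" by (simp add: power2_eq_square)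
qed

text \<open>On a good output the damped term is at most 1/2, and the correction at most 200 (b d)^2
  <= 1/8. The bound is free of the dimension, so accuracy at a constant level is meaningful.\<close>

lemma zeta_bound:
  assumes B: "B \<in> space box" and b_small: "b * d \<le> 1 / 40"
  shows "\<bar>zeta B z\<bar> \<le> 1"
proof (cases "good z")
  case True
  have "\<bar>R B z * damp' (T B z)\<bar> \<le> 1 / 8 * 1"
    unfolding abs_mult using R_bounds[OF B True b_small] damp'_bound by (intro mult_mono) auto
  then show ?thesis using t_damp_bound[of "T B z"] True by (simp add: zeta_def)
qed (simp add: zeta_def)

lemma T_neg: "T B (neg x) = - T B x" and V_neg: "V B (neg x) = V B x"
proof -
  have s: "shift B (neg x) j = shift B x j" for j
    using m_less by (auto simp: shift_def neg_def intro!: sum.cong)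
  show "T B (neg x) = - T B x" unfolding T_def s sum_negf[symmetric] by (intro sum.cong) (auto simp: neg_def)
  show "V B (neg x) = V B x" by (auto simp: V_def s)
qed

lemma zeta_neg: "zeta B (neg x) = - zeta B x"
proof -
  have "in_sq (neg x) = in_sq x" "out_sq (neg x) = out_sq x"
    using m_less by (auto simp: in_sq_def out_sq_def neg_def intro!: sum.cong)
  moreover have "(outer (neg x) e)\<^sup>2 = (outer x e)\<^sup>2" if "e \<in> E" for e
    using that m_less by (auto simp: outer_def neg_def)
  then have "R B (neg x) = R B x" unfolding R_def by (intro sum.cong) auto
  ultimately show ?thesis by (simp add: zeta_def good_def T_neg damp_def damp'_def)
qed

text \<open>For each good \<open>z\<close> a polynomial in the entries of \<open>B\<close>, so its
  prior average needs only second and fourth moments of linear forms.\<close>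

definition low :: "(nat \<times> nat \<Rightarrow> real) \<Rightarrow> (nat \<Rightarrow> real) \<Rightarrow> real" where
  "low B z = (if good z then (T B z)\<^sup>2 - (T B z)^4 - V B z / 3 else 0)"

lemma V_nonneg: "0 \<le> V B x" by (simp add: V_def sum_nonneg)

text \<open>This is sinh a >= a for a >= 0, from exp x + exp(-x) >= 2; multiplication by
  \<open>t\<close> makes it valid for both signs.\<close>

lemma sinh_lower: "4 / 3 * t\<^sup>2 \<le> t * (exp (2/3 * t) - exp (- (2/3 * t)))" for t :: real
proof -
  have *: "2 * a \<le> exp a - exp (- a)" if "0 \<le> a" for a :: real
  proof -
    let ?f = "\<lambda>a::real. exp a - exp (- a) - 2 * a"
    have "?f 0 \<le> ?f a"
    proof (rule DERIV_nonneg_imp_nondecreasing[OF that])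
      fix x :: real
      have "(?f has_real_derivative (exp x + exp (- x) - 2)) (at x)"
        by (auto intro!: derivative_eq_intros)
      moreover have "0 \<le> exp x + exp (- x) - 2"
        using exp_ge_add_one_self[of x] exp_ge_add_one_self[of "-x"] by linarith
      ultimately show "\<exists>y. (?f has_real_derivative y) (at x) \<and> 0 \<le> y" by blast
    qed
    then show ?thesis by simp
  qed
  show ?thesis
  proof (cases "0 \<le> t")
    case True
    then show ?thesis using mult_left_mono[OF *[of "2/3 * t"], of t] by (simp add: power2_eq_square)
  next
    case False
    then show ?thesis using mult_left_mono[OF *[of "- (2/3 * t)"], of "-t"] by (simp add: power2_eq_square algebra_simps)
  qed
qed

text \<open>Pairing \<open>x\<close> with \<open>neg x\<close> turns the likelihood into a
  hyperbolic sine. The correction with \<open>R\<close> has the sign of \<open>T\<close>, so it only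
  helps and is dropped. What remains follows from sinh a >= a, exp(-v/3) >= 1 - v/3 and t^2 - t^4 <=
  t^2 * damp t <= 1.\<close>

lemma zeta_low_pointwise:
  assumes B: "B \<in> space box" and b_small: "b * d \<le> 1 / 40"
  shows "4 / 3 * low B x \<le> zeta B x * lik1 B x - zeta B x * lik1 B (neg x)"
proof (cases "good x")
  case True
  let ?t = "T B x" and ?v = "V B x"
  have k: "zeta B x = ?t * (damp ?t + R B x * (2 / (1 + ?t\<^sup>2)\<^sup>2))"
    using True by (simp add: zeta_def damp'_def algebra_simps)
  have "zeta B x * lik1 B x - zeta B x * lik1 B (neg x) =
      (damp ?t + R B x * (2 / (1 + ?t\<^sup>2)\<^sup>2)) * (?t * (exp (2/3 * ?t) - exp (- (2/3 * ?t)))) * exp (- (?v / 3))"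
    unfolding k lik1_def T_neg V_neg exp_diff by (simp add: exp_minus field_simps)
  also have "\<dots> \<ge> damp ?t * (4 / 3 * ?t\<^sup>2) * exp (- (?v / 3))"
    using R_bounds(1)[OF B True b_small] sinh_lower[of ?t] damp_bounds[of ?t]
    by (intro mult_right_mono[OF mult_mono[OF _ sinh_lower]] add_increasing2) simp_all
  finally have 1: "4 / 3 * (?t\<^sup>2 * damp ?t * exp (- (?v / 3))) \<le> zeta B x * lik1 B x - zeta B x * lik1 B (neg x)"
    by (simp add: mult_ac)
  have a0: "0 \<le> ?t\<^sup>2 * damp ?t" using damp_bounds[of ?t] by simp
  have a1: "?t\<^sup>2 * damp ?t \<le> 1" by (simp add: damp_def add_pos_nonneg)
  have a2: "?t\<^sup>2 - ?t^4 \<le> ?t\<^sup>2 * damp ?t"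
  proof -
    have "(?t\<^sup>2 - ?t^4) * (1 + ?t\<^sup>2) = ?t\<^sup>2 - ?t^4 * ?t\<^sup>2" by (simp add: power4_eq_xxxx power2_eq_square algebra_simps)
    also have "\<dots> \<le> ?t\<^sup>2" by simp
    finally show ?thesis by (simp add: damp_def add_pos_nonneg pos_le_divide_eq)
  qed
  have "?t\<^sup>2 * damp ?t * (1 - ?v / 3) \<le> ?t\<^sup>2 * damp ?t * exp (- (?v / 3))"
    using exp_ge_add_one_self[of "- (?v / 3)"] by (intro mult_left_mono a0) simp
  moreover have "?t\<^sup>2 * damp ?t * (?v / 3) \<le> 1 * (?v / 3)"
    using V_nonneg[of B x] by (intro mult_right_mono a1) simp
  ultimately have "?t\<^sup>2 - ?t^4 - ?v / 3 \<le> ?t\<^sup>2 * damp ?t * exp (- (?v / 3))"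
    using a2 by (simp add: algebra_simps)
  with 1 True show ?thesis by (simp add: low_def)
qed (simp add: low_def zeta_def)

lemma measurable_zeta:
  assumes f: "\<And>e. e \<in> E \<Longrightarrow> (\<lambda>\<omega>. f \<omega> e) \<in> borel_measurable M"
    and g: "\<And>k. k < d \<Longrightarrow> (\<lambda>\<omega>. g \<omega> k) \<in> borel_measurable M"
  shows "(\<lambda>\<omega>. zeta (f \<omega>) (g \<omega>)) \<in> borel_measurable M"
    and "(\<lambda>\<omega>. low (f \<omega>) (g \<omega>)) \<in> borel_measurable M"
proof -
  note TV[measurable] = measurable_TV[OF f g]
  note pq[measurable] = measurable_in_sq_out_sq[OF g]
  have w[measurable]: "(\<lambda>\<omega>. wgt (f \<omega>) e) \<in> borel_measurable M" if "e \<in> E" for e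
    unfolding wgt_def by (intro borel_measurable_divide borel_measurable_diff borel_measurable_power f that borel_measurable_const)
  have o[measurable]: "(\<lambda>\<omega>. outer (g \<omega>) e) \<in> borel_measurable M" if "e \<in> E" for e
    unfolding outer_def using that m_less by (intro borel_measurable_times g) auto
  have R[measurable]: "(\<lambda>\<omega>. R (f \<omega>) (g \<omega>)) \<in> borel_measurable M" unfolding R_def by measurable
  have G[measurable]: "Measurable.pred M (\<lambda>\<omega>. good (g \<omega>))" unfolding good_def by measurable
  show "(\<lambda>\<omega>. zeta (f \<omega>) (g \<omega>)) \<in> borel_measurable M" unfolding zeta_def damp_def damp'_def by measurable
  show "(\<lambda>\<omega>. low (f \<omega>) (g \<omega>)) \<in> borel_measurable M" unfolding low_def by measurable
qed

lemma measurable_Phi: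
  assumes f: "\<And>e. e \<in> E \<Longrightarrow> (\<lambda>\<omega>. f \<omega> e) \<in> borel_measurable M"
    and g: "\<And>k. k < d \<Longrightarrow> (\<lambda>\<omega>. g \<omega> k) \<in> borel_measurable M"
    and h: "\<And>k. k < d \<Longrightarrow> (\<lambda>\<omega>. h \<omega> k) \<in> borel_measurable M"
  shows "(\<lambda>\<omega>. Phi (f \<omega>) (g \<omega>) (h \<omega>)) \<in> borel_measurable M"
proof -
  note TV[measurable] = measurable_TV[OF f g]
  note pq[measurable] = measurable_in_sq_out_sq[OF g]
  have w[measurable]: "(\<lambda>\<omega>. wgt (f \<omega>) e) \<in> borel_measurable M" if "e \<in> E" for e
    unfolding wgt_def by (intro borel_measurable_divide borel_measurable_diff borel_measurable_power f that borel_measurable_const)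
  have o[measurable]: "(\<lambda>\<omega>. outer (g \<omega>) e) \<in> borel_measurable M" if "e \<in> E" for e
    unfolding outer_def using that m_less by (intro borel_measurable_times g) auto
  have G[measurable]: "Measurable.pred M (\<lambda>\<omega>. good (g \<omega>))" unfolding good_def by measurable
  have [measurable]: "(\<lambda>\<omega>. score (f \<omega>) (h \<omega>) e) \<in> borel_measurable M" if "e \<in> E" for e
    unfolding score_def using that m_less
    by (intro borel_measurable_times borel_measurable_diff borel_measurable_const measurable_shift h f) auto
  show ?thesis unfolding Phi_def damp_def by measurable
qed

lemma lik1_pos: "0 < lik1 B x" by (simp add: lik1_def)

text \<open>\<open>zeta B\<close> is odd under \<open>neg\<close> and \<open>D0\<close> is
  invariant, so twice the expectation is the integral of the paired expression, to which the
  pointwise bound applies.\<close>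

lemma zeta_DB_lower:
  assumes B: "B \<in> space box" and b_small: "b * d \<le> 1 / 40"
    and low: "integrable D0 (low B)"
  shows "(\<integral>x. zeta B x \<partial>DB B) \<ge> 2 / 3 * (\<integral>x. low B x \<partial>D0)"
proof -
  interpret DB: prob_space "DB B" by (rule prob_space_DB)
  have z[measurable]: "zeta B \<in> borel_measurable D0"
    using measurable_zeta(1)[of "\<lambda>_. B" D0 "\<lambda>x. x"] by auto
  have "zeta B \<in> borel_measurable (DB B)"
    using z by (simp add: DB_def)
  then have iz: "integrable (DB B) (zeta B)"
    using zeta_bound[OF B b_small] by (intro DB.integrable_const_bound[of _ 1] AE_I2) simp_all
  have i1: "integrable D0 (\<lambda>x. zeta B x * lik1 B x)"
    using iz lik1_pos[THEN less_imp_le] unfolding DB_def by (subst (asm) integrable_density) (auto simp: mult.commute)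
  have e1: "(\<integral>x. zeta B x \<partial>DB B) = (\<integral>x. zeta B x * lik1 B x \<partial>D0)"
    using lik1_pos[THEN less_imp_le] unfolding DB_def by (subst integral_density) (auto simp: mult.commute)
  have ng: "distr D0 D0 neg = D0"
  proof (rule measure_eqI)
    fix A assume A: "A \<in> sets (distr D0 D0 neg)"
    then have "emeasure (distr D0 D0 neg) A = (\<integral>\<^sup>+ x. indicator A x \<partial>distr D0 D0 neg)" by simp
    also have "\<dots> = (\<integral>\<^sup>+ x. indicator A (neg x) \<partial>D0)" using A by (subst nn_integral_distr) auto
    also have "\<dots> = (\<integral>\<^sup>+ x. indicator A x \<partial>D0)" using A by (subst nn_integral_neg) auto
    finally show "emeasure (distr D0 D0 neg) A = emeasure D0 A" using A by simp
  qed simp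
  have i2: "integrable D0 (\<lambda>x. - (zeta B x * lik1 B (neg x)))" and
    e2: "(\<integral>x. - (zeta B x * lik1 B (neg x)) \<partial>D0) = (\<integral>x. zeta B x * lik1 B x \<partial>D0)"
  proof -
    have m: "(\<lambda>x. zeta B x * lik1 B x) \<in> borel_measurable D0" by measurable
    show "integrable D0 (\<lambda>x. - (zeta B x * lik1 B (neg x)))"
      using integrable_distr[OF measurable_neg, of "\<lambda>x. zeta B x * lik1 B x"] i1 by (simp add: ng zeta_neg)
    show "(\<integral>x. - (zeta B x * lik1 B (neg x)) \<partial>D0) = (\<integral>x. zeta B x * lik1 B x \<partial>D0)"
      using integral_distr[OF measurable_neg m] by (simp add: ng zeta_neg)
  qed
  have "4 / 3 * (\<integral>x. low B x \<partial>D0) = (\<integral>x. 4 / 3 * low B x \<partial>D0)" by simp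
  also have "\<dots> \<le> (\<integral>x. zeta B x * lik1 B x + - (zeta B x * lik1 B (neg x)) \<partial>D0)"
    using zeta_low_pointwise[OF B b_small] low by (intro integral_mono Bochner_Integration.integrable_add i1 i2) auto
  also have "\<dots> = 2 * (\<integral>x. zeta B x \<partial>DB B)"
    by (subst Bochner_Integration.integral_add[OF i1 i2]) (simp only: e1 e2)
  finally show ?thesis by simp
qed

end

section \<open>Integration by parts over the prior\<close>

context hidden_regression
begin

text \<open>A class closed under the operations used below, so that integrability over the prior
  follows from the shape of an expression.\<close>

definition box_bounded :: "((nat \<times> nat \<Rightarrow> real) \<Rightarrow> real) \<Rightarrow> bool" where
  "box_bounded f \<longleftrightarrow> f \<in> borel_measurable box \<and> (\<exists>K. \<forall>B\<in>space box. \<bar>f B\<bar> \<le> K)"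

lemma box_bounded_integrable: "box_bounded f \<Longrightarrow> integrable box f"
  unfolding box_bounded_def by (auto intro: integrable_box)

lemma box_bounded_const: "box_bounded (\<lambda>_. c)"
  unfolding box_bounded_def by auto

lemma box_bounded_coord: "e \<in> E \<Longrightarrow> box_bounded (\<lambda>B. B e)"
  unfolding box_bounded_def using box_range[of _ E e] by (auto intro!: measurable_coord_box)

lemma box_bounded_add: assumes "box_bounded f" "box_bounded g" shows "box_bounded (\<lambda>B. f B + g B)"
proof -
  obtain K K' where "\<forall>B\<in>space box. \<bar>f B\<bar> \<le> K" "\<forall>B\<in>space box. \<bar>g B\<bar> \<le> K'"
    using assms by (auto simp: box_bounded_def)
  then have "\<forall>B\<in>space box. \<bar>f B + g B\<bar> \<le> K + K'" by (meson abs_triangle_ineq add_mono order_trans)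
  then show ?thesis using assms by (auto simp: box_bounded_def)
qed

lemma box_bounded_mult: assumes "box_bounded f" "box_bounded g" shows "box_bounded (\<lambda>B. f B * g B)"
proof -
  obtain K K' where K: "\<forall>B\<in>space box. \<bar>f B\<bar> \<le> K" "\<forall>B\<in>space box. \<bar>g B\<bar> \<le> K'"
    using assms by (auto simp: box_bounded_def)
  have "\<bar>f B * g B\<bar> \<le> \<bar>K\<bar> * \<bar>K'\<bar>" if "B \<in> space box" for B
    unfolding abs_mult using K that by (intro mult_mono) (auto intro: order_trans[OF _ abs_ge_self])
  then show ?thesis using assms by (auto simp: box_bounded_def)
qed

lemma box_bounded_sum: "(\<And>i. i \<in> S \<Longrightarrow> box_bounded (f i)) \<Longrightarrow> box_bounded (\<lambda>B. \<Sum>i\<in>S. f i B)"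
  by (induction S rule: infinite_finite_induct) (auto intro!: box_bounded_const box_bounded_add)

lemma box_bounded_exp: assumes "box_bounded f" shows "box_bounded (\<lambda>B. exp (f B))"
proof -
  obtain K where "\<forall>B\<in>space box. \<bar>f B\<bar> \<le> K" using assms by (auto simp: box_bounded_def)
  then have "\<forall>B\<in>space box. \<bar>exp (f B)\<bar> \<le> exp K" by (auto simp: abs_le_iff)
  then show ?thesis using assms by (auto simp: box_bounded_def)
qed

lemma box_bounded_bounded_comp:
  assumes "box_bounded f" "h \<in> borel_measurable borel" "\<And>t. \<bar>h t\<bar> \<le> 1"
  shows "box_bounded (\<lambda>B. h (f B))"
  using assms by (auto simp: box_bounded_def intro: measurable_compose[of f _ borel h])

lemma box_bounded_shift: "j \<in> {m..<d} \<Longrightarrow> box_bounded (\<lambda>B. shift B x j)"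
  unfolding shift_def by (intro box_bounded_sum box_bounded_mult box_bounded_coord box_bounded_const) auto

lemma box_bounded_T: "box_bounded (\<lambda>B. T B x)"
  unfolding T_eq by (intro box_bounded_sum box_bounded_mult box_bounded_coord box_bounded_const)

lemma box_bounded_V: "box_bounded (\<lambda>B. V B x)"
  unfolding V_def power2_eq_square by (intro box_bounded_sum box_bounded_mult box_bounded_shift)

lemma box_bounded_damp: "box_bounded (\<lambda>B. damp (T B x))" "box_bounded (\<lambda>B. damp' (T B x))"
proof -
  have "damp \<in> borel_measurable borel" "damp' \<in> borel_measurable borel"
    unfolding damp_def[abs_def] damp'_def[abs_def] by measurable
  moreover have "\<bar>damp t\<bar> \<le> 1" for t using damp_bounds[of t] by simp
  ultimately show "box_bounded (\<lambda>B. damp (T B x))" "box_bounded (\<lambda>B. damp' (T B x))"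
    using damp'_bound box_bounded_bounded_comp[OF box_bounded_T, of damp] box_bounded_bounded_comp[OF box_bounded_T, of damp'] by blast+
qed

lemma box_bounded_wt: "e \<in> E \<Longrightarrow> box_bounded (\<lambda>B. wgt B e)"
proof -
  assume e: "e \<in> E"
  have "wgt B e = b\<^sup>2 / 2 + (- 1 / 2) * (B e * B e)" for B
    by (simp add: wgt_def power2_eq_square diff_divide_distrib)
  then show ?thesis using e by (simp only:) (intro box_bounded_add box_bounded_mult box_bounded_const box_bounded_coord)
qed

lemma box_bounded_score: "e \<in> E \<Longrightarrow> box_bounded (\<lambda>B. score B x e)"
proof -
  assume e: "e \<in> E"
  have "score B x e = (2 / 3 * x (fst e) + (- 2 / 3) * shift B x (fst e)) * x (snd e)" for B
    by (simp add: score_def algebra_simps)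
  then show ?thesis using e by (simp only:) (intro box_bounded_add box_bounded_mult box_bounded_const box_bounded_shift, auto)
qed

definition lik :: "nat \<Rightarrow> (nat \<times> nat \<Rightarrow> real) \<Rightarrow> (nat \<Rightarrow> nat \<Rightarrow> real) \<Rightarrow> real" where
  "lik n B X = (\<Prod>i<n. lik1 B (X i))"

lemma lik_exp: "lik n B X = exp (\<Sum>i<n. 2/3 * T B (X i) + (- 1 / 3) * V B (X i))"
  by (simp add: lik_def lik1_def exp_sum)

lemma box_bounded_lik: "box_bounded (\<lambda>B. lik n B X)"
  unfolding lik_exp by (intro box_bounded_exp box_bounded_sum box_bounded_add box_bounded_mult box_bounded_const box_bounded_T box_bounded_V)

lemma coord_deriv:
  "((\<lambda>x. (B(e := x)) e') has_real_derivative (if e' = e then 1 else 0)) (at x)"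
  by (cases "e' = e") auto

lemma T_deriv:
  assumes "e \<in> E"
  shows "((\<lambda>x. T (B(e := x)) y) has_real_derivative outer y e) (at x)"
proof -
  have "((\<lambda>x. \<Sum>e'\<in>E. (B(e := x)) e' * outer y e') has_real_derivative
     (\<Sum>e'\<in>E. (if e' = e then 1 else 0) * outer y e')) (at x)"
    by (intro DERIV_sum DERIV_cmult_right coord_deriv)
  also have "(\<Sum>e'\<in>E. (if e' = e then 1 else 0) * outer y e') = outer y e"
    using assms by (simp add: if_distrib[of "\<lambda>c. c * _"] sum.delta del: mem_Sigma_iff cong: if_cong)
  finally show ?thesis unfolding T_eq .
qed

lemma shift_deriv:
  assumes "e \<in> E"
  shows "((\<lambda>x. shift (B(e := x)) y j) has_real_derivative (if j = fst e then y (snd e) else 0)) (at x)"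
proof -
  obtain i k where e: "e = (i, k)" by (cases e)
  have "((\<lambda>x. \<Sum>l<m. (B(e := x)) (j, l) * y l) has_real_derivative
     (\<Sum>l<m. (if (j, l) = e then 1 else 0) * y l)) (at x)"
    by (intro DERIV_sum DERIV_cmult_right coord_deriv)
  also have "(\<Sum>l<m. (if (j, l) = e then 1 else 0) * y l) = (if j = i then \<Sum>l<m. if l = k then y l else 0 else 0)"
  proof -
    have "(if P then 1 else 0) * a = (if P then a else 0)" for P and a :: real by simp
    then show ?thesis by (cases "j = i") (simp_all add: e cong: if_cong)
  qed
  also have "\<dots> = (if j = fst e then y (snd e) else 0)"
    using assms by (auto simp: e)
  finally show ?thesis unfolding shift_def .
qed

lemma V_deriv:
  assumes "e \<in> E"
  shows "((\<lambda>x. V (B(e := x)) y) has_real_derivative 2 * shift (B(e := x)) y (fst e) * y (snd e)) (at x)"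
proof -
  have "((\<lambda>x. \<Sum>j=m..<d. (shift (B(e := x)) y j)\<^sup>2) has_real_derivative
     (\<Sum>j=m..<d. 2 * (if j = fst e then y (snd e) else 0) * shift (B(e := x)) y j)) (at x)"
    by (intro DERIV_sum) (auto intro!: derivative_eq_intros shift_deriv[OF assms] split: if_splits)
  also have "(\<Sum>j=m..<d. 2 * (if j = fst e then y (snd e) else 0) * shift (B(e := x)) y j)
    = (\<Sum>j=m..<d. if j = fst e then 2 * shift (B(e := x)) y (fst e) * y (snd e) else 0)"
    by (intro sum.cong) auto
  also have "\<dots> = 2 * shift (B(e := x)) y (fst e) * y (snd e)"
    using assms by auto
  finally show ?thesis unfolding V_def .
qed

text \<open>The logarithmic derivative is additive over the samples; this is why integration by
  parts produces one correlation per sample.\<close>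

lemma lik_deriv:
  assumes "e \<in> E"
  shows "((\<lambda>x. lik n (B(e := x)) X) has_real_derivative
     lik n (B(e := x)) X * (\<Sum>i<n. score (B(e := x)) (X i) e)) (at x)"
proof -
  have "((\<lambda>x. \<Sum>i<n. 2/3 * T (B(e := x)) (X i) + (- 1 / 3) * V (B(e := x)) (X i)) has_real_derivative
    (\<Sum>i<n. 2/3 * outer (X i) e + (- 1 / 3) * (2 * shift (B(e := x)) (X i) (fst e) * X i (snd e)))) (at x)"
    by (intro DERIV_sum DERIV_add DERIV_cmult T_deriv V_deriv assms)
  also have "(\<Sum>i<n. 2/3 * outer (X i) e + (- 1 / 3) * (2 * shift (B(e := x)) (X i) (fst e) * X i (snd e)))
     = (\<Sum>i<n. score (B(e := x)) (X i) e)"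
    by (intro sum.cong) (auto simp: outer_def score_def algebra_simps)
  finally show ?thesis unfolding lik_exp by (rule DERIV_fun_exp)
qed

lemma damp_deriv: "(damp has_real_derivative damp' t) (at t)"
proof -
  have "1 + t\<^sup>2 \<noteq> 0" by (metis add_pos_nonneg less_numeral_extra(1,3) zero_le_power2)
  then show ?thesis
    unfolding damp_def[abs_def] damp'_def
    by (auto intro!: derivative_eq_intros simp: power2_eq_square)
qed

lemma isCont_upd:
  assumes "e \<in> E"
  shows "isCont (\<lambda>x. damp' (T (B(e := x)) z)) x" "isCont (\<lambda>x. damp (T (B(e := x)) z)) x"
    "isCont (\<lambda>x. lik n (B(e := x)) X) x" "isCont (\<lambda>x. score (B(e := x)) y e) x"
proof -
  have nz: "1 + t\<^sup>2 \<noteq> 0" for t :: real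
    by (metis add_pos_nonneg less_numeral_extra(1,3) zero_le_power2)
  note [continuous_intros] = DERIV_isCont[OF T_deriv[OF assms]] DERIV_isCont[OF shift_deriv[OF assms]]
  show "isCont (\<lambda>x. damp' (T (B(e := x)) z)) x" "isCont (\<lambda>x. damp (T (B(e := x)) z)) x"
    unfolding damp'_def damp_def by (intro continuous_intros; simp add: nz)+
  show "isCont (\<lambda>x. lik n (B(e := x)) X) x" by (rule DERIV_isCont[OF lik_deriv[OF assms]])
  show "isCont (\<lambda>x. score (B(e := x)) y e) x" unfolding score_def by (intro continuous_intros)
qed

text \<open>The weight \<open>wgt B e\<close> vanishes on the faces of the box, so no boundary terms appear.\<close>

lemma fingerprint_identity:
  "(\<integral>B. zeta B z * lik n B X \<partial>box) = (\<integral>B. (\<Sum>i<n. Phi B z (X i)) * lik n B X \<partial>box)"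
proof (cases "good z")
  case good: True
  \<comment> \<open>The factor of \<open>B e\<close> once \<open>T B z\<close> is expanded as a
    linear form; this is what gets differentiated in entry \<open>e\<close>.\<close>
  define f where "f e B = outer z e * (damp (T B z) * lik n B X)" for e B
  define f' where "f' e B = outer z e * (damp (T B z) * (lik n B X * (\<Sum>i<n. score B (X i) e)) +
     (damp' (T B z) * outer z e) * lik n B X)" for e B
  have bf: "box_bounded (\<lambda>B. B e * f e B)" and bf': "box_bounded (\<lambda>B. wgt B e * f' e B)" if "e \<in> E" for e
    unfolding f_def f'_def
    by (intro box_bounded_mult box_bounded_add box_bounded_sum box_bounded_const box_bounded_coord box_bounded_damp box_bounded_lik box_bounded_wt box_bounded_score that)+
  have parts: "(\<integral>B. B e * f e B \<partial>box) = (\<integral>B. wgt B e * f' e B \<partial>box)" if e: "e \<in> E" for e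
    unfolding wgt_def
  proof (rule box_by_parts)
    show "integrable box (\<lambda>B. B e * f e B)" by (intro box_bounded_integrable bf e)
    show "integrable box (\<lambda>B. (b\<^sup>2 - (B e)\<^sup>2) / 2 * f' e B)"
      using box_bounded_integrable[OF bf'[OF e]] by (simp add: wgt_def)
    show "((\<lambda>x. f e (B(e := x))) has_real_derivative f' e (B(e := x))) (at x)" for B x
    proof -
      have "((\<lambda>x. f e (B(e := x))) has_real_derivative
          outer z e * ((damp' (T (B(e := x)) z) * outer z e) * lik n (B(e := x)) X +
          (lik n (B(e := x)) X * (\<Sum>i<n. score (B(e := x)) (X i) e)) * damp (T (B(e := x)) z))) (at x)"
        unfolding f_def
        by (intro DERIV_cmult DERIV_mult lik_deriv[OF e] DERIV_chain2[OF damp_deriv T_deriv[OF e]])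
      then show ?thesis by (simp only: f'_def add.commute mult.commute)
    qed
    show "isCont (\<lambda>x. f' e (B(e := x))) x" for B x
      unfolding f'_def
      by (intro continuous_intros isCont_upd[OF e])
  qed (use e in auto)
  have bz: "box_bounded (\<lambda>B. (\<Sum>i<n. Phi B z (X i)) * lik n B X)"
    using good unfolding Phi_def
    by (simp, intro box_bounded_mult box_bounded_sum box_bounded_damp box_bounded_wt box_bounded_const box_bounded_score box_bounded_lik)
  have br: "box_bounded (\<lambda>B. R B z * damp' (T B z) * lik n B X)"
    unfolding R_def by (intro box_bounded_mult box_bounded_sum box_bounded_wt box_bounded_const box_bounded_damp box_bounded_lik)
  \<comment> \<open>Differentiating the likelihood gives the \<open>Phi\<close> terms;
    differentiating the damping gives the \<open>R\<close> term, which is moved to the other side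
    and completes \<open>zeta\<close>.\<close>
  have split: "(\<Sum>e\<in>E. wgt B e * f' e B) = (\<Sum>i<n. Phi B z (X i)) * lik n B X + R B z * damp' (T B z) * lik n B X" for B
  proof -
    have "(\<Sum>i<n. Phi B z (X i)) = (\<Sum>i<n. \<Sum>e\<in>E. damp (T B z) * (wgt B e * outer z e * score B (X i) e))"
      using good by (simp add: Phi_def sum_distrib_left)
    also have "\<dots> = (\<Sum>e\<in>E. \<Sum>i<n. damp (T B z) * (wgt B e * outer z e * score B (X i) e))" by (rule sum.swap)
    finally have 1: "(\<Sum>i<n. Phi B z (X i)) * lik n B X =
       (\<Sum>e\<in>E. wgt B e * outer z e * damp (T B z) * (\<Sum>i<n. score B (X i) e) * lik n B X)"
      by (simp add: sum_distrib_right sum_distrib_left mult_ac)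
    have 2: "R B z * damp' (T B z) * lik n B X = (\<Sum>e\<in>E. wgt B e * (outer z e)\<^sup>2 * damp' (T B z) * lik n B X)"
      by (simp add: R_def sum_distrib_right)
    show ?thesis unfolding 1 2 sum.distrib[symmetric]
      by (intro sum.cong refl) (simp add: f'_def power2_eq_square algebra_simps)
  qed
  have "(\<integral>B. T B z * damp (T B z) * lik n B X \<partial>box) = (\<integral>B. (\<Sum>e\<in>E. B e * f e B) \<partial>box)"
  proof (intro Bochner_Integration.integral_cong refl)
    fix B
    have "T B z * c = (\<Sum>e\<in>E. B e * (outer z e * c))" for c
      by (simp add: T_eq sum_distrib_right mult.assoc)
    from this[of "damp (T B z) * lik n B X"] show "T B z * damp (T B z) * lik n B X = (\<Sum>e\<in>E. B e * f e B)"
      by (simp only: f_def mult.assoc)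
  qed
  also have "\<dots> = (\<Sum>e\<in>E. \<integral>B. B e * f e B \<partial>box)"
    by (intro Bochner_Integration.integral_sum box_bounded_integrable bf)
  also have "\<dots> = (\<Sum>e\<in>E. \<integral>B. wgt B e * f' e B \<partial>box)"
    by (intro sum.cong refl parts)
  also have "\<dots> = (\<integral>B. (\<Sum>e\<in>E. wgt B e * f' e B) \<partial>box)"
    by (intro Bochner_Integration.integral_sum[symmetric] box_bounded_integrable bf')
  also have "\<dots> = (\<integral>B. (\<Sum>i<n. Phi B z (X i)) * lik n B X \<partial>box) + (\<integral>B. R B z * damp' (T B z) * lik n B X \<partial>box)"
    unfolding split by (intro Bochner_Integration.integral_add box_bounded_integrable bz br)
  finally have "(\<integral>B. T B z * damp (T B z) * lik n B X \<partial>box) - (\<integral>B. R B z * damp' (T B z) * lik n B X \<partial>box)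
    = (\<integral>B. (\<Sum>i<n. Phi B z (X i)) * lik n B X \<partial>box)" by simp
  moreover have "box_bounded (\<lambda>B. T B z * damp (T B z) * lik n B X)"
    by (intro box_bounded_mult box_bounded_T box_bounded_damp box_bounded_lik)
  then have "(\<integral>B. T B z * damp (T B z) * lik n B X \<partial>box) - (\<integral>B. R B z * damp' (T B z) * lik n B X \<partial>box)
    = (\<integral>B. T B z * damp (T B z) * lik n B X - R B z * damp' (T B z) * lik n B X \<partial>box)"
    by (intro Bochner_Integration.integral_diff[symmetric] box_bounded_integrable br)
  ultimately show ?thesis using good by (simp add: zeta_def left_diff_distrib)
qed (simp add: zeta_def Phi_def)

text \<open>Brings a single shift into the form required by
  \<open>linear_form_moments\<close>.\<close>

lemma shift_linear_form:
  assumes "j \<in> {m..<d}"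
  shows "shift B x j = (\<Sum>e\<in>E. (if fst e = j then x (snd e) else 0) * B e)"
proof -
  have "(\<Sum>e\<in>E. (if fst e = j then x (snd e) else 0) * B e)
    = (\<Sum>i=m..<d. \<Sum>k<m. (if i = j then x k else 0) * B (i, k))"
    by (simp add: sum.cartesian_product' cong: if_cong)
  also have "\<dots> = (\<Sum>i=m..<d. if i = j then \<Sum>k<m. x k * B (i, k) else 0)"
    by (intro sum.cong) auto
  finally show ?thesis using assms by (simp add: shift_def mult.commute)
qed

text \<open>The second moment of \<open>T\<close> is b^2/3 times the product of the squared lengths.
  The fourth is at most a quarter of that, since b^2 times this product is at most 400 (b d)^2 <=
  1/4; hence the factor 3/4. Each of the d - m responses adds b^2/3 * in_sq to the mean of
  \<open>V\<close>.\<close>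

lemma low_box_average:
  assumes b_small: "b * d \<le> 1 / 40"
  shows "b\<^sup>2 / 3 * (if good z then in_sq z * (3 / 4 * out_sq z - real (d - m) / 3) else 0) \<le> (\<integral>B. low B z \<partial>box)"
proof (cases "good z")
  case True
  let ?pq = "out_sq z * in_sq z"
  have T2: "(\<integral>B. (T B z)\<^sup>2 \<partial>box) = b\<^sup>2 / 3 * ?pq"
    and T4: "(\<integral>B. (T B z)^4 \<partial>box) \<le> b ^ 4 / 3 * ?pq\<^sup>2"
    using linear_form_moments[of E "outer z"] by (simp_all add: T_eq mult.commute[of "outer z _"] sum_outer_sq)
  have "(\<integral>B. V B z \<partial>box) = (\<Sum>j=m..<d. \<integral>B. (shift B z j)\<^sup>2 \<partial>box)"
    unfolding V_def power2_eq_square by (intro Bochner_Integration.integral_sum box_bounded_integrable box_bounded_mult box_bounded_shift)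
  also have "\<dots> = (\<Sum>j=m..<d. b\<^sup>2 / 3 * in_sq z)"
  proof (rule sum.cong[OF refl])
    fix j assume j: "j \<in> {m..<d}"
    have "(\<Sum>e\<in>E. (if fst e = j then z (snd e) else 0)\<^sup>2) = (\<Sum>i=m..<d. \<Sum>k<m. (if i = j then (z k)\<^sup>2 else 0))"
      by (simp add: sum.cartesian_product' if_distrib[of "\<lambda>c. c\<^sup>2"] cong: if_cong)
    also have "\<dots> = (\<Sum>i=m..<d. if i = j then in_sq z else 0)" by (intro sum.cong) (auto simp: in_sq_def)
    finally have s: "(\<Sum>e\<in>E. (if fst e = j then z (snd e) else 0)\<^sup>2) = in_sq z" using j by simp
    show "(\<integral>B. (shift B z j)\<^sup>2 \<partial>box) = b\<^sup>2 / 3 * in_sq z"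
      using linear_form_moments(1)[of E "\<lambda>e. if fst e = j then z (snd e) else 0"]
      unfolding shift_linear_form[OF j] s by simp
  qed
  finally have V: "(\<integral>B. V B z \<partial>box) = real (d - m) * (b\<^sup>2 / 3 * in_sq z)" by simp
  have pq0: "0 \<le> ?pq" using in_sq_nonneg out_sq_nonneg by simp
  have "b\<^sup>2 * ?pq \<le> b\<^sup>2 * ((20 * real d) * (20 * real d))"
    by (intro mult_left_mono mult_mono) (use True out_sq_nonneg[of z] in_sq_nonneg[of z] in \<open>simp_all add: good_def\<close>)
  also have "\<dots> = 400 * (b * d)\<^sup>2" by (simp add: power2_eq_square)
  also have "\<dots> \<le> 400 * (1 / 40)\<^sup>2"
    using b_small b_pos by (intro mult_left_mono power_mono) auto
  finally have small: "b\<^sup>2 * ?pq \<le> 1 / 4" by (simp add: power2_eq_square)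
  have "b ^ 4 / 3 * ?pq\<^sup>2 = (b\<^sup>2 / 3 * ?pq) * (b\<^sup>2 * ?pq)" by (simp add: power4_eq_xxxx power2_eq_square)
  also have "\<dots> \<le> (b\<^sup>2 / 3 * ?pq) * (1 / 4)" by (intro mult_left_mono small) (use pq0 in simp)
  finally have q4: "(\<integral>B. (T B z)^4 \<partial>box) \<le> b\<^sup>2 / 3 * ?pq / 4" using T4 by simp
  have i: "integrable box (\<lambda>B. (T B z)\<^sup>2)" "integrable box (\<lambda>B. (T B z)^4)" "integrable box (\<lambda>B. V B z)"
    unfolding power2_eq_square power4_eq_xxxx by (intro box_bounded_integrable box_bounded_mult box_bounded_T box_bounded_V)+
  have "(\<integral>B. low B z \<partial>box) = (\<integral>B. (T B z)\<^sup>2 \<partial>box) - (\<integral>B. (T B z)^4 \<partial>box) - (\<integral>B. V B z \<partial>box) / 3"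
    using True i by (simp add: low_def)
  also have "\<dots> \<ge> b\<^sup>2 / 3 * ?pq - b\<^sup>2 / 3 * ?pq / 4 - real (d - m) * (b\<^sup>2 / 3 * in_sq z) / 3"
    using q4 unfolding T2 V by linarith
  finally show ?thesis using True by (simp add: algebra_simps)
qed (simp add: low_def)

text \<open>Only integrability and Fubini rely on this, so the bound may be crude as long as it is
  uniform in \<open>B\<close> and \<open>z\<close>.\<close>

lemma low_bounded:
  "\<exists>K. \<forall>B\<in>space box. \<forall>z. \<bar>low B z\<bar> \<le> K"
proof -
  \<comment> \<open>From |z_k| <= z_k^2 + 1 and the cutoff, which avoids square roots;
    \<open>s\<close> and \<open>t\<close> then bound the shifts and \<open>T\<close>.\<close>
  define c where "c = 40 * real d + 1"
  define s where "s = real m * (b * c)"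
  define t where "t = real d * (c * s)"
  have c0: "0 \<le> c" by (simp add: c_def)
  have s0: "0 \<le> s" using c0 b_pos by (simp add: s_def)
  have t0: "0 \<le> t" using c0 s0 by (simp add: t_def)
  have "\<bar>low B z\<bar> \<le> t\<^sup>2 + t^4 + real d * s\<^sup>2" if B: "B \<in> space box" for B z
  proof (cases "good z")
    case True
    have zc: "\<bar>z k\<bar> \<le> c" if k: "k < d" for k
    proof -
      have "(z k)\<^sup>2 \<le> in_sq z + out_sq z"
      proof (cases "k < m")
        case True
        then have "(z k)\<^sup>2 \<le> in_sq z" unfolding in_sq_def by (intro member_le_sum) auto
        then show ?thesis using out_sq_nonneg[of z] by simp
      next
        case False
        then have "(z k)\<^sup>2 \<le> out_sq z" unfolding out_sq_def using k by (intro member_le_sum) auto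
        then show ?thesis using in_sq_nonneg[of z] by simp
      qed
      moreover have "\<bar>z k\<bar> \<le> (z k)\<^sup>2 + 1"
      proof -
        have "0 \<le> (\<bar>z k\<bar> - 1)\<^sup>2" by simp
        then have "2 * \<bar>z k\<bar> \<le> (z k)\<^sup>2 + 1" by (simp add: power2_diff)
        then show ?thesis by linarith
      qed
      ultimately show ?thesis using True by (simp add: good_def c_def)
    qed
    have sh: "\<bar>shift B z j\<bar> \<le> s" if j: "j \<in> {m..<d}" for j
    proof -
      have "\<bar>shift B z j\<bar> \<le> (\<Sum>k<m. \<bar>B (j, k) * z k\<bar>)" unfolding shift_def by (rule sum_abs)
      also have "\<dots> \<le> (\<Sum>k<m. b * c)"
        unfolding abs_mult using j m_less b_pos by (intro sum_mono mult_mono box_range[OF B] zc) auto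
      finally show ?thesis by (simp add: s_def)
    qed
    have "\<bar>T B z\<bar> \<le> (\<Sum>j=m..<d. \<bar>z j * shift B z j\<bar>)" unfolding T_def by (rule sum_abs)
    also have "\<dots> \<le> (\<Sum>j=m..<d. c * s)"
      unfolding abs_mult using c0 by (intro sum_mono mult_mono zc sh) auto
    also have "\<dots> \<le> t" using c0 s0 unfolding t_def by (auto intro!: mult_right_mono)
    finally have T: "\<bar>T B z\<bar> \<le> t" .
    have T2: "(T B z)\<^sup>2 \<le> t\<^sup>2" and T4: "(T B z)^4 \<le> t^4"
      using power_mono[OF T, of 2] power_mono[OF T, of 4] by simp_all
    have "V B z \<le> (\<Sum>j=m..<d. s\<^sup>2)"
      unfolding V_def using power_mono[OF sh, of _ 2] by (intro sum_mono) simp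
    also have "\<dots> \<le> real d * s\<^sup>2" by (auto intro!: mult_right_mono)
    finally have V: "V B z \<le> real d * s\<^sup>2" .
    have "0 \<le> (T B z)\<^sup>2" "0 \<le> (T B z)^4" by simp_all
    with T2 T4 V V_nonneg[of B z] have "\<bar>(T B z)\<^sup>2 - (T B z)^4 - V B z / 3\<bar> \<le> t\<^sup>2 + t^4 + real d * s\<^sup>2"
      by (intro abs_leI) linarith+
    then show ?thesis using True by (simp add: low_def)
  qed (use t0 in \<open>simp add: low_def\<close>)
  then show ?thesis by blast
qed

text \<open>Fubini lets the prior be averaged out first, for fixed \<open>z\<close>; 1/6 is the
  product of 1/3 from the uniform variance and 1/2 from \<open>integral_good\<close>.\<close>

lemma low_average:
  assumes b_small: "b * d \<le> 1 / 40"
  shows "\<And>B. B \<in> space box \<Longrightarrow> integrable D0 (low B)"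
    and "integrable box (\<lambda>B. \<integral>x. low B x \<partial>D0)"
    and "(\<integral>B. \<integral>x. low B x \<partial>D0 \<partial>box) \<ge> b\<^sup>2 * real m * real (d - m) / 6"
proof -
  interpret P: pair_prob_space box D0 ..
  obtain K where K: "\<bar>low B z\<bar> \<le> K" if "B \<in> space box" for B z using low_bounded by blast
  have meas: "(\<lambda>(B, x). low B x) \<in> borel_measurable (box \<Otimes>\<^sub>M D0)"
    unfolding case_prod_beta
    by (intro measurable_zeta measurable_compose[OF measurable_fst measurable_coord_box]
        measurable_compose[OF measurable_snd measurable_coord_D0])
  show "integrable D0 (low B)" if "B \<in> space box" for B
    using measurable_zeta(2)[of "\<lambda>_. B" D0 "\<lambda>x. x"] K[OF that]
    by (intro D0.integrable_const_bound[of _ K] AE_I2) auto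
  have int: "integrable (box \<Otimes>\<^sub>M D0) (\<lambda>(B, x). low B x)"
    using K meas by (intro P.integrable_const_bound[of _ K] AE_I2) (auto simp: space_pair_measure)
  show "integrable box (\<lambda>B. \<integral>x. low B x \<partial>D0)"
    using P.integrable_fst[OF int] by simp
  let ?F = "\<lambda>z. if good z then in_sq z * (3 / 4 * out_sq z - real (d - m) / 3) else 0"
  have "b\<^sup>2 * real m * real (d - m) / 6 = b\<^sup>2 / 3 * (real m * real (d - m) / 2)" by simp
  also have "\<dots> \<le> b\<^sup>2 / 3 * (\<integral>z. ?F z \<partial>D0)"
    using integral_good(2) by (intro mult_left_mono) auto
  also have "\<dots> = (\<integral>z. b\<^sup>2 / 3 * ?F z \<partial>D0)" by simp
  also have "\<dots> \<le> (\<integral>z. \<integral>B. low B z \<partial>box \<partial>D0)"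
    using P.integrable_snd[OF int] low_box_average[OF b_small] integral_good(1)
    by (intro integral_mono integrable_mult_right) auto
  also have "\<dots> = (\<integral>B. \<integral>x. low B x \<partial>D0 \<partial>box)" by (rule P.Fubini_integral[OF int])
  finally show "(\<integral>B. \<integral>x. low B x \<partial>D0 \<partial>box) \<ge> b\<^sup>2 * real m * real (d - m) / 6" .
qed

end

section \<open>The joint law of the sample and the output\<close>

locale private_sampler = hidden_regression +
  fixes n :: nat and A :: "(nat \<Rightarrow> nat \<Rightarrow> real) \<Rightarrow> (nat \<Rightarrow> real) measure" and \<epsilon> \<delta> :: real
  assumes A: "randomized_alg n (euclid d) A"
    and dp: "diff_private n (euclid d) \<epsilon> \<delta> A"
    and eps: "0 < \<epsilon>" "\<epsilon> \<le> 1" and delta: "0 \<le> \<delta>"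
    and b_small: "b * d \<le> 1 / 40"
begin

abbreviation base_sample :: "(nat \<Rightarrow> nat \<Rightarrow> real) measure" where "base_sample \<equiv> datasets n D0"

lemma sets_base_sample: "sets base_sample = sets (datasets n (euclid d))"
  by (intro sets_PiM_cong sets_D0 refl)

lemma space_base_sample: "space base_sample = space (datasets n (euclid d))"
  by (intro sets_eq_imp_space_eq sets_base_sample)

lemma A_kernel [measurable]: "A \<in> base_sample \<rightarrow>\<^sub>M subprob_algebra D0"
proof -
  have "A \<in> datasets n (euclid d) \<rightarrow>\<^sub>M subprob_algebra (euclid d)"
    using A unfolding randomized_alg_def by (rule measurable_prob_algebraD)
  then show ?thesis
    unfolding measurable_cong_sets[OF sets_base_sample refl] subprob_algebra_cong[OF sets_D0] .
qed

lemma A_prob: "X \<in> space base_sample \<Longrightarrow> prob_space (A X)" and A_sets: "X \<in> space base_sample \<Longrightarrow> sets (A X) = sets D0"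
  using A unfolding randomized_alg_def space_base_sample
  by (auto dest: measurable_space simp: space_prob_algebra sets_D0)

sublocale base_sample: prob_space base_sample by (intro prob_space_PiM D0.prob_space_axioms)

text \<open>Dataset and output when the data come from the model with coefficients 0. The law under
  \<open>B\<close> is this fixed measure reweighted by \<open>lik n B\<close>, so the average over
  \<open>B\<close> can be taken for each dataset and output separately.\<close>

definition joint :: "((nat \<Rightarrow> nat \<Rightarrow> real) \<times> (nat \<Rightarrow> real)) measure" where
  "joint = Giry_Monad.bind base_sample (\<lambda>X. distr (A X) (base_sample \<Otimes>\<^sub>M D0) (\<lambda>z. (X, z)))"

lemma joint_kernel: "(\<lambda>X. distr (A X) (base_sample \<Otimes>\<^sub>M D0) (\<lambda>z. (X, z))) \<in> base_sample \<rightarrow>\<^sub>M subprob_algebra (base_sample \<Otimes>\<^sub>M D0)"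
  by (rule measurable_distr2[OF _ A_kernel]) simp

lemma sets_joint [measurable_cong]: "sets joint = sets (base_sample \<Otimes>\<^sub>M D0)"
  unfolding joint_def by (rule sets_bind) (use base_sample.not_empty in auto)

lemma nn_integral_joint:
  assumes [measurable]: "(\<lambda>(X, z). f X z) \<in> borel_measurable (base_sample \<Otimes>\<^sub>M D0)"
  shows "(\<integral>\<^sup>+ \<omega>. f (fst \<omega>) (snd \<omega>) \<partial>joint) = (\<integral>\<^sup>+ X. \<integral>\<^sup>+ z. f X z \<partial>A X \<partial>base_sample)"
proof -
  have f: "(\<lambda>\<omega>. f (fst \<omega>) (snd \<omega>)) \<in> borel_measurable (base_sample \<Otimes>\<^sub>M D0)"
    using assms by (simp add: case_prod_beta')
  have "(\<integral>\<^sup>+ \<omega>. f (fst \<omega>) (snd \<omega>) \<partial>joint) =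
     (\<integral>\<^sup>+ X. \<integral>\<^sup>+ \<omega>. f (fst \<omega>) (snd \<omega>) \<partial>distr (A X) (base_sample \<Otimes>\<^sub>M D0) (\<lambda>z. (X, z)) \<partial>base_sample)"
    unfolding joint_def by (rule nn_integral_bind[OF f joint_kernel])
  also have "\<dots> = (\<integral>\<^sup>+ X. \<integral>\<^sup>+ z. f X z \<partial>A X \<partial>base_sample)"
  proof (rule nn_integral_cong)
    fix X assume X: "X \<in> space base_sample"
    have "(\<lambda>z. (X, z)) \<in> A X \<rightarrow>\<^sub>M base_sample \<Otimes>\<^sub>M D0"
      unfolding measurable_cong_sets[OF A_sets[OF X] refl] using X by simp
    moreover have "(\<lambda>\<omega>. f (fst \<omega>) (snd \<omega>)) \<in> borel_measurable (distr (A X) (base_sample \<Otimes>\<^sub>M D0) (\<lambda>z. (X, z)))"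
      unfolding measurable_distr_eq1 by (rule f)
    ultimately have "(\<integral>\<^sup>+ \<omega>. f (fst \<omega>) (snd \<omega>) \<partial>distr (A X) (base_sample \<Otimes>\<^sub>M D0) (\<lambda>z. (X, z)))
      = (\<integral>\<^sup>+ z. f (fst (X, z)) (snd (X, z)) \<partial>A X)"
      by (rule nn_integral_distr)
    then show "(\<integral>\<^sup>+ \<omega>. f (fst \<omega>) (snd \<omega>) \<partial>distr (A X) (base_sample \<Otimes>\<^sub>M D0) (\<lambda>z. (X, z))) = (\<integral>\<^sup>+ z. f X z \<partial>A X)"
      by (simp only: fst_conv snd_conv)
  qed
  finally show ?thesis .
qed

sublocale joint: prob_space joint
proof
  have "emeasure joint (space joint) = (\<integral>\<^sup>+ \<omega>. 1 \<partial>joint)" by simp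
  also have "\<dots> = (\<integral>\<^sup>+ X. \<integral>\<^sup>+ z. 1 \<partial>A X \<partial>base_sample)" by (rule nn_integral_joint) simp
  also have "\<dots> = (\<integral>\<^sup>+ X. 1 \<partial>base_sample)"
    by (intro nn_integral_cong) (simp add: prob_space.emeasure_space_1[OF A_prob])
  finally show "emeasure joint (space joint) = 1" by (simp add: base_sample.emeasure_space_1)
qed

lemma datasets_DB: "datasets n (DB B) = density base_sample (\<lambda>X. ennreal (lik n B X))"
proof -
  have "datasets n (DB B) = density base_sample (\<lambda>X. \<Prod>i<n. ennreal (lik1 B (X i)))"
    unfolding DB_def
    by (rule PiM_density)
      (auto simp: DB_def[symmetric] intro: prob_space_imp_sigma_finite prob_space_DB D0.sigma_finite_measure_axioms)
  then show ?thesis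
    by (simp add: prod_ennreal lik1_pos less_imp_le lik_def)
qed

lemma sets_datasets_DB: "sets (datasets n (DB B)) = sets base_sample"
  by (simp add: datasets_DB)

lemma space_datasets_DB: "space (datasets n (DB B)) = space base_sample"
  by (simp add: datasets_DB)

lemma prob_space_datasets_DB: "prob_space (datasets n (DB B))"
  by (intro prob_space_PiM prob_space_DB)

lemma coord_base_sample: "i < n \<Longrightarrow> (\<lambda>X. X i) \<in> base_sample \<rightarrow>\<^sub>M D0"
  by (rule measurable_component_singleton) auto

lemma entry_base_sample: "i < n \<Longrightarrow> k < d \<Longrightarrow> (\<lambda>X. X i k) \<in> borel_measurable base_sample"
  by (rule measurable_compose[OF coord_base_sample measurable_coord_D0])

lemma measurable_lik:
  assumes f: "\<And>e. e \<in> E \<Longrightarrow> (\<lambda>\<omega>. f \<omega> e) \<in> borel_measurable M"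
    and g: "\<And>i k. i < n \<Longrightarrow> k < d \<Longrightarrow> (\<lambda>\<omega>. g \<omega> i k) \<in> borel_measurable M"
  shows "(\<lambda>\<omega>. lik n (f \<omega>) (g \<omega>)) \<in> borel_measurable M"
  unfolding lik_def by (intro borel_measurable_prod measurable_TV(3) f g) auto

lemma lik_nonneg: "0 \<le> lik n B X" by (simp add: lik_def lik1_pos less_imp_le prod_nonneg)

lemma measurable_lik_base_sample: "lik n B \<in> borel_measurable base_sample"
  by (rule measurable_lik[of "\<lambda>_. B" _ "\<lambda>X. X", simplified]) (auto intro: entry_base_sample)

text \<open>Change of measure: the likelihood depends on the dataset alone, so it passes through the
  kernel \<open>A\<close> and only replaces the law of the dataset.\<close>

lemma nn_integral_joint_lik:
  assumes f: "(\<lambda>(X, z). f X z) \<in> borel_measurable (base_sample \<Otimes>\<^sub>M D0)"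
  shows "(\<integral>\<^sup>+ \<omega>. f (fst \<omega>) (snd \<omega>) * ennreal (lik n B (fst \<omega>)) \<partial>joint)
     = (\<integral>\<^sup>+ X. \<integral>\<^sup>+ z. f X z \<partial>A X \<partial>datasets n (DB B))"
proof -
  note [measurable] = f measurable_lik_base_sample[of B]
  have "(\<integral>\<^sup>+ \<omega>. f (fst \<omega>) (snd \<omega>) * ennreal (lik n B (fst \<omega>)) \<partial>joint) =
    (\<integral>\<^sup>+ X. \<integral>\<^sup>+ z. f X z * ennreal (lik n B X) \<partial>A X \<partial>base_sample)"
    by (rule nn_integral_joint) simp
  also have "\<dots> = (\<integral>\<^sup>+ X. ennreal (lik n B X) * (\<integral>\<^sup>+ z. f X z \<partial>A X) \<partial>base_sample)"
  proof (rule nn_integral_cong)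
    fix X assume X: "X \<in> space base_sample"
    have "f X \<in> borel_measurable (A X)"
      unfolding measurable_cong_sets[OF A_sets[OF X] refl]
      using measurable_compose[OF measurable_Pair1'[OF X] f] by simp
    then show "(\<integral>\<^sup>+ z. f X z * ennreal (lik n B X) \<partial>A X) = ennreal (lik n B X) * (\<integral>\<^sup>+ z. f X z \<partial>A X)"
      by (subst nn_integral_multc) (auto simp: mult.commute)
  qed
  also have "\<dots> = (\<integral>\<^sup>+ X. \<integral>\<^sup>+ z. f X z \<partial>A X \<partial>datasets n (DB B))"
    unfolding datasets_DB
    by (subst nn_integral_density) (auto intro!: nn_integral_measurable_subprob_algebra2[OF f A_kernel])
  finally show ?thesis .
qed

lemma integral_lik: "integrable joint (\<lambda>\<omega>. lik n B (fst \<omega>))" "(\<integral>\<omega>. lik n B (fst \<omega>) \<partial>joint) = 1"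
proof -
  interpret P: prob_space "datasets n (DB B)" by (rule prob_space_datasets_DB)
  note [measurable] = measurable_lik_base_sample[of B]
  have "(\<integral>\<^sup>+ \<omega>. ennreal (lik n B (fst \<omega>)) \<partial>joint) = (\<integral>\<^sup>+ X. \<integral>\<^sup>+ z. 1 \<partial>A X \<partial>datasets n (DB B))"
    using nn_integral_joint_lik[of "\<lambda>_ _. 1"] by simp
  also have "\<dots> = (\<integral>\<^sup>+ X. 1 \<partial>datasets n (DB B))"
    by (intro nn_integral_cong) (simp add: prob_space.emeasure_space_1[OF A_prob] space_datasets_DB)
  finally have 1: "(\<integral>\<^sup>+ \<omega>. ennreal (lik n B (fst \<omega>)) \<partial>joint) = 1" by (simp add: P.emeasure_space_1)
  show "integrable joint (\<lambda>\<omega>. lik n B (fst \<omega>))"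
    by (rule integrableI_nonneg) (use 1 in \<open>auto simp: lik_nonneg\<close>)
  show "(\<integral>\<omega>. lik n B (fst \<omega>) \<partial>joint) = 1"
    by (subst integral_eq_nn_integral) (use 1 in \<open>auto simp: lik_nonneg\<close>)
qed

lemma zeta_joint_measurable:
  "(\<lambda>(B, \<omega>). zeta B (snd \<omega>) * lik n B (fst \<omega>)) \<in> borel_measurable (box \<Otimes>\<^sub>M joint)"
  "i < n \<Longrightarrow> (\<lambda>(B, \<omega>). Phi B (snd \<omega>) (fst \<omega> i) * lik n B (fst \<omega>)) \<in> borel_measurable (box \<Otimes>\<^sub>M joint)"
proof -
  have s: "sets (box \<Otimes>\<^sub>M joint) = sets (box \<Otimes>\<^sub>M (base_sample \<Otimes>\<^sub>M D0))"
    by (intro sets_pair_measure_cong refl sets_joint)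
  have 1: "(\<lambda>p. fst p e) \<in> borel_measurable (box \<Otimes>\<^sub>M (base_sample \<Otimes>\<^sub>M D0))" if "e \<in> E" for e
    by (rule measurable_compose[OF measurable_fst measurable_coord_box[OF that]])
  have 2: "(\<lambda>p. fst (snd p) i k) \<in> borel_measurable (box \<Otimes>\<^sub>M (base_sample \<Otimes>\<^sub>M D0))" if "i < n" "k < d" for i k
    by (rule measurable_compose[OF measurable_snd measurable_compose[OF measurable_fst entry_base_sample[OF that]]])
  have 3: "(\<lambda>p. snd (snd p) k) \<in> borel_measurable (box \<Otimes>\<^sub>M (base_sample \<Otimes>\<^sub>M D0))" if "k < d" for k
    by (rule measurable_compose[OF measurable_snd measurable_compose[OF measurable_snd measurable_coord_D0[OF that]]])
  show "(\<lambda>(B, \<omega>). zeta B (snd \<omega>) * lik n B (fst \<omega>)) \<in> borel_measurable (box \<Otimes>\<^sub>M joint)"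
    unfolding measurable_cong_sets[OF s refl] case_prod_beta
    by (intro borel_measurable_times measurable_zeta(1) measurable_lik 1 2 3)
  show "(\<lambda>(B, \<omega>). Phi B (snd \<omega>) (fst \<omega> i) * lik n B (fst \<omega>)) \<in> borel_measurable (box \<Otimes>\<^sub>M joint)" if "i < n"
    unfolding measurable_cong_sets[OF s refl] case_prod_beta
    by (intro borel_measurable_times measurable_Phi measurable_lik 1 2 3 that)
qed

lemma zeta_joint_meas:
  "(\<lambda>\<omega>. zeta B (snd \<omega>)) \<in> borel_measurable joint"
  "(\<lambda>\<omega>. lik n B (fst \<omega>)) \<in> borel_measurable joint"
  unfolding measurable_cong_sets[OF sets_joint refl]
  by (intro measurable_zeta(1) measurable_lik measurable_const borel_measurable_const
      measurable_compose[OF measurable_fst entry_base_sample] measurable_compose[OF measurable_snd measurable_coord_D0]; simp)+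

text \<open>\<open>zeta B + 1\<close> takes values in [0, 2], so an error of \<alpha> on events
  becomes an error of at most 2 \<alpha> in expectation.\<close>

lemma output_zeta:
  assumes B: "B \<in> space box"
    and acc: "tv_dist (DB B) (output_dist n A (DB B)) \<le> \<alpha>"
  shows "(\<integral>\<omega>. zeta B (snd \<omega>) * lik n B (fst \<omega>) \<partial>joint) \<ge> (\<integral>x. zeta B x \<partial>DB B) - 2 * \<alpha>"
proof -
  let ?Q = "output_dist n A (DB B)"
  interpret DB: prob_space "DB B" by (rule prob_space_DB)
  have A': "A \<in> datasets n (DB B) \<rightarrow>\<^sub>M subprob_algebra D0"
    using A_kernel unfolding measurable_cong_sets[OF sets_datasets_DB refl] .
  have nQ: "(\<integral>\<^sup>+ z. f z \<partial>?Q) = (\<integral>\<^sup>+ X. \<integral>\<^sup>+ z. f z \<partial>A X \<partial>datasets n (DB B))" if "f \<in> borel_measurable D0" for f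
    unfolding output_dist_def by (rule nn_integral_bind[OF that A'])
  have sQ: "sets ?Q = sets D0"
    unfolding output_dist_def
    by (rule sets_bind) (use A_sets space_datasets_DB base_sample.not_empty in auto)
  have "emeasure ?Q (space ?Q) = (\<integral>\<^sup>+ z. 1 \<partial>?Q)" by simp
  also have "\<dots> = (\<integral>\<^sup>+ X. \<integral>\<^sup>+ z. 1 \<partial>A X \<partial>datasets n (DB B))" by (rule nQ) simp
  also have "\<dots> = (\<integral>\<^sup>+ X. 1 \<partial>datasets n (DB B))"
    by (intro nn_integral_cong) (simp add: prob_space.emeasure_space_1[OF A_prob] space_datasets_DB)
  also have "\<dots> = 1" using prob_space.emeasure_space_1[OF prob_space_datasets_DB] by simp
  finally interpret Q: prob_space ?Q by (intro prob_spaceI)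
  have tv: "\<bar>measure (DB B) S - measure ?Q S\<bar> \<le> \<alpha>" if "S \<in> sets (DB B)" for S
  proof -
    \<comment> \<open>A real supremum dominates its members only once the family is known to be
      bounded.\<close>
    have "bdd_above ((\<lambda>S. \<bar>measure (DB B) S - measure ?Q S\<bar>) ` sets (DB B))"
    proof (rule bdd_aboveI2)
      show "\<bar>measure (DB B) S - measure ?Q S\<bar> \<le> 1" for S
        using DB.prob_le_1[of S] Q.prob_le_1[of S] measure_nonneg[of "DB B" S] measure_nonneg[of ?Q S]
        by linarith
    qed
    then have "\<bar>measure (DB B) S - measure ?Q S\<bar> \<le> tv_dist (DB B) ?Q"
      unfolding tv_dist_def using that by (intro cSUP_upper)
    then show ?thesis using acc by simp
  qed
  have a0: "0 \<le> \<alpha>" using tv[of "{}"] by simp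
  have sD: "sets (DB B) = sets D0" by (simp add: DB_def)
  have z: "zeta B \<in> borel_measurable D0"
    using measurable_zeta(1)[of "\<lambda>_. B" D0 "\<lambda>x. x"] by auto
  have zD: "zeta B \<in> borel_measurable (DB B)" and zQ: "zeta B \<in> borel_measurable ?Q"
    using z unfolding measurable_cong_sets[OF sD refl] measurable_cong_sets[OF sQ refl] by auto
  have zb: "0 \<le> zeta B x + 1" "zeta B x + 1 \<le> 2" for x using zeta_bound[OF B b_small, of x] by auto
  have iD: "integrable (DB B) (zeta B)" and iQ: "integrable ?Q (zeta B)"
    using zeta_bound[OF B b_small] zD zQ
    by (auto intro!: DB.integrable_const_bound[of _ 1] Q.integrable_const_bound[of _ 1] AE_I2)
  have le: "(\<integral>\<^sup>+ x. ennreal (zeta B x + 1) \<partial>DB B) \<le> ennreal 1 * (\<integral>\<^sup>+ x. ennreal (zeta B x + 1) \<partial>?Q) + ennreal (\<alpha> * 2)"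
  proof (rule nn_integral_le_of_emeasure_le)
    show "measure (DB B) S \<le> 1 * measure ?Q S + \<alpha>" if "S \<in> sets (DB B)" for S
      using tv[OF that] by simp
  qed (use zb zD a0 sD sQ DB.finite_measure_axioms Q.finite_measure_axioms in auto)
  have "(\<integral>\<^sup>+ x. ennreal (zeta B x + 1) \<partial>DB B) = ennreal ((\<integral>x. zeta B x \<partial>DB B) + 1)"
    using iD zb by (subst nn_integral_eq_integral) (auto simp: DB.prob_space)
  moreover have nnQ: "(\<integral>\<^sup>+ x. ennreal (zeta B x + 1) \<partial>?Q) = ennreal ((\<integral>x. zeta B x \<partial>?Q) + 1)"
    using iQ zb by (subst nn_integral_eq_integral) (auto simp: Q.prob_space)
  moreover have q0: "0 \<le> (\<integral>x. zeta B x \<partial>?Q) + 1"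
    using Bochner_Integration.integral_nonneg[of ?Q "\<lambda>x. zeta B x + 1"] zb iQ by (simp add: Q.prob_space)
  ultimately have 1: "(\<integral>x. zeta B x \<partial>DB B) \<le> (\<integral>x. zeta B x \<partial>?Q) + 2 * \<alpha>"
    using le a0 by (simp add: ennreal_plus[symmetric] del: ennreal_plus)
  have zL: "integrable joint (\<lambda>\<omega>. zeta B (snd \<omega>) * lik n B (fst \<omega>))"
  proof (rule Bochner_Integration.integrable_bound[OF integral_lik(1)[of B]])
    show "(\<lambda>\<omega>. zeta B (snd \<omega>) * lik n B (fst \<omega>)) \<in> borel_measurable joint"
      by (intro borel_measurable_times zeta_joint_meas)
    show "AE \<omega> in joint. norm (zeta B (snd \<omega>) * lik n B (fst \<omega>)) \<le> norm (lik n B (fst \<omega>))"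
      using zeta_bound[OF B b_small] by (intro AE_I2) (auto simp: abs_mult intro: mult_left_le_one_le)
  qed
  have nnL: "0 \<le> zeta B (snd \<omega>) * lik n B (fst \<omega>) + lik n B (fst \<omega>)" for \<omega>
  proof -
    have "0 \<le> (zeta B (snd \<omega>) + 1) * lik n B (fst \<omega>)" by (intro mult_nonneg_nonneg zb lik_nonneg)
    then show ?thesis by (simp add: algebra_simps)
  qed
  have "ennreal ((\<integral>x. zeta B x \<partial>?Q) + 1) = (\<integral>\<^sup>+ X. \<integral>\<^sup>+ z. ennreal (zeta B z + 1) \<partial>A X \<partial>datasets n (DB B))"
    using z by (subst nnQ[symmetric], subst nQ) auto
  also have "\<dots> = (\<integral>\<^sup>+ \<omega>. ennreal (zeta B (snd \<omega>) + 1) * ennreal (lik n B (fst \<omega>)) \<partial>joint)"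
    using z by (subst nn_integral_joint_lik) auto
  also have "\<dots> = (\<integral>\<^sup>+ \<omega>. ennreal (zeta B (snd \<omega>) * lik n B (fst \<omega>) + lik n B (fst \<omega>)) \<partial>joint)"
    using zb(1) by (intro nn_integral_cong) (simp add: ennreal_mult[symmetric] lik_nonneg algebra_simps)
  also have "\<dots> = ennreal (\<integral>\<omega>. zeta B (snd \<omega>) * lik n B (fst \<omega>) + lik n B (fst \<omega>) \<partial>joint)"
    by (intro nn_integral_eq_integral Bochner_Integration.integrable_add zL integral_lik AE_I2 nnL)
  also have c1: "(\<integral>\<omega>. zeta B (snd \<omega>) * lik n B (fst \<omega>) + lik n B (fst \<omega>) \<partial>joint)
    = (\<integral>\<omega>. zeta B (snd \<omega>) * lik n B (fst \<omega>) \<partial>joint) + 1"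
    using zL integral_lik[of B] by simp
  finally have "ennreal ((\<integral>x. zeta B x \<partial>?Q) + 1) = ennreal ((\<integral>\<omega>. zeta B (snd \<omega>) * lik n B (fst \<omega>) \<partial>joint) + 1)" .
  moreover have "0 \<le> (\<integral>\<omega>. zeta B (snd \<omega>) * lik n B (fst \<omega>) \<partial>joint) + 1"
    unfolding c1[symmetric] by (intro Bochner_Integration.integral_nonneg nnL)
  ultimately have "(\<integral>x. zeta B x \<partial>?Q) = (\<integral>\<omega>. zeta B (snd \<omega>) * lik n B (fst \<omega>) \<partial>joint)"
    using q0 by (simp add: ennreal_inj)
  with 1 show ?thesis by simp
qed

end

section \<open>Sensitivity to one sample\<close>

context hidden_regression
begin

text \<open>For an honest sample the residual is the original noise and the inputs are untouched, so
  the score no longer depends on \<open>B\<close>.\<close>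

lemma score_shear: "e \<in> E \<Longrightarrow> score B (shear B x) e = 2 / 3 * outer x e"
proof -
  assume e: "e \<in> E"
  have "shift B (shear B x) j = shift B x j" for j
    using m_less by (auto simp: shift_def shear_def intro!: sum.cong)
  then show ?thesis using e m_less by (auto simp: score_def outer_def shear_def)
qed

lemma outer_le: "good z \<Longrightarrow> e \<in> E \<Longrightarrow> \<bar>outer z e\<bar> \<le> 20 * real d"
proof -
  assume z: "good z" and e: "e \<in> E"
  obtain j k where jk: "e = (j, k)" "m \<le> j" "j < d" "k < m" using e by auto
  have "(z j)\<^sup>2 \<le> out_sq z" unfolding out_sq_def using jk by (intro member_le_sum) auto
  moreover have "(z k)\<^sup>2 \<le> in_sq z" unfolding in_sq_def using jk by (intro member_le_sum) auto
  moreover have "2 * (\<bar>z j\<bar> * \<bar>z k\<bar>) \<le> (z j)\<^sup>2 + (z k)\<^sup>2"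
    using sum_squares_bound[of "\<bar>z j\<bar>" "\<bar>z k\<bar>"] by simp
  ultimately show ?thesis using z by (simp add: outer_def jk good_def abs_mult)
qed

text \<open>An envelope for \<open>Phi\<close> that is uniform in the output: the additive error of
  privacy is multiplied by a supremum over outputs at a fixed dataset.\<close>

definition sens_bound :: "(nat \<times> nat \<Rightarrow> real) \<Rightarrow> (nat \<Rightarrow> real) \<Rightarrow> real" where
  "sens_bound B x = (\<Sum>e\<in>E. b\<^sup>2 / 2 * (20 * real d) * \<bar>score B x e\<bar>)"

lemma sens_bound_nonneg: "0 \<le> sens_bound B x" by (simp add: sens_bound_def sum_nonneg)

lemma Phi_le_sens_bound: "B \<in> space box \<Longrightarrow> \<bar>Phi B z x\<bar> \<le> sens_bound B x"
proof (cases "good z")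
  case True
  assume B: "B \<in> space box"
  have "\<bar>Phi B z x\<bar> \<le> 1 * \<bar>\<Sum>e\<in>E. wgt B e * outer z e * score B x e\<bar>"
    using True damp_bounds[of "T B z"] unfolding Phi_def by (simp add: abs_mult mult_left_le_one_le)
  also have "\<dots> \<le> (\<Sum>e\<in>E. \<bar>wgt B e * outer z e * score B x e\<bar>)" by simp
  also have "\<dots> \<le> sens_bound B x" unfolding sens_bound_def
  proof (rule sum_mono)
    fix e assume e: "e \<in> E"
    show "\<bar>wgt B e * outer z e * score B x e\<bar> \<le> b\<^sup>2 / 2 * (20 * real d) * \<bar>score B x e\<bar>"
      unfolding abs_mult using wgt_bounds[of B e, OF box_range[OF B e]]
      by (intro mult_right_mono mult_mono outer_le True e) auto
  qed
  finally show ?thesis .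
qed (simp add: Phi_def sens_bound_nonneg)

lemma measurable_fixed_Phi:
  "(\<lambda>x. Phi B z x) \<in> borel_measurable D0" "sens_bound B \<in> borel_measurable D0"
proof -
  show "(\<lambda>x. Phi B z x) \<in> borel_measurable D0"
    using measurable_Phi[of "\<lambda>_. B" D0 "\<lambda>_. z" "\<lambda>x. x"] by simp
  have "(\<lambda>x. score B x e) \<in> borel_measurable D0" if "e \<in> E" for e
    unfolding score_def using that m_less
    by (intro borel_measurable_times borel_measurable_diff borel_measurable_const measurable_fixed_D0 measurable_coord_D0) auto
  then show "sens_bound B \<in> borel_measurable D0"
    unfolding sens_bound_def[abs_def] by (intro borel_measurable_sum borel_measurable_times borel_measurable_const borel_measurable_abs)
qed

lemma nn_integral_sq_coord: "j < d \<Longrightarrow> (\<integral>\<^sup>+ x. ennreal ((x j)\<^sup>2) \<partial>D0) = ennreal (3 / 2)"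
  using coordinate_integral[of "{..<d}" j "\<lambda>y. y\<^sup>2"] integrable_nu_power[of 2]
  by (subst nn_integral_eq_integral) (auto simp: D0_def nu_moments)

lemma nn_integral_outer_le: "e \<in> E \<Longrightarrow> (\<integral>\<^sup>+ x. ennreal \<bar>outer x e\<bar> \<partial>D0) \<le> ennreal (3 / 2)"
proof -
  assume e: "e \<in> E"
  obtain j k where jk: "e = (j, k)" "j < d" "k < d" using e m_less by auto
  note [measurable] = measurable_coord_D0[OF jk(2)] measurable_coord_D0[OF jk(3)]
  have "(\<integral>\<^sup>+ x. ennreal \<bar>outer x e\<bar> \<partial>D0) \<le> (\<integral>\<^sup>+ x. ennreal (1/2) * (ennreal ((x j)\<^sup>2) + ennreal ((x k)\<^sup>2)) \<partial>D0)"
  proof (rule nn_integral_mono)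
    fix x :: "nat \<Rightarrow> real"
    have "2 * (\<bar>x j\<bar> * \<bar>x k\<bar>) \<le> (x j)\<^sup>2 + (x k)\<^sup>2"
      using sum_squares_bound[of "\<bar>x j\<bar>" "\<bar>x k\<bar>"] by simp
    then have "\<bar>outer x e\<bar> \<le> 1/2 * ((x j)\<^sup>2 + (x k)\<^sup>2)" by (simp add: outer_def jk abs_mult)
    then show "ennreal \<bar>outer x e\<bar> \<le> ennreal (1/2) * (ennreal ((x j)\<^sup>2) + ennreal ((x k)\<^sup>2))"
      by (simp only: ennreal_plus[symmetric] ennreal_mult[symmetric] zero_le_power2 add_nonneg_nonneg) (simp add: ennreal_leI ennreal_mult[symmetric] del: ennreal_plus)
  qed
  also have "\<dots> = ennreal (1/2) * (ennreal (3/2) + ennreal (3/2))"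
    by (subst nn_integral_cmult, simp, subst nn_integral_add) (simp_all add: nn_integral_sq_coord jk)
  also have "\<dots> = ennreal (1 / 2 * (3 / 2 + 3 / 2))"
  proof -
    have "ennreal (1/2 * (3/2 + 3/2)) = ennreal (1/2) * ennreal (3/2 + 3/2)" by (rule ennreal_mult) simp_all
    also have "ennreal (3/2 + 3/2) = ennreal (3/2) + ennreal (3/2)" by (rule ennreal_plus) simp_all
    finally show ?thesis by (rule sym)
  qed
  also have "1 / 2 * (3 / 2 + 3 / 2) = (3 / 2 :: real)" by simp
  finally show ?thesis .
qed

text \<open>Absolute values forgo all cancellation: each of at most d^2 entries costs b^2/2 * 20 d *
  2/3 * 3/2 = 10 b^2 d.\<close>

lemma nn_integral_sens_bound: "(\<integral>\<^sup>+ x. ennreal (sens_bound B x) \<partial>DB B) \<le> ennreal (10 * b\<^sup>2 * real d ^ 3)"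
proof -
  let ?c = "b\<^sup>2 / 2 * (20 * real d) * (2 / 3)"
  have outer [measurable]: "(\<lambda>x. outer x e) \<in> borel_measurable D0" if "e \<in> E" for e
    unfolding outer_def using that m_less by (intro borel_measurable_times measurable_coord_D0) auto
  have "(\<integral>\<^sup>+ x. ennreal (sens_bound B x) \<partial>DB B) = (\<integral>\<^sup>+ x. ennreal (sens_bound B (shear B x)) \<partial>D0)"
    by (rule nn_integral_DB) (intro measurable_compose[OF _ measurable_ennreal] measurable_fixed_Phi)
  also have "\<dots> = (\<integral>\<^sup>+ x. (\<Sum>e\<in>E. ennreal ?c * ennreal \<bar>outer x e\<bar>) \<partial>D0)"
  proof (rule nn_integral_cong)
    fix x
    have "sens_bound B (shear B x) = (\<Sum>e\<in>E. ?c * \<bar>outer x e\<bar>)"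
      unfolding sens_bound_def by (intro sum.cong refl) (simp add: score_shear abs_mult)
    then have "ennreal (sens_bound B (shear B x)) = (\<Sum>e\<in>E. ennreal (?c * \<bar>outer x e\<bar>))"
      by (simp only:) (intro sum_ennreal[symmetric], simp)
    also have "\<dots> = (\<Sum>e\<in>E. ennreal ?c * ennreal \<bar>outer x e\<bar>)"
      by (intro sum.cong refl ennreal_mult) auto
    finally show "ennreal (sens_bound B (shear B x)) = (\<Sum>e\<in>E. ennreal ?c * ennreal \<bar>outer x e\<bar>)" .
  qed
  also have "\<dots> = (\<Sum>e\<in>E. ennreal ?c * (\<integral>\<^sup>+ x. ennreal \<bar>outer x e\<bar> \<partial>D0))"
  proof -
    have m: "(\<lambda>x. ennreal \<bar>outer x e\<bar>) \<in> borel_measurable D0" if "e \<in> E" for e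
      using outer[OF that] by simp
    show ?thesis
      using m by (simp only: nn_integral_sum nn_integral_cmult borel_measurable_times_ennreal borel_measurable_const cong: sum.cong)
  qed
  also have "\<dots> \<le> (\<Sum>e\<in>E. ennreal ?c * ennreal (3 / 2))"
    by (intro sum_mono mult_left_mono nn_integral_outer_le) auto
  also have "\<dots> = (\<Sum>e\<in>E. ennreal (10 * b\<^sup>2 * real d))"
    by (intro sum.cong refl) (simp add: ennreal_mult[symmetric] mult_ac)
  also have "\<dots> = ennreal (real (card E) * (10 * b\<^sup>2 * real d))"
    by (simp add: ennreal_of_nat_eq_real_of_nat ennreal_mult del: card_cartesian_product)
  also have "\<dots> \<le> ennreal (10 * b\<^sup>2 * real d ^ 3)"
  proof (rule ennreal_leI)
    have "real (card E) \<le> real d * real d"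
      using m_less by (simp add: card_cartesian_product) (intro mult_mono, auto)
    then have "real (card E) * (10 * b\<^sup>2 * real d) \<le> (real d * real d) * (10 * b\<^sup>2 * real d)"
      by (intro mult_right_mono) auto
    then show "real (card E) * (10 * b\<^sup>2 * real d) \<le> 10 * b\<^sup>2 * real d ^ 3"
      by (simp add: power3_eq_cube mult_ac)
  qed
  finally show ?thesis .
qed

text \<open>With the output fixed and an honest sample, shearing turns \<open>Phi\<close> into a
  bilinear form in the base noise. Reflection gives the symmetry; orthogonality gives the size b^2/2
  * 20 d, smaller by d^2 than the bound with absolute values.\<close>

lemma Phi_symmetric:
  assumes B: "B \<in> space box"
  shows "(\<integral>\<^sup>+ x. ennreal (- Phi B z x) \<partial>DB B) = (\<integral>\<^sup>+ x. ennreal (Phi B z x) \<partial>DB B)"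
    and "(\<integral>\<^sup>+ x. ennreal (Phi B z x) \<partial>DB B) \<le> ennreal (10 * b\<^sup>2 * real d)"
proof -
  define c where "c e = (if good z then damp (T B z) * wgt B e * outer z e * (2 / 3) else 0)" for e
  have Phi: "Phi B z (shear B x) = bilin c x" for x
    by (simp add: Phi_def bilin_def c_def sum_distrib_left score_shear outer_def[of x] mult_ac cong: sum.cong)
  have e1: "(\<integral>\<^sup>+ x. ennreal (Phi B z x) \<partial>DB B) = (\<integral>\<^sup>+ x. ennreal (bilin c x) \<partial>D0)"
    using nn_integral_DB[of "\<lambda>x. ennreal (Phi B z x)" B] measurable_fixed_Phi(1)[of B z]
    by (simp add: Phi measurable_compose[OF _ measurable_ennreal])
  have e2: "(\<integral>\<^sup>+ x. ennreal (- Phi B z x) \<partial>DB B) = (\<integral>\<^sup>+ x. ennreal (- bilin c x) \<partial>D0)"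
    using nn_integral_DB[of "\<lambda>x. ennreal (- Phi B z x)" B] measurable_fixed_Phi(1)[of B z]
    by (simp add: Phi measurable_compose[OF _ measurable_ennreal])
  show "(\<integral>\<^sup>+ x. ennreal (- Phi B z x) \<partial>DB B) = (\<integral>\<^sup>+ x. ennreal (Phi B z x) \<partial>DB B)"
    unfolding e1 e2 by (rule bilin_symmetric)
  show "(\<integral>\<^sup>+ x. ennreal (Phi B z x) \<partial>DB B) \<le> ennreal (10 * b\<^sup>2 * real d)"
    unfolding e1
  proof (rule bilin_nn_integral_le)
    show "0 < 10 * b\<^sup>2 * real d" using b_pos m_less by simp
    \<comment> \<open>The factor 9/4 from the second moments cancels the (2/3)^2 carried by the
      score.\<close>
    show "9 / 4 * (\<Sum>e\<in>E. (c e)\<^sup>2) \<le> (10 * b\<^sup>2 * real d)\<^sup>2"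
    proof (cases "good z")
      case True
      have "9 / 4 * (\<Sum>e\<in>E. (c e)\<^sup>2) = (\<Sum>e\<in>E. (damp (T B z))\<^sup>2 * (wgt B e)\<^sup>2 * (outer z e)\<^sup>2)"
        using True by (simp add: c_def sum_distrib_left power_mult_distrib power_divide mult_ac)
      also have "\<dots> \<le> (\<Sum>e\<in>E. (1 * (b\<^sup>2 / 2)\<^sup>2) * (outer z e)\<^sup>2)"
        using damp_bounds[of "T B z"] wgt_bounds[of B, OF box_range[OF B]]
        by (intro sum_mono mult_right_mono mult_mono power_mono power_le_one) (auto simp: less_imp_le)
      also have "\<dots> = (b\<^sup>2 / 2)\<^sup>2 * (out_sq z * in_sq z)" by (simp add: sum_distrib_left[symmetric] sum_outer_sq del: mem_Sigma_iff)
      also have "\<dots> \<le> (b\<^sup>2 / 2)\<^sup>2 * ((20 * real d) * (20 * real d))"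
        by (intro mult_left_mono mult_mono) (use True out_sq_nonneg[of z] in_sq_nonneg[of z] in \<open>simp_all add: good_def\<close>)
      also have "\<dots> = (10 * b\<^sup>2 * real d)\<^sup>2" by (simp add: power2_eq_square)
      finally show ?thesis .
    qed (simp add: c_def)
  qed
qed

end

section \<open>Privacy applied to the replacement of one sample\<close>

context private_sampler
begin

definition origin :: "nat \<Rightarrow> real" where "origin = (\<lambda>j\<in>{..<d}. 0)"

lemma origin_space: "origin \<in> space D0" by (auto simp: origin_def space_D0)

lemma upd_base_sample: "X \<in> space base_sample \<Longrightarrow> i < n \<Longrightarrow> w \<in> space D0 \<Longrightarrow> X(i := w) \<in> space base_sample"
  by (auto simp: space_PiM PiE_iff extensional_def)

lemma privacy:
  assumes X: "X \<in> space base_sample" and i: "i < n" and w: "w \<in> space D0" and S: "S \<in> sets D0"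
  shows "measure (A X) S \<le> exp \<epsilon> * measure (A (X(i := w))) S + \<delta>"
    "measure (A (X(i := w))) S \<le> exp \<epsilon> * measure (A X) S + \<delta>"
proof -
  note X' = upd_base_sample[OF X i w]
  have "measure (A X) S \<le> exp \<epsilon> * measure (A (X(i := w))) S + \<delta> \<and>
    measure (A (X(i := w))) S \<le> exp \<epsilon> * measure (A X) S + \<delta>"
  proof (cases "X i = w")
    \<comment> \<open>Equal datasets are not neighbors, so privacy says nothing here; the claim
      follows from exp \<epsilon> >= 1 and \<delta> >= 0.\<close>
    case True
    then have "X(i := w) = X" by auto
    moreover have "measure (A X) S \<le> exp \<epsilon> * measure (A X) S"
      using mult_right_mono[of 1 "exp \<epsilon>" "measure (A X) S"] eps(1) by simp
    ultimately show ?thesis using delta by simp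
  next
    case False
    then have "{j. j < n \<and> X j \<noteq> (X(i := w)) j} = {i}" "{j. j < n \<and> (X(i := w)) j \<noteq> X j} = {i}"
      using i by auto
    then have "neighbors n X (X(i := w))" "neighbors n (X(i := w)) X" by (simp_all add: neighbors_def)
    then show ?thesis
      using dp X X' S unfolding diff_private_def space_base_sample sets_D0 by blast
  qed
  then show "measure (A X) S \<le> exp \<epsilon> * measure (A (X(i := w))) S + \<delta>"
    "measure (A (X(i := w))) S \<le> exp \<epsilon> * measure (A X) S + \<delta>" by auto
qed

text \<open>\<open>f\<close> may be negative; \<open>ennreal\<close> replaces it by its positive
  part, to which the layer-cake comparison applies. The bound \<open>K\<close> may vary with the
  dataset, which is used for the envelope of \<open>Phi\<close>.\<close>

lemma privacy_integral:
  assumes X: "X \<in> space base_sample" and i: "i < n" and w: "w \<in> space D0"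
    and f: "f \<in> borel_measurable D0" and fM: "\<And>z. f z \<le> K" and K: "0 \<le> K"
  shows "(\<integral>\<^sup>+ z. ennreal (f z) \<partial>A X) \<le> ennreal (exp \<epsilon>) * (\<integral>\<^sup>+ z. ennreal (f z) \<partial>A (X(i := w))) + ennreal (\<delta> * K)"
    and "(\<integral>\<^sup>+ z. ennreal (f z) \<partial>A (X(i := w))) \<le> ennreal (exp \<epsilon>) * (\<integral>\<^sup>+ z. ennreal (f z) \<partial>A X) + ennreal (\<delta> * K)"
proof -
  note X' = upd_base_sample[OF X i w]
  have fin: "finite_measure (A Y)" if "Y \<in> space base_sample" for Y
    using A_prob[OF that] by (rule prob_space.finite_measure)
  have m: "(\<lambda>z. max 0 (f z)) \<in> borel_measurable (A Y)" if "Y \<in> space base_sample" for Y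
    unfolding measurable_cong_sets[OF A_sets[OF that] refl] by (intro borel_measurable_max borel_measurable_const f)
  have e: "ennreal (f z) = ennreal (max 0 (f z))" for z by (cases "0 \<le> f z") (auto simp: ennreal_neg)
  have mx: "max 0 (f z) \<le> K" for z using fM[of z] K by simp
  show "(\<integral>\<^sup>+ z. ennreal (f z) \<partial>A X) \<le> ennreal (exp \<epsilon>) * (\<integral>\<^sup>+ z. ennreal (f z) \<partial>A (X(i := w))) + ennreal (\<delta> * K)"
    unfolding e
    by (rule nn_integral_le_of_emeasure_le[OF fin[OF X] fin[OF X'] _ m[OF X] _ mx])
       (use privacy(1)[OF X i w] A_sets[OF X] A_sets[OF X'] delta K in auto)
  show "(\<integral>\<^sup>+ z. ennreal (f z) \<partial>A (X(i := w))) \<le> ennreal (exp \<epsilon>) * (\<integral>\<^sup>+ z. ennreal (f z) \<partial>A X) + ennreal (\<delta> * K)"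
    unfolding e
    by (rule nn_integral_le_of_emeasure_le[OF fin[OF X'] fin[OF X] _ m[OF X'] _ mx])
       (use privacy(2)[OF X i w] A_sets[OF X] A_sets[OF X'] delta K in auto)
qed

lemma replace_measurable: "i < n \<Longrightarrow> (\<lambda>X. X(i := origin)) \<in> base_sample \<rightarrow>\<^sub>M base_sample"
proof -
  assume i: "i < n"
  have "(\<lambda>X. \<lambda>j\<in>{..<n}. (if j = i then origin else X j)) \<in> base_sample \<rightarrow>\<^sub>M base_sample"
    by (intro measurable_restrict) (use origin_space coord_base_sample in \<open>auto intro: measurable_const\<close>)
  moreover have "(\<lambda>j\<in>{..<n}. (if j = i then origin else X j)) = X(i := origin)" if "X \<in> space base_sample" for X
    using that i by (auto simp: space_PiM PiE_iff extensional_def fun_eq_iff)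
  ultimately show ?thesis by (simp cong: measurable_cong)
qed

text \<open>Taken at \<open>s = 1\<close> and \<open>s = -1\<close>, these are the masses of the
  positive and the negative part of the correlation. Privacy compares nonnegative integrals, so the
  parts are handled separately.\<close>

definition sens :: "(nat \<times> nat \<Rightarrow> real) \<Rightarrow> nat \<Rightarrow> real \<Rightarrow> ennreal" where
  "sens B i s = (\<integral>\<^sup>+ X. \<integral>\<^sup>+ z. ennreal (s * Phi B z (X i)) \<partial>A X \<partial>datasets n (DB B))"

text \<open>The algorithm sees the origin in place of sample \<open>i\<close>, but its output is still correlated with the
  original sample, of which it is now independent.\<close>

definition sens0 :: "(nat \<times> nat \<Rightarrow> real) \<Rightarrow> nat \<Rightarrow> real \<Rightarrow> ennreal" where
  "sens0 B i s = (\<integral>\<^sup>+ X. \<integral>\<^sup>+ z. ennreal (s * Phi B z (X i)) \<partial>A (X(i := origin)) \<partial>datasets n (DB B))"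

lemma Phi_pair_measurable:
  "(\<lambda>(x, z). ennreal (s * Phi B z x)) \<in> borel_measurable (D0 \<Otimes>\<^sub>M D0)"
  unfolding case_prod_beta
  by (intro measurable_compose[OF _ measurable_ennreal] borel_measurable_times borel_measurable_const
      measurable_Phi measurable_compose[OF measurable_fst measurable_coord_D0]
      measurable_compose[OF measurable_snd measurable_coord_D0])

lemma Phi_base_sample_measurable:
  assumes i: "i < n"
  shows "(\<lambda>(X, z). ennreal (s * Phi B z (X i))) \<in> borel_measurable (base_sample \<Otimes>\<^sub>M D0)"
proof -
  have "(\<lambda>p. (fst p i, snd p)) \<in> base_sample \<Otimes>\<^sub>M D0 \<rightarrow>\<^sub>M D0 \<Otimes>\<^sub>M D0"
    by (intro measurable_Pair measurable_compose[OF measurable_fst coord_base_sample[OF i]] measurable_snd)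
  from measurable_compose[OF this Phi_pair_measurable[of s B]] show ?thesis
    by (simp add: case_prod_beta)
qed

lemma Phi_snd_measurable: "(\<lambda>z. s * Phi B z x) \<in> borel_measurable D0"
  by (intro borel_measurable_times borel_measurable_const measurable_Phi measurable_coord_D0)

lemma inner_measurable:
  assumes i: "i < n"
  shows "(\<lambda>X. \<integral>\<^sup>+ z. ennreal (s * Phi B z (X i)) \<partial>A X) \<in> borel_measurable (datasets n (DB B))"
    "(\<lambda>X. \<integral>\<^sup>+ z. ennreal (s * Phi B z (X i)) \<partial>A (X(i := origin))) \<in> borel_measurable (datasets n (DB B))"
  unfolding measurable_cong_sets[OF sets_datasets_DB refl]
  by (intro nn_integral_measurable_subprob_algebra2[OF Phi_base_sample_measurable[OF i]] A_kernel
      measurable_compose[OF replace_measurable[OF i] A_kernel])+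

lemma sens_bound_component:
  assumes i: "i < n"
  shows "(\<integral>\<^sup>+ X. ennreal (sens_bound B (X i)) \<partial>datasets n (DB B)) \<le> ennreal (10 * b\<^sup>2 * real d ^ 3)"
    "(\<lambda>X. sens_bound B (X i)) \<in> borel_measurable (datasets n (DB B))"
proof -
  have sD: "sets (DB B) = sets D0" by (simp add: DB_def)
  have m: "sens_bound B \<in> borel_measurable (DB B)"
    unfolding measurable_cong_sets[OF sD refl] by (rule measurable_fixed_Phi)
  have c: "(\<lambda>X. X i) \<in> datasets n (DB B) \<rightarrow>\<^sub>M DB B"
    by (rule measurable_component_singleton) (use i in auto)
  show "(\<lambda>X. sens_bound B (X i)) \<in> borel_measurable (datasets n (DB B))"
    by (rule measurable_compose[OF c m])
  have "distr (datasets n (DB B)) (DB B) (\<lambda>X. X i) = DB B"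
    using distr_PiM_component[of "{..<n}" "\<lambda>_. DB B" i] i prob_space_DB by auto
  then have "(\<integral>\<^sup>+ x. ennreal (sens_bound B x) \<partial>DB B) = (\<integral>\<^sup>+ x. ennreal (sens_bound B x) \<partial>distr (datasets n (DB B)) (DB B) (\<lambda>X. X i))"
    by simp
  also have "\<dots> = (\<integral>\<^sup>+ X. ennreal (sens_bound B (X i)) \<partial>datasets n (DB B))"
    by (rule nn_integral_distr[OF c]) (simp only: measurable_distr_eq1 measurable_compose[OF m measurable_ennreal])
  finally show "(\<integral>\<^sup>+ X. ennreal (sens_bound B (X i)) \<partial>datasets n (DB B)) \<le> ennreal (10 * b\<^sup>2 * real d ^ 3)"
    using nn_integral_sens_bound[of B] by simp
qed

text \<open>Privacy is used at each fixed dataset, with an error \<delta> times the envelope of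
  sample \<open>i\<close>; averaging over the data then turns the envelope into its mean. Both
  directions are needed, one for each sign.\<close>

lemma sens_le:
  assumes B: "B \<in> space box" and i: "i < n" and s: "\<bar>s\<bar> = 1"
  shows "sens B i s \<le> ennreal (exp \<epsilon>) * sens0 B i s + ennreal (\<delta> * (10 * b\<^sup>2 * real d ^ 3))"
    "sens0 B i s \<le> ennreal (exp \<epsilon>) * sens B i s + ennreal (\<delta> * (10 * b\<^sup>2 * real d ^ 3))"
proof -
  let ?P = "datasets n (DB B)"
  have le: "s * Phi B z x \<le> sens_bound B x" for z x
    using Phi_le_sens_bound[OF B, of z x] abs_ge_self[of "s * Phi B z x"] s by (simp add: abs_mult)
  note pi = privacy_integral[OF _ i origin_space Phi_snd_measurable[of s B] le sens_bound_nonneg]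
  have d_split: "(\<integral>\<^sup>+ X. ennreal (exp \<epsilon>) * f X + ennreal (\<delta> * sens_bound B (X i)) \<partial>?P)
      \<le> ennreal (exp \<epsilon>) * (\<integral>\<^sup>+ X. f X \<partial>?P) + ennreal (\<delta> * (10 * b\<^sup>2 * real d ^ 3))"
    if f: "f \<in> borel_measurable ?P" for f
  proof -
    have m: "(\<lambda>X. ennreal (sens_bound B (X i))) \<in> borel_measurable ?P"
      by (rule measurable_compose[OF sens_bound_component(2)[OF i] measurable_ennreal])
    have "(\<integral>\<^sup>+ X. ennreal (exp \<epsilon>) * f X + ennreal (\<delta> * sens_bound B (X i)) \<partial>?P)
       = (\<integral>\<^sup>+ X. ennreal (exp \<epsilon>) * f X + ennreal \<delta> * ennreal (sens_bound B (X i)) \<partial>?P)"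
      using delta by (simp add: ennreal_mult sens_bound_nonneg)
    also have "\<dots> = ennreal (exp \<epsilon>) * (\<integral>\<^sup>+ X. f X \<partial>?P) + ennreal \<delta> * (\<integral>\<^sup>+ X. ennreal (sens_bound B (X i)) \<partial>?P)"
      using f m by (simp only: nn_integral_add nn_integral_cmult borel_measurable_times_ennreal borel_measurable_const)
    also have "\<dots> \<le> ennreal (exp \<epsilon>) * (\<integral>\<^sup>+ X. f X \<partial>?P) + ennreal \<delta> * ennreal (10 * b\<^sup>2 * real d ^ 3)"
      by (intro add_left_mono mult_left_mono sens_bound_component i) auto
    finally show ?thesis using delta by (simp add: ennreal_mult)
  qed
  have "sens B i s \<le> (\<integral>\<^sup>+ X. ennreal (exp \<epsilon>) * (\<integral>\<^sup>+ z. ennreal (s * Phi B z (X i)) \<partial>A (X(i := origin)))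
      + ennreal (\<delta> * sens_bound B (X i)) \<partial>?P)"
    unfolding sens_def by (intro nn_integral_mono pi(1)) (simp add: space_datasets_DB)
  also have "\<dots> \<le> ennreal (exp \<epsilon>) * sens0 B i s + ennreal (\<delta> * (10 * b\<^sup>2 * real d ^ 3))"
    unfolding sens0_def by (intro d_split inner_measurable i)
  finally show "sens B i s \<le> ennreal (exp \<epsilon>) * sens0 B i s + ennreal (\<delta> * (10 * b\<^sup>2 * real d ^ 3))" .
  have "sens0 B i s \<le> (\<integral>\<^sup>+ X. ennreal (exp \<epsilon>) * (\<integral>\<^sup>+ z. ennreal (s * Phi B z (X i)) \<partial>A X)
      + ennreal (\<delta> * sens_bound B (X i)) \<partial>?P)"
    unfolding sens0_def by (intro nn_integral_mono pi(2)) (simp add: space_datasets_DB)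
  also have "\<dots> \<le> ennreal (exp \<epsilon>) * sens B i s + ennreal (\<delta> * (10 * b\<^sup>2 * real d ^ 3))"
    unfolding sens_def by (intro d_split inner_measurable i)
  finally show "sens0 B i s \<le> ennreal (exp \<epsilon>) * sens B i s + ennreal (\<delta> * (10 * b\<^sup>2 * real d ^ 3))" .
qed

text \<open>After the replacement the output does not depend on sample \<open>i\<close>, so that
  sample can be integrated first with the output held fixed. The inner integral is symmetric in the
  sign, hence the right side does not contain \<open>s\<close>.\<close>

lemma sens0_eq:
  assumes B: "B \<in> space box" and i: "i < n" and s: "s = 1 \<or> s = -1"
  shows "sens0 B i s = (\<integral>\<^sup>+ X. \<integral>\<^sup>+ z. \<integral>\<^sup>+ x. ennreal (Phi B z x) \<partial>DB B \<partial>A (X(i := origin)) \<partial>(\<Pi>\<^sub>M j\<in>{..<n} - {i}. DB B))"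
proof -
  have sD: "sets (DB B) = sets D0" by (simp add: DB_def)
  have spD: "space (DB B) = space D0" by (rule space_DB)
  interpret DB: prob_space "DB B" by (rule prob_space_DB)
  interpret P: product_sigma_finite "\<lambda>_::nat. DB B"
    by unfold_locales (rule DB.sigma_finite_countable)
  have ins: "insert i ({..<n} - {i}) = {..<n}" using i by auto
  have inner: "(\<integral>\<^sup>+ x. ennreal (s * Phi B z x) \<partial>DB B) = (\<integral>\<^sup>+ x. ennreal (Phi B z x) \<partial>DB B)" for z
    using s Phi_symmetric(1)[OF B, of z] by auto
  have "sens0 B i s = (\<integral>\<^sup>+ X. \<integral>\<^sup>+ x. \<integral>\<^sup>+ z. ennreal (s * Phi B z ((X(i := x)) i)) \<partial>A ((X(i := x))(i := origin)) \<partial>DB B \<partial>(\<Pi>\<^sub>M j\<in>{..<n} - {i}. DB B))"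
    using P.product_nn_integral_insert[of "{..<n} - {i}" i "\<lambda>X. \<integral>\<^sup>+ z. ennreal (s * Phi B z (X i)) \<partial>A (X(i := origin))", unfolded ins]
      inner_measurable(2)[OF i, of s B] unfolding sens0_def by simp
  also have "\<dots> = (\<integral>\<^sup>+ X. \<integral>\<^sup>+ z. \<integral>\<^sup>+ x. ennreal (Phi B z x) \<partial>DB B \<partial>A (X(i := origin)) \<partial>(\<Pi>\<^sub>M j\<in>{..<n} - {i}. DB B))"
  proof (rule nn_integral_cong)
    fix X assume "X \<in> space (\<Pi>\<^sub>M j\<in>{..<n} - {i}. DB B)"
    then have Y: "X(i := origin) \<in> space base_sample"
      using i origin_space by (auto simp: space_PiM PiE_iff extensional_def spD)
    interpret K: prob_space "A (X(i := origin))" by (rule A_prob[OF Y])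
    interpret pair_sigma_finite "A (X(i := origin))" "DB B" ..
    have sp: "sets (A (X(i := origin)) \<Otimes>\<^sub>M DB B) = sets (D0 \<Otimes>\<^sub>M D0)"
      by (intro sets_pair_measure_cong A_sets Y sD)
    have m: "(\<lambda>(z, x). ennreal (s * Phi B z x)) \<in> borel_measurable (A (X(i := origin)) \<Otimes>\<^sub>M DB B)"
      unfolding measurable_cong_sets[OF sp refl] case_prod_beta
      by (intro measurable_compose[OF _ measurable_ennreal] borel_measurable_times borel_measurable_const
          measurable_Phi measurable_compose[OF measurable_fst measurable_coord_D0]
          measurable_compose[OF measurable_snd measurable_coord_D0])
    have "(\<integral>\<^sup>+ x. \<integral>\<^sup>+ z. ennreal (s * Phi B z x) \<partial>A (X(i := origin)) \<partial>DB B)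
      = (\<integral>\<^sup>+ z. \<integral>\<^sup>+ x. ennreal (s * Phi B z x) \<partial>DB B \<partial>A (X(i := origin)))"
      by (rule Fubini'[OF m])
    then show "(\<integral>\<^sup>+ x. \<integral>\<^sup>+ z. ennreal (s * Phi B z ((X(i := x)) i)) \<partial>A ((X(i := x))(i := origin)) \<partial>DB B)
      = (\<integral>\<^sup>+ z. \<integral>\<^sup>+ x. ennreal (Phi B z x) \<partial>DB B \<partial>A (X(i := origin)))"
      by (simp only: fun_upd_same fun_upd_upd inner)
  qed
  finally show ?thesis .
qed

lemma sens0_le:
  assumes B: "B \<in> space box" and i: "i < n" and s: "s = 1 \<or> s = -1"
  shows "sens0 B i s \<le> ennreal (10 * b\<^sup>2 * real d)"
proof -
  interpret P: prob_space "\<Pi>\<^sub>M j\<in>{..<n} - {i}. DB B" by (intro prob_space_PiM prob_space_DB)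
  have "sens0 B i s \<le> (\<integral>\<^sup>+ X. \<integral>\<^sup>+ z. ennreal (10 * b\<^sup>2 * real d) \<partial>A (X(i := origin)) \<partial>(\<Pi>\<^sub>M j\<in>{..<n} - {i}. DB B))"
    unfolding sens0_eq[OF assms] by (intro nn_integral_mono Phi_symmetric(2)[OF B])
  also have "\<dots> = (\<integral>\<^sup>+ X. ennreal (10 * b\<^sup>2 * real d) \<partial>(\<Pi>\<^sub>M j\<in>{..<n} - {i}. DB B))"
  proof (rule nn_integral_cong)
    fix X assume "X \<in> space (\<Pi>\<^sub>M j\<in>{..<n} - {i}. DB B)"
    then have Y: "X(i := origin) \<in> space base_sample"
      using i origin_space by (auto simp: space_PiM PiE_iff extensional_def space_DB)
    show "(\<integral>\<^sup>+ z. ennreal (10 * b\<^sup>2 * real d) \<partial>A (X(i := origin))) = ennreal (10 * b\<^sup>2 * real d)"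
      by (simp add: prob_space.emeasure_space_1[OF A_prob[OF Y]])
  qed
  finally show ?thesis by (simp add: P.emeasure_space_1)
qed

text \<open>The mean is p - q, the masses of the positive and negative parts. Privacy gives p <=
  exp(\<epsilon>) k + error and q >= exp(-\<epsilon>) k - error with one common k <= 10 b^2 d, so
  the difference is of order \<epsilon> k.\<close>

lemma Phi_joint:
  assumes B: "B \<in> space box" and i: "i < n"
  shows "integrable joint (\<lambda>\<omega>. Phi B (snd \<omega>) (fst \<omega> i) * lik n B (fst \<omega>))"
    and "(\<integral>\<^sup>+ \<omega>. ennreal \<bar>Phi B (snd \<omega>) (fst \<omega> i) * lik n B (fst \<omega>)\<bar> \<partial>joint) \<le> ennreal (10 * b\<^sup>2 * real d ^ 3)"
    and "(\<integral>\<omega>. Phi B (snd \<omega>) (fst \<omega> i) * lik n B (fst \<omega>) \<partial>joint) \<le>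
      30 * \<epsilon> * b\<^sup>2 * real d + 20 * \<delta> * b\<^sup>2 * real d ^ 3"
proof -
  let ?f = "\<lambda>\<omega>. Phi B (snd \<omega>) (fst \<omega> i) * lik n B (fst \<omega>)"
  let ?P = "datasets n (DB B)"
  let ?M = "10 * b\<^sup>2 * real d ^ 3" and ?k = "10 * b\<^sup>2 * real d"
  have m: "?f \<in> borel_measurable joint"
    unfolding measurable_cong_sets[OF sets_joint refl]
    by (intro borel_measurable_times measurable_Phi measurable_lik borel_measurable_const
      measurable_compose[OF measurable_fst entry_base_sample] measurable_compose[OF measurable_snd measurable_coord_D0] i)
  have s: "(\<integral>\<^sup>+ \<omega>. ennreal (s * ?f \<omega>) \<partial>joint) = sens B i s" for s
  proof -
    have "(\<integral>\<^sup>+ \<omega>. ennreal (s * ?f \<omega>) \<partial>joint)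
      = (\<integral>\<^sup>+ \<omega>. ennreal (s * Phi B (snd \<omega>) (fst \<omega> i)) * ennreal (lik n B (fst \<omega>)) \<partial>joint)"
      by (intro nn_integral_cong) (simp add: ennreal_mult''[symmetric] lik_nonneg mult.assoc)
    also have "\<dots> = sens B i s" unfolding sens_def
      by (rule nn_integral_joint_lik[OF Phi_base_sample_measurable[OF i]])
    finally show ?thesis .
  qed
  have "(\<integral>\<^sup>+ \<omega>. ennreal \<bar>?f \<omega>\<bar> \<partial>joint)
     \<le> (\<integral>\<^sup>+ \<omega>. ennreal (sens_bound B (fst \<omega> i)) * ennreal (lik n B (fst \<omega>)) \<partial>joint)"
    using Phi_le_sens_bound[OF B]
    by (intro nn_integral_mono)
       (simp add: ennreal_mult[symmetric] sens_bound_nonneg lik_nonneg abs_mult mult_right_mono ennreal_leI)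
  also have "\<dots> = (\<integral>\<^sup>+ X. \<integral>\<^sup>+ z. ennreal (sens_bound B (X i)) \<partial>A X \<partial>?P)"
  proof (rule nn_integral_joint_lik)
    have "(\<lambda>p. ennreal (sens_bound B (fst p i))) \<in> borel_measurable (base_sample \<Otimes>\<^sub>M D0)"
      by (rule measurable_compose[OF measurable_fst
            measurable_compose[OF coord_base_sample[OF i] measurable_compose[OF measurable_fixed_Phi(2) measurable_ennreal]]])
    then show "(\<lambda>(X, z). ennreal (sens_bound B (X i))) \<in> borel_measurable (base_sample \<Otimes>\<^sub>M D0)"
      by (simp only: case_prod_beta')
  qed
  also have "\<dots> = (\<integral>\<^sup>+ X. ennreal (sens_bound B (X i)) \<partial>?P)"
    by (intro nn_integral_cong) (simp add: prob_space.emeasure_space_1[OF A_prob] space_datasets_DB)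
  also have "\<dots> \<le> ennreal ?M" by (rule sens_bound_component(1)[OF i])
  finally show abs_le: "(\<integral>\<^sup>+ \<omega>. ennreal \<bar>?f \<omega>\<bar> \<partial>joint) \<le> ennreal ?M" .
  show int: "integrable joint ?f"
    using abs_le by (intro integrableI_bounded m) (auto intro: le_less_trans)
  have le_abs: "sens B i s \<le> ennreal ?M" if "\<bar>s\<bar> = 1" for s
  proof -
    have "s * ?f \<omega> \<le> \<bar>?f \<omega>\<bar>" for \<omega>
      using abs_ge_self[of "s * ?f \<omega>"] that by (simp add: abs_mult)
    then have "sens B i s \<le> (\<integral>\<^sup>+ \<omega>. ennreal \<bar>?f \<omega>\<bar> \<partial>joint)"
      unfolding s[symmetric] by (intro nn_integral_mono ennreal_leI)
    then show ?thesis using abs_le by (rule order_trans)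
  qed
  obtain p where p: "sens B i 1 = ennreal p" "0 \<le> p"
    using le_abs[of 1] by (cases "sens B i 1") (auto simp: top_unique)
  obtain q where q: "sens B i (-1) = ennreal q" "0 \<le> q"
    using le_abs[of "-1"] by (cases "sens B i (-1)") (auto simp: top_unique)
  obtain k where k: "sens0 B i 1 = ennreal k" "0 \<le> k"
    using sens0_le[OF B i, of 1] by (cases "sens0 B i 1") (auto simp: top_unique)
  \<comment> \<open>Both signs share the same \<open>k\<close>; without this the leading terms would
    not cancel.\<close>
  have k': "sens0 B i (-1) = ennreal k"
    using sens0_eq[OF B i, of 1] sens0_eq[OF B i, of "-1"] k by simp
  have k_le: "k \<le> ?k" using sens0_le[OF B i, of 1] k by (simp add: ennreal_le_iff)
  have M0: "0 \<le> \<delta> * ?M" using delta by simp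
  have "ennreal p \<le> ennreal (exp \<epsilon> * k + \<delta> * ?M)"
    using sens_le(1)[OF B i, of 1] p k M0 by (simp add: ennreal_mult ennreal_plus)
  then have p_le: "p \<le> exp \<epsilon> * k + \<delta> * ?M" using k M0 by (subst (asm) ennreal_le_iff) auto
  have "ennreal k \<le> ennreal (exp \<epsilon> * q + \<delta> * ?M)"
    using sens_le(2)[OF B i, of "-1"] q k' M0 by (simp add: ennreal_mult ennreal_plus)
  then have k_le2: "k \<le> exp \<epsilon> * q + \<delta> * ?M" using q M0 by (subst (asm) ennreal_le_iff) auto
  \<comment> \<open>For \<epsilon> at most 1 these give exp(\<epsilon>) - exp(-\<epsilon>) <= 2
    \<epsilon> + \<epsilon>^2 <= 3 \<epsilon>.\<close>
  have en: "exp (- \<epsilon>) \<le> 1" "1 - \<epsilon> \<le> exp (- \<epsilon>)" "exp \<epsilon> \<le> 1 + \<epsilon> + \<epsilon>\<^sup>2"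
    using eps exp_ge_add_one_self[of "- \<epsilon>"] exp_bound[of \<epsilon>] by auto
  have "exp (- \<epsilon>) * k \<le> exp (- \<epsilon>) * (exp \<epsilon> * q + \<delta> * ?M)"
    using k_le2 by (intro mult_left_mono) auto
  also have "\<dots> = q + exp (- \<epsilon>) * (\<delta> * ?M)"
    by (simp add: distrib_left mult.assoc[symmetric] mult_exp_exp)
  also have "\<dots> \<le> q + 1 * (\<delta> * ?M)" by (intro add_left_mono mult_right_mono en M0)
  finally have q_ge: "exp (- \<epsilon>) * k - \<delta> * ?M \<le> q" by simp
  have "\<epsilon>\<^sup>2 \<le> \<epsilon>" using eps by (simp add: power2_eq_square mult_left_le)
  then have "exp \<epsilon> - exp (- \<epsilon>) \<le> 3 * \<epsilon>" using en by linarith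
  then have "(exp \<epsilon> - exp (- \<epsilon>)) * k \<le> (3 * \<epsilon>) * ?k"
    using k k_le eps by (intro mult_mono) auto
  then have diff: "p - q \<le> 3 * \<epsilon> * ?k + 2 * (\<delta> * ?M)"
    using p_le q_ge by (simp add: algebra_simps)
  have "(\<integral>\<omega>. ?f \<omega> \<partial>joint) = p - q"
    unfolding real_lebesgue_integral_def[OF int] using s[of 1] s[of "-1"] p q by simp
  with diff show "(\<integral>\<omega>. ?f \<omega> \<partial>joint) \<le> 30 * \<epsilon> * b\<^sup>2 * real d + 20 * \<delta> * b\<^sup>2 * real d ^ 3"
    by (simp add: mult_ac)
qed

end

section \<open>Signal against total sensitivity, averaged over the prior\<close>

context private_sampler
begin

lemma integrable_box_jointI:
  fixes f :: "(nat \<times> nat \<Rightarrow> real) \<Rightarrow> (nat \<Rightarrow> nat \<Rightarrow> real) \<times> (nat \<Rightarrow> real) \<Rightarrow> real"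
  assumes m: "(\<lambda>(B, \<omega>). f B \<omega>) \<in> borel_measurable (box \<Otimes>\<^sub>M joint)"
    and le: "\<And>B. B \<in> space box \<Longrightarrow> (\<integral>\<^sup>+ \<omega>. ennreal \<bar>f B \<omega>\<bar> \<partial>joint) \<le> ennreal K"
  shows "integrable (box \<Otimes>\<^sub>M joint) (\<lambda>(B, \<omega>). f B \<omega>)"
proof (rule integrableI_bounded[OF m])
  have m': "(\<lambda>p. ennreal (norm (case p of (B, \<omega>) \<Rightarrow> f B \<omega>))) \<in> borel_measurable (box \<Otimes>\<^sub>M joint)"
    by (rule measurable_compose[OF measurable_compose[OF m borel_measurable_norm] measurable_ennreal])
  have "(\<integral>\<^sup>+ p. ennreal (norm (case p of (B, \<omega>) \<Rightarrow> f B \<omega>)) \<partial>(box \<Otimes>\<^sub>M joint))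
     = (\<integral>\<^sup>+ B. \<integral>\<^sup>+ \<omega>. ennreal \<bar>f B \<omega>\<bar> \<partial>joint \<partial>box)"
    by (subst joint.nn_integral_fst[OF m', symmetric]) (simp only: prod.case real_norm_def)
  also have "\<dots> \<le> (\<integral>\<^sup>+ B. ennreal K \<partial>box)" by (intro nn_integral_mono le)
  also have "\<dots> = ennreal K" by (simp add: box.emeasure_space_1)
  also have "\<dots> < \<infinity>" by simp
  finally show "(\<integral>\<^sup>+ p. ennreal (norm (case p of (B, \<omega>) \<Rightarrow> f B \<omega>)) \<partial>(box \<Otimes>\<^sub>M joint)) < \<infinity>" .
qed

text \<open>The same double integral is bounded below by accuracy and above by privacy. Both bounds
  hold for each \<open>B\<close>, whereas the identity linking them holds only after averaging over
  \<open>B\<close>; hence Fubini is used twice.\<close>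

lemma fingerprint_bound:
  assumes acc: "\<And>D. D \<in> gaussian_class d \<Longrightarrow> tv_dist D (output_dist n A D) \<le> \<alpha>"
  shows "b\<^sup>2 * real m * real (d - m) / 9 - 2 * \<alpha> \<le> real n * (30 * \<epsilon> * b\<^sup>2 * real d + 20 * \<delta> * b\<^sup>2 * real d ^ 3)"
proof -
  interpret P: pair_prob_space box joint ..
  let ?K = "30 * \<epsilon> * b\<^sup>2 * real d + 20 * \<delta> * b\<^sup>2 * real d ^ 3"
  define F where "F B \<omega> = zeta B (snd \<omega>) * lik n B (fst \<omega>)" for B \<omega>
  define G where "G i B \<omega> = Phi B (snd \<omega>) (fst \<omega> i) * lik n B (fst \<omega>)" for i B \<omega>
  define H where "H B \<omega> = (\<Sum>i<n. G i B \<omega>)" for B \<omega>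
  have F: "integrable (box \<Otimes>\<^sub>M joint) (\<lambda>(B, \<omega>). F B \<omega>)"
  proof (rule integrable_box_jointI)
    show "(\<lambda>(B, \<omega>). F B \<omega>) \<in> borel_measurable (box \<Otimes>\<^sub>M joint)"
      unfolding F_def by (rule zeta_joint_measurable)
    fix B assume B: "B \<in> space box"
    have "(\<integral>\<^sup>+ \<omega>. ennreal \<bar>F B \<omega>\<bar> \<partial>joint) \<le> (\<integral>\<^sup>+ \<omega>. ennreal (lik n B (fst \<omega>)) \<partial>joint)"
      using zeta_bound[OF B b_small] unfolding F_def
      by (intro nn_integral_mono ennreal_leI) (simp add: abs_mult lik_nonneg mult_left_le_one_le)
    also have "\<dots> = ennreal 1"
      using nn_integral_eq_integral[OF integral_lik(1)[of B]] integral_lik(2)[of B] by (simp add: lik_nonneg)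
    finally show "(\<integral>\<^sup>+ \<omega>. ennreal \<bar>F B \<omega>\<bar> \<partial>joint) \<le> ennreal 1" .
  qed
  have G: "integrable (box \<Otimes>\<^sub>M joint) (\<lambda>(B, \<omega>). G i B \<omega>)" if "i < n" for i
    unfolding G_def by (intro integrable_box_jointI[OF zeta_joint_measurable(2)[OF that] Phi_joint(2)[OF _ that]])
  have H: "integrable (box \<Otimes>\<^sub>M joint) (\<lambda>(B, \<omega>). H B \<omega>)"
    using G unfolding H_def case_prod_beta by (intro Bochner_Integration.integrable_sum) auto
  have id: "(\<integral>B. F B \<omega> \<partial>box) = (\<integral>B. H B \<omega> \<partial>box)" for \<omega>
    using fingerprint_identity[of "snd \<omega>" n "fst \<omega>"] by (simp add: F_def H_def G_def sum_distrib_right)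
  have "b\<^sup>2 * real m * real (d - m) / 9 - 2 * \<alpha> \<le> 2 / 3 * (\<integral>B. \<integral>x. low B x \<partial>D0 \<partial>box) - 2 * \<alpha>"
    using low_average(3)[OF b_small] by linarith
  also have "\<dots> = (\<integral>B. 2 / 3 * (\<integral>x. low B x \<partial>D0) - 2 * \<alpha> \<partial>box)"
    using low_average(2)[OF b_small] by (simp add: box.prob_space)
  also have "\<dots> \<le> (\<integral>B. \<integral>\<omega>. F B \<omega> \<partial>joint \<partial>box)"
  proof (rule integral_mono)
    show "integrable box (\<lambda>B. 2 / 3 * (\<integral>x. low B x \<partial>D0) - 2 * \<alpha>)"
      using low_average(2)[OF b_small] by simp
    show "integrable box (\<lambda>B. \<integral>\<omega>. F B \<omega> \<partial>joint)"
      using P.integrable_fst[OF F] by simp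
    fix B assume B: "B \<in> space box"
    have "DB B \<in> gaussian_class d" by (intro DB_in_gaussian_class box_range[OF B] b_small)
    then show "2 / 3 * (\<integral>x. low B x \<partial>D0) - 2 * \<alpha> \<le> (\<integral>\<omega>. F B \<omega> \<partial>joint)"
      using output_zeta[OF B acc] zeta_DB_lower[OF B b_small low_average(1)[OF b_small B]] by (simp add: F_def)
  qed
  also have "\<dots> = (\<integral>\<omega>. \<integral>B. F B \<omega> \<partial>box \<partial>joint)" by (rule P.Fubini_integral[OF F, symmetric])
  \<comment> \<open>Integration by parts in \<open>B\<close>, pointwise in the dataset and the
    output.\<close>
  also have "\<dots> = (\<integral>\<omega>. \<integral>B. H B \<omega> \<partial>box \<partial>joint)" by (simp only: id)
  also have "\<dots> = (\<integral>B. \<integral>\<omega>. H B \<omega> \<partial>joint \<partial>box)" by (rule P.Fubini_integral[OF H])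
  also have "\<dots> \<le> (\<integral>B. real n * ?K \<partial>box)"
  proof (rule integral_mono)
    show "integrable box (\<lambda>B. \<integral>\<omega>. H B \<omega> \<partial>joint)"
      using P.integrable_fst[OF H] by simp
    fix B assume B: "B \<in> space box"
    have "(\<integral>\<omega>. H B \<omega> \<partial>joint) = (\<Sum>i<n. \<integral>\<omega>. G i B \<omega> \<partial>joint)"
      unfolding H_def G_def by (intro Bochner_Integration.integral_sum Phi_joint(1) B) simp
    also have "\<dots> \<le> (\<Sum>i<n. ?K)"
      unfolding G_def by (intro sum_mono Phi_joint(3) B) simp
    finally show "(\<integral>\<omega>. H B \<omega> \<partial>joint) \<le> real n * ?K" by simp
  qed simp
  also have "\<dots> = real n * ?K" by (simp add: box.prob_space)
  finally show ?thesis .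
qed

end

text \<open>With b = 1/(40 d) the signal is at least (2/9)(1/1600)/9 = 1/64800. The thresholds on
  \<alpha> and on \<delta> n d^2 make the two losses small against this, and the remainder divided
  by 30/1600 exceeds 1/1500.\<close>

lemma sample_complexity:
  fixes d n :: nat
  assumes d: "2 \<le> d" and eps: "0 < \<epsilon>" "\<epsilon> \<le> 1" and delta: "0 < \<delta>"
    and \<alpha>: "\<alpha> \<le> 1 / 10^6" and C: "\<delta> * (real n * (real d)\<^sup>2) \<le> 1 / 10^4"
    and acc: "accurate_sampler n (euclid d) (gaussian_class d) \<alpha> A"
    and dp: "diff_private n (euclid d) \<epsilon> \<delta> A"
  shows "real d / (1500 * \<epsilon>) \<le> real n"
proof -
  define m where "m = d div 2"
  define b where "b = 1 / (40 * real d)"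
  have d0: "0 < real d" using d by simp
  interpret private_sampler d m b n A \<epsilon> \<delta>
    by unfold_locales (use d eps delta acc dp in \<open>auto simp: m_def b_def accurate_sampler_def\<close>)
  have main: "b\<^sup>2 * real m * real (d - m) / 9 - 2 * \<alpha> \<le> real n * (30 * \<epsilon> * b\<^sup>2 * real d + 20 * \<delta> * b\<^sup>2 * real d ^ 3)"
    using acc by (intro fingerprint_bound) (auto simp: accurate_sampler_def)
  \<comment> \<open>The worst case is d = 3, where the halves 1 and 2 give equality; for odd d the
    claim reduces to (m - 1)(m + 2) >= 0.\<close>
  have mm: "2 / 9 * (real d)\<^sup>2 \<le> real m * real (d - m)"
  proof -
    have dm: "d = m + (d - m)" and c: "d - m = m \<or> d - m = m + 1" and m1: "1 \<le> m" using d by (auto simp: m_def)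
    from c show ?thesis
    proof
      assume "d - m = m"
      then have "real d = 2 * real m" using dm by simp
      then show ?thesis using \<open>d - m = m\<close> by (simp add: power2_eq_square)
    next
      assume e: "d - m = m + 1"
      then have rd: "real d = 2 * real m + 1" using dm by simp
      have "0 \<le> (real m - 1) * (real m + 2)" using m1 by simp
      then show ?thesis unfolding rd e by (simp add: power2_eq_square algebra_simps)
    qed
  qed
  have bd2: "b\<^sup>2 * (real d)\<^sup>2 = 1 / 1600" using d0 by (simp add: b_def power2_eq_square)
  have lhs: "1 / 64800 \<le> b\<^sup>2 * real m * real (d - m) / 9"
  proof -
    have "2 / 9 * (b\<^sup>2 * (real d)\<^sup>2) \<le> b\<^sup>2 * real m * real (d - m)"
      using mult_left_mono[OF mm, of "b\<^sup>2"] by (simp only: mult.assoc mult.left_commute zero_le_power2)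
    then show ?thesis unfolding bd2 by linarith
  qed
  have e1: "real n * (30 * \<epsilon> * b\<^sup>2 * real d) = 30 / 1600 * (real n * \<epsilon> / real d)"
    using d0 by (simp add: b_def power2_eq_square field_simps)
  have "real n * (20 * \<delta> * b\<^sup>2 * real d ^ 3) = 20 * (\<delta> * (real n * (real d)\<^sup>2)) * (b\<^sup>2 * real d)"
    by (simp add: power2_eq_square power3_eq_cube)
  also have "\<dots> \<le> 20 * (1 / 10^4) * (b\<^sup>2 * real d)"
    using C by (intro mult_right_mono mult_left_mono) auto
  also have "b\<^sup>2 * real d \<le> 1 / 3200"
    using d d0 by (simp add: b_def power2_eq_square field_simps)
  finally have e2: "real n * (20 * \<delta> * b\<^sup>2 * real d ^ 3) \<le> 20 * (1 / 10^4) * (1 / 3200)" by simp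
  define y where "y = real n * \<epsilon> / real d"
  have "1 / 64800 - 2 * (1 / 10^6) - 20 * (1 / 10^4) * (1 / 3200) \<le> 30 / 1600 * y"
    unfolding y_def using main lhs \<alpha> e1 e2 unfolding distrib_left by linarith
  then have "1 / 1500 \<le> y" by simp
  then show ?thesis unfolding y_def using d0 eps by (simp add: field_simps)
qed

theorem theorem5:
  shows "\<exists>\<alpha>\<^sub>0>0. \<exists>C>0. \<exists>c>0. \<forall>(\<alpha>::real) (\<epsilon>::real) (\<delta>::real) (d::nat) (n::nat) A.
    0 < \<alpha> \<and> \<alpha> \<le> \<alpha>\<^sub>0 \<and> 0 < \<epsilon> \<and> \<epsilon> \<le> 1 \<and> 0 < \<delta> \<and> \<delta> \<le> 1 / 2 \<and> 2 \<le> d \<and>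
    \<delta> * (real n * (real d)\<^sup>2) \<le> C \<and>
    accurate_sampler n (euclid d) (gaussian_class d) \<alpha> A \<and>
    diff_private n (euclid d) \<epsilon> \<delta> A
    \<longrightarrow> real n \<ge> c * (real d / (\<epsilon> * sqrt (ln (real d))))"
proof (intro exI conjI allI impI)
  fix \<alpha> \<epsilon> \<delta> :: real and d n :: nat and A
  assume h: "0 < \<alpha> \<and> \<alpha> \<le> 1 / 10^6 \<and> 0 < \<epsilon> \<and> \<epsilon> \<le> 1 \<and> 0 < \<delta> \<and> \<delta> \<le> 1 / 2 \<and> 2 \<le> d \<and>
    \<delta> * (real n * (real d)\<^sup>2) \<le> 1 / 10^4 \<and>
    accurate_sampler n (euclid d) (gaussian_class d) \<alpha> A \<and>
    diff_private n (euclid d) \<epsilon> \<delta> A"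
  then have n: "real d / (1500 * \<epsilon>) \<le> real n" by (intro sample_complexity[where \<delta> = \<delta> and \<alpha> = \<alpha>]) auto
  \<comment> \<open>From ln(1/2) <= -1/2. For d >= 2 the root of the logarithm is thus at least 1/2,
    so dividing by it costs only the factor 2 between 1/1500 and 1/3000.\<close>
  have "(1/2)\<^sup>2 \<le> ln (2::real)"
    using ln_add_one_self_le_self2[of "-1/2"] by (simp add: ln_div power2_eq_square)
  also have "\<dots> \<le> ln (real d)" using h by simp
  finally have s: "1 / 2 \<le> sqrt (ln (real d))" by (rule real_le_rsqrt)
  have "1 / 3000 * (real d / (\<epsilon> * sqrt (ln (real d)))) \<le> 1 / 3000 * (real d / (\<epsilon> * (1 / 2)))"
    using h s by (intro mult_left_mono divide_left_mono mult_pos_pos) auto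
  also have "\<dots> = real d / (1500 * \<epsilon>)" by simp
  finally show "1 / 3000 * (real d / (\<epsilon> * sqrt (ln (real d)))) \<le> real n" using n by simp
qed simp_all

end
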